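(* The system $(Y,\nu,T)$ is prime, i.e. every factor map on $(Y,\nu,T)$ is, mod null sets, either an isomorphism or a map to a one point system.
   Context: Let $a_i=k$ if $i=10^k$ for some integer $k\ge 2$, and $a_i=8$ otherwise ($i\ge 1$). Let $X=\prod_{i\ge1}\{0,\dots,a_i-1\}$ with the product topology, and $S\colon X\to X$ the odometer (addition of $(1,0,0,\dots)$ with carry to the right), with its unique invariant probability measure $\mu$. Let $Z_k=\{\mathbf x\in X: x_k=7,\ x_i=a_i-2\text{ for all }i<k\}$ and $W_k=\{\mathbf x\in X: x_i=a_i-2\text{ for all }i<10^{2k},\ x_{10^{2k}}<a_{10^{2k}}/2\}$. Put $Y=X\setminus\bigl(\bigcup_{\ell\notin\{10^k:k\ge2\}}Z_\ell\cup\bigcup_{k\ge2}W_k\bigr)$, let $T\colon Y\to Y$ be the first return map of $S$ to $Y$, and $\nu=\mu(Y)^{-1}\mu|_Y$. A factor of $(Y,\nu,T)$ is a system $(Z,\rho,R)$ with a measurable map $\pi\colon Y\to Z$ such that $\nu\circ\pi^{-1}=\rho$ and $\pi\circ T=R\circ\pi$ $\nu$-a.e. *)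

theory Defs
  imports "HOL-Probability.Probability"
begin

section \<open>Measure-preserving systems, factors, isomorphisms\<close>

definition borel_of_top :: "'a topology \<Rightarrow> 'a measure" where
  "borel_of_top \<tau> = sigma (topspace \<tau>) {U. openin \<tau> U}"

definition standard_borel_space :: "'a measure \<Rightarrow> bool" where
  "standard_borel_space M \<longleftrightarrow>
     (\<exists>\<tau>. completely_metrizable_space \<tau> \<and> second_countable \<tau> \<and> sets M = sets (borel_of_top \<tau>))"

definition measure_preserving_on :: "'a measure \<Rightarrow> ('a \<Rightarrow> 'a) \<Rightarrow> bool" where
  "measure_preserving_on M R \<longleftrightarrow> R \<in> measurable M M \<and> distr M M R = M"

text \<open>Systems live on standard probability spaces, as is needed for statements about
  point maps modulo null sets. The transformation is not required to be invertible.\<close>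

definition mp_system :: "'a measure \<Rightarrow> ('a \<Rightarrow> 'a) \<Rightarrow> bool" where
  "mp_system M R \<longleftrightarrow> prob_space M \<and> standard_borel_space M \<and> measure_preserving_on M R"

definition factor_map ::
  "'a measure \<Rightarrow> ('a \<Rightarrow> 'a) \<Rightarrow> 'b measure \<Rightarrow> ('b \<Rightarrow> 'b) \<Rightarrow> ('a \<Rightarrow> 'b) \<Rightarrow> bool" where
  "factor_map N T M R \<pi> \<longleftrightarrow>
     mp_system M R \<and> \<pi> \<in> measurable N M \<and> distr N M \<pi> = M \<and> (AE y in N. \<pi> (T y) = R (\<pi> y))"

definition iso_mod_null ::
  "'a measure \<Rightarrow> ('a \<Rightarrow> 'a) \<Rightarrow> 'b measure \<Rightarrow> ('b \<Rightarrow> 'b) \<Rightarrow> ('a \<Rightarrow> 'b) \<Rightarrow> bool" where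
  "iso_mod_null N T M R \<pi> \<longleftrightarrow>
     factor_map N T M R \<pi> \<and>
     (\<exists>A B. A \<in> sets N \<and> emeasure N (space N - A) = 0 \<and> T ` A \<subseteq> A \<and>
            B \<in> sets M \<and> emeasure M (space M - B) = 0 \<and> R ` B \<subseteq> B \<and>
            bij_betw \<pi> A B \<and>
            \<pi> \<in> measurable (restrict_space N A) (restrict_space M B) \<and>
            the_inv_into A \<pi> \<in> measurable (restrict_space M B) (restrict_space N A) \<and>
            (\<forall>y\<in>A. \<pi> (T y) = R (\<pi> y)))"

definition one_point_mod_null ::
  "'a measure \<Rightarrow> ('a \<Rightarrow> 'a) \<Rightarrow> 'b measure \<Rightarrow> ('b \<Rightarrow> 'b) \<Rightarrow> ('a \<Rightarrow> 'b) \<Rightarrow> bool" where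
  "one_point_mod_null N T M R \<pi> \<longleftrightarrow>
     factor_map N T M R \<pi> \<and> (\<exists>z\<in>space M. R z = z \<and> (AE y in N. \<pi> y = z))"

text \<open>Where a point never returns to \<open>Y\<close>, the value of \<open>first_return\<close> is unspecified.\<close>

definition first_return :: "('a \<Rightarrow> 'a) \<Rightarrow> 'a set \<Rightarrow> 'a \<Rightarrow> 'a" where
  "first_return S Y x = (S ^^ (LEAST n. n \<ge> 1 \<and> (S ^^ n) x \<in> Y)) x"

definition normalized_restriction :: "'a measure \<Rightarrow> 'a set \<Rightarrow> 'a measure" where
  "normalized_restriction M Y = scale_measure (inverse (emeasure M Y)) (restrict_space M Y)"

section \<open>The odometer and the induced system\<close>

text \<open>Coordinates are indexed by \<open>{1..}\<close>; points are extensional functions on that set.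
  All bases are at least 2, so the truncated subtractions below are exact.\<close>

definition odo_a :: "nat \<Rightarrow> nat" where
  "odo_a i = (if \<exists>k\<ge>2. i = 10 ^ k then (THE k. i = 10 ^ k) else 8)"

definition odo_top :: "(nat \<Rightarrow> nat) topology" where
  "odo_top = product_topology (\<lambda>i. discrete_topology {..<odo_a i}) {1..}"

definition odo_X :: "(nat \<Rightarrow> nat) set" where
  "odo_X = topspace odo_top"

text \<open>Coordinate \<open>i\<close> receives a carry iff all earlier coordinates are maximal; in particular
  coordinate \<open>1\<close> is always incremented.\<close>

definition odo_S :: "(nat \<Rightarrow> nat) \<Rightarrow> nat \<Rightarrow> nat" where
  "odo_S x = (\<lambda>i\<in>{1..}. if \<forall>j\<in>{1..<i}. x j = odo_a j - 1 then (x i + 1) mod odo_a i else x i)"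

definition odo_Z :: "nat \<Rightarrow> (nat \<Rightarrow> nat) set" where
  "odo_Z k = {x \<in> odo_X. x k = 7 \<and> (\<forall>i\<in>{1..<k}. x i = odo_a i - 2)}"

definition odo_W :: "nat \<Rightarrow> (nat \<Rightarrow> nat) set" where
  "odo_W k = {x \<in> odo_X. (\<forall>i\<in>{1..<10 ^ (2 * k)}. x i = odo_a i - 2) \<and>
                 real (x (10 ^ (2 * k))) < real (odo_a (10 ^ (2 * k))) / 2}"

definition odo_Y :: "(nat \<Rightarrow> nat) set" where
  "odo_Y = odo_X - ((\<Union>l\<in>{1..} - {10 ^ k | k. k \<ge> 2}. odo_Z l) \<union> (\<Union>k\<in>{2..}. odo_W k))"

definition odo_T :: "(nat \<Rightarrow> nat) \<Rightarrow> nat \<Rightarrow> nat" where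
  "odo_T = first_return odo_S odo_Y"

definition invariant_odometer_measure :: "(nat \<Rightarrow> nat) measure \<Rightarrow> bool" where
  "invariant_odometer_measure \<mu> \<longleftrightarrow>
     sets \<mu> = sets (borel_of_top odo_top) \<and> prob_space \<mu> \<and> measure_preserving_on \<mu> odo_S"

end

theory Submission
  imports Defs "HOL-Probability.Probability"
begin

text \<open>After adding 1 to every digit of the odometer, the induced map becomes a cutting and stacking
  construction: the tower of level \<open>l\<close> consists of copies of the previous one, some of which lost their top set. Let \<open>B\<close>
  be a nontrivial set of a factor. If \<open>B\<close> is nearly invariant under \<open>T^n\<close>, comparing \<open>x\<close> and
  \<open>T^n x\<close> along windows translated by a tower height shows that both meet the same pattern of lost top sets
  at all high levels; applied to the multiples of \<open>n\<close>, this forces \<open>T^n\<close> to be close to the identity on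
  every fixed level. Special levels \<open>10^k\<close> with \<open>k\<close> odd have no lost sets, so there the towers are
  traversed cyclically, and in the relatively independent self-joining over the factor two points are on average as far apart
  on level sets as \<open>x\<close> and \<open>T^n x\<close> for a suitable \<open>n\<close>. As the joining identifies \<open>B\<close> with itself,
  it lives on the diagonal, so the factor is everything.\<close>

section \<open>Combinatorics of towers\<close>

text \<open>Except in the last copy, translating by a tower height raises the height of a point by
  one if its copy is short and keeps it otherwise. If two orbits match before and after such a
  translation, they were displaced alike, since otherwise one orbit would match itself displaced by
  one step. This pins down digits only up to the classes of \<open>st\<close>, which are coarser
  than digits on special levels. As \<open>blk\<close> is affine on a class, second differences of
  heights stay controlled: the plain level below each special one (\<open>isolated\<close>) makes
  them too small to be a nonzero multiple of the slope.

  Two obstacles shape the measure theory. Disagreement may occur at infinitely many levels, so one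
  error term per level would not sum; charging each point only to its first level of disagreement
  gives disjoint parts of a single event. And the map of a factor need not be invertible, so its
  sigma-algebra is only known to contain preimages under \<open>TT 1\<close>. Invariance of the
  self-joining is recovered from rigidity, by which every set is close to one of its own later
  preimages.\<close>

locale tower_shape =
  fixes A :: "nat \<Rightarrow> int" and Sh :: "nat \<Rightarrow> int set"
  assumes shape: "(A l = 8 \<and> Sh l = {0}) \<or> (A l \<ge> 2 \<and> Sh l = {}) \<or> (\<exists>k\<ge>2. A l = 2 * k \<and> Sh l = {1..k})"
    and isolated: "\<not> (A l = 8 \<and> Sh l = {0}) \<Longrightarrow> l \<ge> 1 \<and> A (l - 1) = 8 \<and> Sh (l - 1) = {0}"
    and uncut: "\<exists>l\<ge>K. Sh l = {} \<and> A l \<ge> int K"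
begin

abbreviation plain :: "nat \<Rightarrow> bool" where
  "plain l \<equiv> A l = 8 \<and> Sh l = {0}"

fun h :: "nat \<Rightarrow> int" where
  "h 0 = 1"
| "h (Suc l) = (\<Sum>i\<in>{0..<A l}. h l - of_bool (i \<in> Sh l))"

text \<open>The height at which copy \<open>c\<close> starts inside the tower of level
  \<open>Suc l\<close>.\<close>

definition blk :: "nat \<Rightarrow> int \<Rightarrow> int" where
  "blk l c = (\<Sum>i\<in>{0..<c}. h l - of_bool (i \<in> Sh l))"

lemma shape_cases:
  obtains (plain) "A l = 8" "Sh l = {0}" | (uncut) "A l \<ge> 2" "Sh l = {}"
    | (cut) k where "k \<ge> 2" "A l = 2 * k" "Sh l = {1..k}"
  using shape[of l] by blast

lemma A_ge2: "A l \<ge> 2"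
  by (cases l rule: shape_cases) simp_all

lemma top_notin_Sh: "A l - 1 \<notin> Sh l"
  by (cases l rule: shape_cases) simp_all

lemma blk_0 [simp]: "blk l 0 = 0"
  by (simp add: blk_def)

lemma blk_step: "0 \<le> c \<Longrightarrow> blk l (c + 1) = blk l c + h l - of_bool (c \<in> Sh l)"
proof -
  assume "0 \<le> c"
  hence "{0..<c + 1} = insert c {0..<c}" by auto
  thus ?thesis by (simp add: blk_def)
qed

lemma h_Suc: "h (Suc l) = blk l (A l)"
  by (simp add: blk_def)

declare h.simps(2) [simp del]

lemma h_Suc_plain: "plain l \<Longrightarrow> h (Suc l) = 8 * h l - 1"
proof -
  assume p: "plain l"
  have e: "{0..<8::int} = {0,1,2,3,4,5,6,7}" by auto
  show ?thesis using p by (simp add: h_Suc blk_def e)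
qed

lemma blk_uncut: assumes "Sh l = {}" "0 \<le> c" shows "blk l c = h l * c"
  using assms(2)
proof (induction c rule: int_ge_induct)
  case base show ?case by simp
next
  case (step i) thus ?case using blk_step[of i l] assms(1) by (simp add: algebra_simps)
qed

lemma blk_interval:
  assumes "Sh l = {1..k}" "0 \<le> k" "0 \<le> c"
  shows "blk l c = (if c = 0 then 0 else if c \<le> k then h l * c - (c - 1) else h l * c - k)"
  using assms(3)
proof (induction c rule: int_ge_induct)
  case base show ?case by simp
next
  case (step i)
  have e: "blk l (i + 1) = blk l i + h l - of_bool (1 \<le> i \<and> i \<le> k)"
    using blk_step[of i l] step(1) assms(1) by simp
  show ?case unfolding e step(2) using step(1) assms(2)
    by (cases "i = k") (auto simp: of_bool_def distrib_left)
qed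

text \<open>Positivity and growth go together: in the cut case \<open>k\<close> sets are lost, and
  \<open>h l \<ge> 1\<close> with \<open>k \<ge> 2\<close> still leaves
  \<open>h l * (2 * k) - k \<ge> 2 * h l\<close>.\<close>

lemma h_pos_Suc_ge: "h l \<ge> 1 \<and> h (Suc l) \<ge> 2 * h l"
proof (induction l)
  case 0
  have "plain 0" using isolated[of 0] by auto
  thus ?case using h_Suc_plain by auto
next
  case (Suc l)
  hence h1: "h (Suc l) \<ge> 1" by auto
  consider "plain (Suc l)" | "A (Suc l) \<ge> 2" "Sh (Suc l) = {}" | k where "k \<ge> 2" "A (Suc l) = 2 * k" "Sh (Suc l) = {1..k}"
    using shape[of "Suc l"] by blast
  hence "h (Suc (Suc l)) \<ge> 2 * h (Suc l)"
  proof cases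
    case 1 thus ?thesis using h_Suc_plain[OF 1] h1 by simp
  next
    case 2
    have "h (Suc (Suc l)) = h (Suc l) * A (Suc l)" using blk_uncut[OF 2(2)] 2 by (simp add: h_Suc)
    moreover have "h (Suc l) * A (Suc l) \<ge> h (Suc l) * 2" using 2(1) h1 by (intro mult_left_mono) auto
    ultimately show ?thesis by simp
  next
    case 3
    have "h (Suc (Suc l)) = h (Suc l) * (2*k) - k" using blk_interval[OF 3(3)] 3 by (simp add: h_Suc)
    hence "h (Suc (Suc l)) = h (Suc l) * 2 + 2 * (h (Suc l) * (k - 2)) + h (Suc l) + h (Suc l) - k" by (simp add: algebra_simps)
    moreover have "h (Suc l) * (k - 2) \<ge> k - 2" using 3(1) h1 by (simp add: mult_le_cancel_right1)
    ultimately show ?thesis using h1 3 by linarith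
  qed
  thus ?case using h1 by simp
qed

lemma h_ge1: "h l \<ge> 1" and h_Suc_ge: "h (Suc l) \<ge> 2 * h l"
  using h_pos_Suc_ge by auto

lemma h_mono: "l \<le> m \<Longrightarrow> h l \<le> h m"
proof (induction rule: dec_induct)
  case (step n) thus ?case using h_Suc_ge[of n] h_ge1[of n] by linarith
qed simp

lemma h_ge_self: "h l \<ge> int l + 1"
proof (induction l)
  case (Suc l) thus ?case using h_Suc_ge[of l] by simp
qed simp

lemma blk_mono: assumes "0 \<le> c" "c \<le> d" shows "blk l c \<le> blk l d"
  using assms(2)
proof (induction d rule: int_ge_induct)
  case (step i) thus ?case using blk_step[of i l] assms(1) h_ge1[of l] by (auto simp: of_bool_def split: if_splits)
qed simp

lemma blk_top: "blk l (A l - 1) = h (Suc l) - h l"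
proof -
  have "blk l (A l - 1 + 1) = blk l (A l - 1) + h l - of_bool (A l - 1 \<in> Sh l)"
    using A_ge2[of l] by (intro blk_step) simp
  thus ?thesis by (simp add: h_Suc top_notin_Sh)
qed

lemma blk_le_top: "0 \<le> c \<Longrightarrow> c < A l \<Longrightarrow> blk l c \<le> h (Suc l) - h l"
  using blk_mono[of c "A l - 1" l] by (simp add: blk_top)

lemma blk_nonneg: "0 \<le> c \<Longrightarrow> 0 \<le> blk l c"
  using blk_mono[of 0 c l] by simp

text \<open>Different copies occupy disjoint intervals of heights, where a short copy has one height
  less.\<close>

lemma blk_decode:
  assumes "0 \<le> c" "0 \<le> c'" "0 \<le> s" "0 \<le> s'"
    "s + of_bool (c \<in> Sh l) < h l" "s' + of_bool (c' \<in> Sh l) < h l"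
    "blk l c + s = blk l c' + s'"
  shows "c = c' \<and> s = s'"
proof -
  have 1: "\<not> c < c'"
    using blk_mono[of "c+1" c' l] blk_step[of c l] assms by linarith
  have 2: "\<not> c' < c"
    using blk_mono[of "c'+1" c l] blk_step[of c' l] assms by linarith
  from 1 2 have "c = c'" by simp
  thus ?thesis using assms(7) by simp
qed

text \<open>A point is coded by \<^term>\<open>t l\<close>, its height in the tower of level \<^term>\<open>l\<close> (a column of
  \<^term>\<open>h l\<close> sets), and \<^term>\<open>d l\<close>, the number of the copy of that tower in which it lies inside the next one.
  The copies with number in \<^term>\<open>Sh l\<close> have lost their top set.\<close>

definition pt :: "(nat \<Rightarrow> int) \<Rightarrow> (nat \<Rightarrow> int) \<Rightarrow> bool" where
  "pt t d \<longleftrightarrow> (\<forall>l. 0 \<le> t l \<and> 0 \<le> d l \<and> d l < A l \<and> t l + of_bool (d l \<in> Sh l) < h l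
      \<and> t (Suc l) = blk l (d l) + t l)"

lemma ptD:
  assumes "pt t d"
  shows "0 \<le> t l" "0 \<le> d l" "d l < A l" "t l + of_bool (d l \<in> Sh l) < h l"
    "t (Suc l) = blk l (d l) + t l" "t l < h l"
proof -
  show "t l + of_bool (d l \<in> Sh l) < h l" using assms unfolding pt_def by blast
  thus "t l < h l" by (auto simp: of_bool_def split: if_splits)
qed (use assms in \<open>auto simp: pt_def\<close>)

text \<open>Passing to a higher tower only adds sets below and above a column, so the distances to
  bottom and top never decrease and a margin at level \<open>l\<close> persists.\<close>

lemma pt_grow: assumes "pt t d" "l \<le> m" shows "t l \<le> t m \<and> t m - t l \<le> h m - h l"
  using assms(2)
proof (induction rule: dec_induct)
  case (step n)
  note p = ptD[OF assms(1), of n]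
  show ?case using step blk_le_top[OF p(2,3)] blk_nonneg[OF p(2), of n] p(5) by linarith
qed simp

text \<open>Decoding from the top level down: a translation that stays inside the column of level
  \<open>l\<close> changes no digit from level \<open>l\<close> on. The spare \<open>+ 1\<close> in
  \<open>hi\<close> allows for columns that lost their top set.\<close>

lemma pt_shift:
  assumes p: "pt t d" and p': "pt t' d'" and eq: "t' m = t m + z"
    and lo: "0 \<le> t l + z" and hi: "t l + z + 1 < h l" and i: "l \<le> i" "i \<le> m"
  shows "t' i = t i + z" and "i < m \<Longrightarrow> d' i = d i"
proof -
  have key: "t' (Suc j) = t (Suc j) + z \<Longrightarrow> t' j = t j + z \<and> d' j = d j" if "l \<le> j" for j
  proof -
    assume a: "t' (Suc j) = t (Suc j) + z"
    note q = ptD[OF p, of j] and q' = ptD[OF p', of j]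
    have g: "t l \<le> t j" "t j - t l \<le> h j - h l" using pt_grow[OF p that] by auto
    have e: "blk j (d' j) + t' j = blk j (d j) + (t j + z)" using a q q' by linarith
    have 1: "0 \<le> t j + z" using g lo by linarith
    have "t j + z + 1 < h j" using g hi by linarith
    hence 2: "t j + z + of_bool (d j \<in> Sh j) < h j" by (auto simp: of_bool_def)
    show ?thesis using blk_decode[OF q'(2) q(2) q'(1) 1 q'(4) 2 e] by simp
  qed
  have *: "t' i = t i + z" if "l \<le> i" "i \<le> m" for i using that(2,1)
  proof (induction rule: inc_induct)
    case base show ?case by (rule eq)
  next
    case (step n) thus ?case using key[of n] by simp
  qed
  show "t' i = t i + z" using * i by simp
  show "d' i = d i" if "i < m" using *[of "Suc i"] i key[of i] that by simp
qed

text \<open>Going up by the height of the column leads to the next copy in cyclic order, one place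
  higher if the copy being left is short. On leaving the last copy, higher levels decide, and only
  \<open>b = 0 \<or> b = 1\<close> is known.\<close>

lemma pt_block_step:
  assumes "pt t d" "pt t' d'" "t' m = t m + h l" "l \<le> m" "t l + 2 < h l"
  shows "\<exists>b. (b = 0 \<or> b = 1) \<and> t' l = t l + b \<and> d' l = (d l + 1) mod A l
     \<and> (d l \<in> Sh l \<longrightarrow> b = 1) \<and> (d l \<notin> Sh l \<and> d l \<noteq> A l - 1 \<longrightarrow> b = 0)"
  using assms
proof (induction "m - l" arbitrary: l t d)
  case 0
  hence "m = l" by simp
  thus ?case using 0 ptD(6)[OF 0(3), of l] ptD(1)[OF 0(2), of l] by simp
next
  case (Suc n)
  note p = Suc.prems(1) and p' = Suc.prems(2)
  note q = ptD[OF p, of l] and q' = ptD[OF p', of l]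
  have lm: "Suc l \<le> m" using Suc.hyps(2) by simp
  show ?case
  proof (cases "d l < A l - 1")
    case True
    define b :: int where "b = of_bool (d l \<in> Sh l)"
    have b: "b = 0 \<or> b = 1" by (simp add: b_def)
    have e: "t (Suc l) + h l = blk l (d l + 1) + (t l + b)"
      using blk_step[OF q(2), of l] q(5) unfolding b_def by linarith
    have le: "blk l (d l + 1) \<le> h (Suc l) - h l" using blk_le_top[of "d l + 1" l] q True by simp
    have hi: "t (Suc l) + h l + 1 < h (Suc l)" using e le b Suc.prems(5) by linarith
    have lo: "0 \<le> t (Suc l) + h l" using ptD(1)[OF p, of "Suc l"] h_ge1[of l] by linarith
    have "t' (Suc l) = t (Suc l) + h l" 
      using pt_shift(1)[OF p p' Suc.prems(3) lo hi order_refl lm] .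
    hence e2: "blk l (d' l) + t' l = blk l (d l + 1) + (t l + b)" using q' e by simp
    have "t l + b + of_bool (d l + 1 \<in> Sh l) < h l" using Suc.prems(5) b by (auto simp: of_bool_def)
    hence "d' l = d l + 1 \<and> t' l = t l + b"
      using blk_decode[OF q'(2) _ q'(1) _ q'(4) _ e2] q b by auto
    moreover have "(d l + 1) mod A l = d l + 1" using True q by (simp add: mod_pos_pos_trivial)
    ultimately show ?thesis using b by (intro exI[of _ b]) (auto simp: b_def)
  next
    case False
    hence dl: "d l = A l - 1" using q by simp
    \<comment> \<open>Carry: resetting the last digit to 0 lowers all higher heights by
      \<open>z\<close>. Translating the old point by \<open>h l\<close> is then translating the new
      one by \<open>h (Suc l)\<close>, so the induction hypothesis applies one level up.\<close>
    define z where "z = h (Suc l) - h l"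
    define t2 where "t2 = (\<lambda>i. if i \<le> l then t i else t i - z)"
    define d2 where "d2 = d(l := 0)"
    have tS: "t (Suc l) = z + t l" using q(5) dl blk_top[of l] by (simp add: z_def)
    have z0: "0 \<le> z" using h_mono[of l "Suc l"] by (simp add: z_def)
    have p2: "pt t2 d2"
      unfolding pt_def
    proof (intro allI)
      fix i
      note r = ptD[OF p, of i]
      show "0 \<le> t2 i \<and> 0 \<le> d2 i \<and> d2 i < A i \<and> t2 i + of_bool (d2 i \<in> Sh i) < h i \<and>
         t2 (Suc i) = blk i (d2 i) + t2 i"
      proof (cases i l rule: linorder_cases)
        case less thus ?thesis using r by (auto simp: t2_def d2_def)
      next
        case equal thus ?thesis using r tS A_ge2[of l] Suc.prems(5) by (auto simp: t2_def d2_def of_bool_def)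
      next
        case greater
        have "t (Suc l) \<le> t i" using pt_grow[OF p, of "Suc l" i] greater by simp
        hence "0 \<le> t i - z" using tS q(1) by simp
        thus ?thesis using r greater z0 by (auto simp: t2_def d2_def)
      qed
    qed
    have "t' m = t2 m + h (Suc l)" using Suc.prems(3) lm by (simp add: t2_def z_def)
    moreover have "n = m - Suc l" using Suc.hyps(2) by simp
    moreover have "t2 (Suc l) + 2 < h (Suc l)" using tS Suc.prems(5) h_mono[of l "Suc l"] by (simp add: t2_def)
    ultimately obtain b where b: "b = 0 \<or> b = 1" "t' (Suc l) = t2 (Suc l) + b"
      using Suc.hyps(1)[OF _ p2 p', of "Suc l"] lm by blast
    have e2: "blk l (d' l) + t' l = blk l 0 + (t l + b)" using b tS q' by (simp add: t2_def)
    have "t l + b + of_bool (0 \<in> Sh l) < h l" using Suc.prems(5) b by (auto simp: of_bool_def)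
    hence "d' l = 0 \<and> t' l = t l + b"
      using blk_decode[OF q'(2) _ q'(1) _ q'(4) _ e2] q b by auto
    moreover have "d l \<notin> Sh l" using dl top_notin_Sh by simp
    ultimately show ?thesis using b dl by (intro exI[of _ b]) auto
  qed
qed

text \<open>The classes are chosen so that \<^term>\<open>blk l\<close> is affine on each of them; on plain levels the classes
  are single digits.\<close>

definition st :: "nat \<Rightarrow> int \<Rightarrow> int" where
  "st l c = (if Sh l = {0} then c else if Sh l = {} then 0
     else if c = 0 then 0 else if c \<in> Sh l then 1 else 2)"

text \<open>Within the short run \<open>{1..k}\<close> each further copy adds
  \<open>h l - 1\<close>; elsewhere it adds \<open>h l\<close>.\<close>

lemma st_affine:
  assumes "\<not> plain l"
  shows "\<exists>g e. (g = h l \<or> g = h l - 1) \<and> (\<forall>c. 0 \<le> c \<and> c < A l \<and> st l c = s \<longrightarrow> blk l c = g * c + e)"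
proof -
  consider "Sh l = {}" | k where "k \<ge> 2" "A l = 2 * k" "Sh l = {1..k}"
    using shape[of l] assms by blast
  thus ?thesis
  proof cases
    case 1
    thus ?thesis using blk_uncut[OF 1] by (intro exI[of _ "h l"] exI[of _ 0]) auto
  next
    case 2
    have ne: "Sh l \<noteq> {0}" "Sh l \<noteq> {}" using 2 by auto
    consider "s = 0" | "s = 1" | "s = 2" | "s \<notin> {0,1,2}" by blast
    thus ?thesis
    proof cases
      case 1
      show ?thesis using ne 1 2 by (intro exI[of _ "h l"] exI[of _ 0]) (auto simp: st_def split: if_splits)
    next
      case b: 2
      show ?thesis using ne b 2 blk_interval[OF 2(3)]
        by (intro exI[of _ "h l - 1"] exI[of _ 1]) (auto simp: st_def algebra_simps split: if_splits)
    next
      case b: 3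
      show ?thesis using ne b 2 blk_interval[OF 2(3)]
        by (intro exI[of _ "h l"] exI[of _ "-k"]) (auto simp: st_def algebra_simps split: if_splits)
    next
      case 4
      thus ?thesis using ne by (intro exI[of _ "h l"] exI[of _ 0]) (auto simp: st_def split: if_splits)
    qed
  qed
qed

lemma abs_mult_less_zero: fixes g e :: int assumes "\<bar>g * e\<bar> < g" shows "g * e = 0"
proof (rule ccontr)
  assume "g * e \<noteq> 0"
  hence "\<bar>e\<bar> \<ge> 1" by auto
  hence "\<bar>g\<bar> * 1 \<le> \<bar>g\<bar> * \<bar>e\<bar>" by (intro mult_left_mono) auto
  moreover have "0 < g" using assms by linarith
  ultimately have "g \<le> \<bar>g * e\<bar>" by (simp add: abs_mult)
  thus False using assms by linarith
qed

text \<open>On a plain level equal classes are equal digits, and the offsets cancel. On a special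
  level \<open>n = Suc j\<close>, level \<open>j\<close> is plain, so the second difference at
  \<open>n\<close> equals the one at \<open>j\<close> and is less than \<open>2 * h j\<close>; being
  a multiple of a slope \<open>g \<ge> h n - 1 = 8 * h j - 2\<close>, it vanishes. Plainness of
  \<open>q\<close> guarantees that \<open>j\<close> is still in range.\<close>

lemma pt_freiman:
  assumes p: "pt t1 d1" "pt t2 d2" "pt t3 d3" "pt t4 d4"
    and m: "t1 m - t2 m = t3 m - t4 m"
    and st: "\<And>l. q \<le> l \<Longrightarrow> l < m \<Longrightarrow> st l (d2 l) = st l (d1 l) \<and> st l (d3 l) = st l (d1 l) \<and> st l (d4 l) = st l (d1 l)"
    and q: "plain q" "q \<le> l" "l \<le> m"
  shows "t1 l - t2 l = t3 l - t4 l"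
  using q(3,2)
proof (induction rule: inc_induct)
  case base show ?case by (rule m)
next
  case (step n)
  have IH: "t1 (Suc n) - t2 (Suc n) = t3 (Suc n) - t4 (Suc n)" using step by simp
  have s: "st n (d2 n) = st n (d1 n)" "st n (d3 n) = st n (d1 n)" "st n (d4 n) = st n (d1 n)"
    using st[of n] step by auto
  note r = ptD(5)[OF p(1), of n] ptD(5)[OF p(2), of n] ptD(5)[OF p(3), of n] ptD(5)[OF p(4), of n]
  show ?case
  proof (cases "plain n")
    case True
    hence "d2 n = d1 n" "d3 n = d1 n" "d4 n = d1 n" using s by (auto simp: st_def)
    thus ?thesis using IH r by simp
  next
    case False
    hence "n \<noteq> q" using q by auto
    then obtain j where j: "n = Suc j" "q \<le> j" using step by (cases n) auto
    have pj: "plain j" using isolated[OF False] j by simp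
    have sj: "d2 j = d1 j" "d3 j = d1 j" "d4 j = d1 j"
      using st[of j] step j pj by (auto simp: st_def)
    have dj: "t1 n - t2 n - t3 n + t4 n = t1 j - t2 j - t3 j + t4 j"
      using ptD(5)[OF p(1), of j] ptD(5)[OF p(2), of j] ptD(5)[OF p(3), of j] ptD(5)[OF p(4), of j] sj j by simp
    have hn: "h n = 8 * h j - 1" using h_Suc_plain[OF pj] j by simp
    have small: "\<bar>t1 n - t2 n - t3 n + t4 n\<bar> < h n - 1"
      unfolding dj hn using ptD(1)[OF p(1), of j] ptD(1)[OF p(2), of j] ptD(1)[OF p(3), of j] ptD(1)[OF p(4), of j]
        ptD(6)[OF p(1), of j] ptD(6)[OF p(2), of j] ptD(6)[OF p(3), of j] ptD(6)[OF p(4), of j] by linarith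
    obtain g e where g: "g = h n \<or> g = h n - 1"
      and af: "\<And>c. 0 \<le> c \<Longrightarrow> c < A n \<Longrightarrow> st n c = st n (d1 n) \<Longrightarrow> blk n c = g * c + e"
      using st_affine[OF False, of "st n (d1 n)"] by blast
    have "blk n (d1 n) = g * d1 n + e" "blk n (d2 n) = g * d2 n + e" "blk n (d3 n) = g * d3 n + e" "blk n (d4 n) = g * d4 n + e"
      using af[OF ptD(2,3)[OF p(1)]] af[OF ptD(2,3)[OF p(2)]] af[OF ptD(2,3)[OF p(3)]] af[OF ptD(2,3)[OF p(4)]] s by auto
    hence "t1 n - t2 n - t3 n + t4 n = g * (- d1 n + d2 n + d3 n - d4 n)"
      using IH r by (simp add: algebra_simps)
    moreover have "h n - 1 \<le> g" using g by auto
    ultimately have "t1 n - t2 n - t3 n + t4 n = 0"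
      using abs_mult_less_zero[of g "- d1 n + d2 n + d3 n - d4 n"] small by simp
    thus ?thesis by simp
  qed
qed

lemma mod_int_window: fixes x n :: int assumes "- n \<le> x" "x < n" shows "x mod n = (if x < 0 then x + n else x)"
proof (cases "x < 0")
  case True
  have "(x + n) mod n = x + n" using assms True by (intro mod_pos_pos_trivial) auto
  thus ?thesis using True by simp
qed (use assms in simp)

text \<open>Translation by \<^term>\<open>h l\<close> raises the height by 1 if the digit lies in \<^term>\<open>Sh l\<close> and keeps it otherwise, except
  that for the last digit \<^term>\<open>A l - 1\<close> the outcome depends on the higher levels. Split digits force different outcomes.\<close>

definition split_at :: "nat \<Rightarrow> int \<Rightarrow> int \<Rightarrow> bool" where
  "split_at l a b \<longleftrightarrow> (a \<in> Sh l \<and> b \<notin> Sh l \<and> b \<noteq> A l - 1) \<or> (b \<in> Sh l \<and> a \<notin> Sh l \<and> a \<noteq> A l - 1)"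

text \<open>On a plain level, shifting by \<open>- a\<close> or \<open>- b\<close> brings one digit
  to the short copy 0. This fails only if the other digit lands on the undecided value 7, and two
  residues that are opposite modulo 8 cannot both be 7. On a cut level a shift between -1 and 2 puts
  exactly one digit into \<open>{1..k}\<close> and keeps the other off the last copy.\<close>

lemma split_shift:
  assumes "0 \<le> a" "a < A l" "0 \<le> b" "b < A l" "st l a \<noteq> st l b"
  shows "\<exists>i\<in>{-7..7}. split_at l ((a + i) mod A l) ((b + i) mod A l)"
proof -
  consider "plain l" | k where "k \<ge> 2" "A l = 2 * k" "Sh l = {1..k}"
    using shape[of l] assms(5) by (auto simp: st_def)
  thus ?thesis
  proof cases
    case 1
    hence ab: "a \<noteq> b" using assms by auto
    have lt: "a < 8" "b < 8" using assms 1 by auto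
    have m1: "(b - a) mod 8 = (if b - a < 0 then b - a + 8 else b - a)"
      using assms(1,3) lt by (intro mod_int_window) auto
    have m2: "(a - b) mod 8 = (if a - b < 0 then a - b + 8 else a - b)"
      using assms(1,3) lt by (intro mod_int_window) auto
    have m: "(b - a) mod 8 \<noteq> 0" "(a - b) mod 8 \<noteq> 0" "(b - a) mod 8 = 7 \<Longrightarrow> (a - b) mod 8 \<noteq> 7"
      using ab assms(1,3) lt unfolding m1 m2 by (auto split: if_splits)
    show ?thesis
    proof (cases "(b - a) mod 8 = 7")
      case False
      thus ?thesis using 1 m assms by (intro bexI[of _ "-a"]) (auto simp: split_at_def)
    next
      case True
      thus ?thesis using 1 m assms by (intro bexI[of _ "-b"]) (auto simp: split_at_def)
    qed
  next
    case 2
    have ne: "Sh l \<noteq> {0}" "Sh l \<noteq> {}" using 2 by auto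
    have core: "\<exists>i\<in>{-7..7}. split_at l ((a + i) mod (2*k)) ((b + i) mod (2*k))"
      if ab: "0 \<le> a" "a < 2*k" "0 \<le> b" "b < 2*k" and c: "(1 \<le> a \<and> a \<le> k \<and> (b = 0 \<or> k < b)) \<or> (a = 0 \<and> k < b)" for a b
    proof -
      consider "1 \<le> a" "a \<le> k" "b = 0 \<or> (k < b \<and> b < 2*k - 1)" | "1 \<le> a" "a < k" "b = 2*k - 1"
        | "a = k" "b = 2*k - 1" "k = 2" | "a = k" "b = 2*k - 1" "k > 2"
        | "a = 0" "k < b" "b < 2*k - 2" | "a = 0" "b = 2*k - 2" "k > 2" | "a = 0" "b = 2*k - 1"
        using c ab by linarith
      thus ?thesis
      proof cases
        case 1 thus ?thesis using ab 2 by (intro bexI[of _ 0]) (auto simp: split_at_def mod_pos_pos_trivial)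
      next
        case b: 2
        have "(a + 1) mod (2*k) = a + 1" using b by (intro mod_pos_pos_trivial) auto
        thus ?thesis using b 2 by (intro bexI[of _ 1]) (auto simp: split_at_def)
      next
        \<comment> \<open>For \<open>k = 2\<close>, stepping back would put both digits 2 and 3 into
          \<open>{1, 2}\<close>; stepping by 2 around the cycle gives 0 and 1.\<close>
        case 3 thus ?thesis using 2 by (intro bexI[of _ 2]) (auto simp: split_at_def)
      next
        case 4
        have "(a - 1) mod (2*k) = a - 1" "(b - 1) mod (2*k) = b - 1" using 4 by (intro mod_pos_pos_trivial; auto)+
        thus ?thesis using 4 2 by (intro bexI[of _ "-1"]) (auto simp: split_at_def)
      next
        case 5
        have "(a + 1) mod (2*k) = a + 1" "(b + 1) mod (2*k) = b + 1" using 5 ab by (intro mod_pos_pos_trivial; auto)+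
        thus ?thesis using 5 2 by (intro bexI[of _ 1]) (auto simp: split_at_def)
      next
        case 6
        have "(a + 2) mod (2*k) = a + 2" using 6 by (intro mod_pos_pos_trivial) auto
        thus ?thesis using 6 2 by (intro bexI[of _ 2]) (auto simp: split_at_def)
      next
        case 7
        have "(a + 1) mod (2*k) = a + 1" using 7 2 by (intro mod_pos_pos_trivial) auto
        thus ?thesis using 7 2 by (intro bexI[of _ 1]) (auto simp: split_at_def)
      qed
    qed
    have sym: "split_at l x y \<longleftrightarrow> split_at l y x" for x y by (auto simp: split_at_def)
    have "((1 \<le> a \<and> a \<le> k \<and> (b = 0 \<or> k < b)) \<or> (a = 0 \<and> k < b)) \<or> ((1 \<le> b \<and> b \<le> k \<and> (a = 0 \<or> k < a)) \<or> (b = 0 \<and> k < a))"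
      using assms ne 2 by (auto simp: st_def split: if_splits)
    thus ?thesis using core[of a b] core[of b a] assms 2 sym by auto
  qed
qed

end

lemma (in tower_shape) pt_decode:
  assumes p: "pt t d" and p': "pt t' d'" and eq: "t' m = t m" and lm: "l \<le> m"
  shows "t' l = t l"
  using lm
proof (induction rule: inc_induct)
  case base show ?case by (rule eq)
next
  case (step n)
  note q = ptD[OF p, of n] and q' = ptD[OF p', of n]
  have "blk n (d' n) + t' n = blk n (d n) + t n" using step q q' by simp
  thus ?case using blk_decode[OF q'(2) q(2) q'(1) q(1) q'(4) q(4)] by simp
qed

section \<open>Measure preserving towers\<close>

text \<open>\<open>TT\<close> is an action of the integers, tied to the towers only through the
  growth of heights at high levels; how high depends on the point, hence the eventual form of
  \<open>TT_t\<close>.\<close>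

locale tower = tower_shape A Sh + prob_space M
  for A Sh and M :: "'a measure" +
  fixes t D :: "nat \<Rightarrow> 'a \<Rightarrow> int" and TT :: "int \<Rightarrow> 'a \<Rightarrow> 'a"
  assumes pt_tD: "x \<in> space M \<Longrightarrow> pt (\<lambda>l. t l x) (\<lambda>l. D l x)"
    and t_meas [measurable]: "t l \<in> measurable M (count_space UNIV)"
    and D_meas [measurable]: "D l \<in> measurable M (count_space UNIV)"
    and TT_meas [measurable]: "TT z \<in> measurable M M"
    and TT_distr: "distr M M (TT z) = M"
    and TT_TT: "x \<in> space M \<Longrightarrow> TT z (TT w x) = TT (z + w) x"
    and TT_0: "x \<in> space M \<Longrightarrow> TT 0 x = x"
    and TT_t: "x \<in> space M \<Longrightarrow> eventually (\<lambda>m. t m (TT z x) = t m x + z) sequentially"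
    and gen: "sets M = sigma_sets (space M) {{x \<in> space M. t l x = v} | l v. True}"
begin

lemma TT_space [simp]: "x \<in> space M \<Longrightarrow> TT z x \<in> space M"
  using measurable_space[OF TT_meas] .

lemma prob_TT: "B \<in> sets M \<Longrightarrow> prob {x \<in> space M. TT z x \<in> B} = prob B"
proof -
  assume B: "B \<in> sets M"
  have "prob B = measure (distr M M (TT z)) B" by (simp add: TT_distr)
  also have "\<dots> = prob (TT z -` B \<inter> space M)" using B by (simp add: measure_distr)
  also have "TT z -` B \<inter> space M = {x \<in> space M. TT z x \<in> B}" by auto
  finally show ?thesis by simp
qed

lemma pt_TT: "x \<in> space M \<Longrightarrow> pt (\<lambda>l. t l (TT z x)) (\<lambda>l. D l (TT z x))"
  by (simp add: pt_tD)

lemma TT_large: assumes "x \<in> space M" shows "\<exists>m\<ge>l. t m (TT z x) = t m x + z"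
  using TT_t[OF assms, of z] unfolding eventually_sequentially by (meson le_cases order_trans)

lemma tD: 
  assumes "x \<in> space M"
  shows "0 \<le> t l x" "t l x < h l" "0 \<le> D l x" "D l x < A l"
  using ptD[OF pt_tD[OF assms], of l] by simp_all

lemma TT_shift:
  assumes x: "x \<in> space M" and "0 \<le> t l x + z" "t l x + z + 1 < h l" "l \<le> i"
  shows "t i (TT z x) = t i x + z" "D i (TT z x) = D i x"
proof -
  obtain m where m: "m \<ge> Suc i" "t m (TT z x) = t m x + z" using TT_large[OF x] by blast
  note s = pt_shift[OF pt_tD[OF x] pt_TT[OF x, of z] m(2) assms(2,3,4)]
  show "t i (TT z x) = t i x + z" "D i (TT z x) = D i x" using s m by simp_all
qed

lemma t_decode: "x \<in> space M \<Longrightarrow> y \<in> space M \<Longrightarrow> t m x = t m y \<Longrightarrow> l \<le> m \<Longrightarrow> t l x = t l y"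
  using pt_decode[OF pt_tD pt_tD, of y x m l] by auto

lemma TT_block:
  assumes x: "x \<in> space M" and "t l x + 2 < h l"
  obtains b where "b = 0 \<or> b = 1" "t l (TT (h l) x) = t l x + b" "D l (TT (h l) x) = (D l x + 1) mod A l"
     "D l x \<in> Sh l \<Longrightarrow> b = 1" "D l x \<notin> Sh l \<Longrightarrow> D l x \<noteq> A l - 1 \<Longrightarrow> b = 0"
proof -
  obtain m where m: "m \<ge> l" "t m (TT (h l) x) = t m x + h l" using TT_large[OF x] by blast
  show thesis using pt_block_step[OF pt_tD[OF x] pt_TT[OF x] m(2,1) assms(2)] that by auto
qed

text \<open>\<open>TT_block\<close> is applied to the translate \<open>v\<close> of \<open>x\<close>
  by \<open>- h l\<close>. If \<open>v\<close> were too close to the top, the point three steps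
  below it would have an image three steps below \<open>x\<close>, at a height that
  \<open>hi\<close> forbids.\<close>

lemma TT_block_back:
  assumes x: "x \<in> space M" and lo: "3 \<le> t l x" and hi: "t l x + 3 < h l"
  obtains b where "b = 0 \<or> b = 1" "t l (TT (- h l) x) = t l x - b" "D l (TT (- h l) x) = (D l x - 1) mod A l"
proof -
  define v where "v = TT (- h l) x"
  have v: "v \<in> space M" "TT (h l) v = x" using x by (auto simp: v_def TT_TT TT_0)
  have mar: "t l v + 2 < h l"
  proof (rule ccontr)
    assume a: "\<not> t l v + 2 < h l"
    define v' where "v' = TT (-3) v"
    have v': "v' \<in> space M" using v by (simp add: v'_def)
    have tv': "t l v' = t l v - 3" using TT_shift(1)[OF v(1), of l "-3" l] a hi lo tD[OF v(1), of l] by (simp add: v'_def)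
    have e: "TT (h l) v' = TT (-3) x"
    proof -
      have "TT (h l) v' = TT (h l + -3) v" using TT_TT[OF v(1)] by (simp add: v'_def)
      also have "\<dots> = TT (-3 + h l) v" by (simp add: add.commute)
      also have "\<dots> = TT (-3) (TT (h l) v)" using TT_TT[OF v(1)] by simp
      finally show ?thesis using v by simp
    qed
    obtain b where "b = 0 \<or> b = 1" "t l (TT (h l) v') = t l v' + b"
      using TT_block[OF v', of l] tv' tD[OF v(1), of l] by (auto simp: )
    moreover have "t l (TT (-3) x) = t l x - 3" using TT_shift(1)[OF x, of l "-3" l] lo hi by simp
    ultimately show False using e tv' a hi by auto
  qed
  obtain b where b: "b = 0 \<or> b = 1" "t l x = t l v + b" "D l x = (D l v + 1) mod A l"
    using TT_block[OF v(1) mar] v(2) by metis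
  have "(D l x - 1) mod A l = D l v"
    unfolding b(3) using tD(3,4)[OF v(1), of l] by (simp add: mod_diff_left_eq mod_pos_pos_trivial)
  thus thesis using that b by (auto simp: v_def)
qed

text \<open>This is the common measure of all levels except possibly the top one, which short copies
  lack.\<close>

definition w :: "nat \<Rightarrow> real" where "w l = prob {x \<in> space M. t l x = 0}"

lemma level_pre:
  assumes "0 \<le> i" "i + 1 < h l"
  shows "{x \<in> space M. t l x = 0} = {x \<in> space M. TT i x \<in> {x \<in> space M. t l x = i}}"
proof safe
  fix x assume x: "x \<in> space M" and a: "t l (TT i x) = i"
  have "t l (TT (- i) (TT i x)) = 0" using TT_shift(1)[of "TT i x" l "- i" l] x a assms by simp
  thus "t l x = 0" using x by (simp add: TT_TT TT_0)
next
  fix x assume x: "x \<in> space M" and a: "t l x = 0"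
  show "t l (TT i x) = i" using TT_shift(1)[of x l i l] x a assms by simp
qed simp

lemma prob_level:
  assumes "0 \<le> i" "i + 1 < h l"
  shows "prob {x \<in> space M. t l x = i} = w l"
  using prob_TT[of "{x \<in> space M. t l x = i}" i] unfolding level_pre[OF assms, symmetric] by (simp add: w_def)

lemma prob_level_le: "prob {x \<in> space M. t l x = i} \<le> w l"
proof -
  consider "0 \<le> i \<and> i + 1 < h l" | "i < 0 \<or> i \<ge> h l" | "i + 1 = h l" by linarith
  thus ?thesis
  proof cases
    case 1 thus ?thesis using prob_level[of i l] by simp
  next
    case 2
    hence "{x \<in> space M. t l x = i} = {}" using tD(1,2)[of _ l] by fastforce
    thus ?thesis by (simp only: measure_empty) (simp add: w_def)
  next
    case 3
    show ?thesis
    proof (cases "h l = 1")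
      case True
      thus ?thesis using 3 by (simp add: w_def)
    next
      case False
      have "{x \<in> space M. TT i x \<in> {x \<in> space M. t l x = i}} \<subseteq> {x \<in> space M. t l x = 0}"
      proof safe
        fix x assume x: "x \<in> space M" and a: "t l (TT i x) = i"
        have "t l (TT (- i) (TT i x)) = 0" using TT_shift(1)[of "TT i x" l "- i" l] x a 3 False h_ge1[of l] by simp
        thus "t l x = 0" using x by (simp add: TT_TT TT_0)
      qed
      hence "prob {x \<in> space M. TT i x \<in> {x \<in> space M. t l x = i}} \<le> w l" unfolding w_def by (intro finite_measure_mono) auto
      thus ?thesis using prob_TT[of "{x \<in> space M. t l x = i}" i] by simp
    qed
  qed
qed

lemma w_nonneg: "0 \<le> w l" by (simp add: w_def)

lemma prob_in_finite:
  assumes "finite E"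
  shows "prob {x \<in> space M. t l x \<in> E} = (\<Sum>i\<in>E. prob {x \<in> space M. t l x = i})"
proof -
  have "{x \<in> space M. t l x \<in> E} = (\<Union>i\<in>E. {x \<in> space M. t l x = i})" by auto
  moreover have "prob \<dots> = (\<Sum>i\<in>E. prob {x \<in> space M. t l x = i})"
    using assms by (intro finite_measure_finite_Union) (auto simp: disjoint_family_on_def)
  ultimately show ?thesis by simp
qed

lemma prob_in_le: "finite E \<Longrightarrow> prob {x \<in> space M. t l x \<in> E} \<le> card E * w l"
  unfolding prob_in_finite using sum_bounded_above[of E "\<lambda>i. prob {x \<in> space M. t l x = i}" "w l"] prob_level_le by simp

lemma prob_in_eq:
  assumes "E \<subseteq> {0..<h l - 1}" shows "prob {x \<in> space M. t l x \<in> E} = card E * w l"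
proof -
  have "finite E" using assms finite_subset by blast
  moreover have "(\<Sum>i\<in>E. prob {x \<in> space M. t l x = i}) = (\<Sum>i\<in>E. w l)"
    using assms by (intro sum.cong refl prob_level) auto
  ultimately show ?thesis by (simp add: prob_in_finite)
qed

lemma w_le: "w l * (h l - 1) \<le> 1"
proof -
  have "real (card {0..<h l - 1}) * w l = prob {x \<in> space M. t l x \<in> {0..<h l - 1}}"
    by (rule prob_in_eq[symmetric]) simp
  also have "\<dots> \<le> 1" by (rule prob_le_1)
  finally have "real (card {0..<h l - 1}) * w l \<le> 1" .
  moreover have "real (card {0..<h l - 1}) = h l - 1" using h_ge1[of l] by simp
  ultimately show ?thesis by (simp only: mult.commute)
qed

lemma w_ge: "1 \<le> w l * h l"
proof -
  have "{x \<in> space M. t l x \<in> {0..<h l}} = space M" using tD(1,2) by auto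
  hence "1 \<le> real (card {0..<h l}) * w l" using prob_in_le[of "{0..<h l}" l] by (simp only: prob_space finite_atLeastLessThan_int simp_thms)
  moreover have "real (card {0..<h l}) = h l" using h_ge1[of l] by simp
  ultimately show ?thesis by (simp only: mult.commute)
qed

lemma w_le_inverse: "1 < h l \<Longrightarrow> w l \<le> 1 / (h l - 1)"
  using w_le[of l] by (simp add: field_simps)

lemma w_tendsto: "w \<longlonglongrightarrow> 0"
proof (rule tendsto_sandwich[of "\<lambda>_. 0" w sequentially "\<lambda>l. 1 / real l" 0])
  show "eventually (\<lambda>l. w l \<le> 1 / real l) sequentially"
    unfolding eventually_sequentially
  proof (intro exI[of _ 1] allI impI)
    fix l :: nat assume "1 \<le> l"
    have a: "int l \<le> h l - 1" using h_ge_self[of l] by simp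
    hence r: "real l \<le> real_of_int (h l) - 1" by linarith
    have "1 < h l" using a \<open>1 \<le> l\<close> by linarith
    hence "w l \<le> 1 / (real_of_int (h l) - 1)" using w_le_inverse by simp
    also have "\<dots> \<le> 1 / real l" using r \<open>1 \<le> l\<close> by (intro divide_left_mono mult_pos_pos) auto
    finally show "w l \<le> 1 / real l" .
  qed
  show "(\<lambda>l. 1 / real l) \<longlonglongrightarrow> 0" by (rule lim_1_over_n)
qed (auto simp: w_nonneg)

lemma level_refine:
  assumes "l \<le> m"
  shows "\<exists>E'. {x \<in> space M. t l x \<in> E} = {x \<in> space M. t m x \<in> E'}"
proof (intro exI set_eqI iffI)
  fix x assume "x \<in> {x \<in> space M. t m x \<in> t m ` {x \<in> space M. t l x \<in> E}}"
  then obtain y where "x \<in> space M" "y \<in> space M" "t m x = t m y" "t l y \<in> E" by auto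
  thus "x \<in> {x \<in> space M. t l x \<in> E}" using t_decode[of x y m l] assms by simp
qed auto

section \<open>Approximation in measure by unions of levels\<close>

definition sdiff :: "'a set \<Rightarrow> 'a set \<Rightarrow> real" where "sdiff B C = prob (sym_diff B C)"

lemma sdiff_commute: "sdiff B C = sdiff C B"
  by (simp add: sdiff_def Un_commute)

lemma sdiff_nonneg: "0 \<le> sdiff B C" by (simp add: sdiff_def)

lemma sdiff_triangle:
  assumes "B \<in> sets M" "C \<in> sets M" "E \<in> sets M"
  shows "sdiff B E \<le> sdiff B C + sdiff C E"
proof -
  have "prob (sym_diff B E) \<le> prob (sym_diff B C \<union> sym_diff C E)"
    using assms by (intro finite_measure_mono) auto
  also have "\<dots> \<le> prob (sym_diff B C) + prob (sym_diff C E)"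
    using assms by (intro measure_Un_le) auto
  finally show ?thesis by (simp add: sdiff_def)
qed

lemma sdiff_prob: "B \<in> sets M \<Longrightarrow> C \<in> sets M \<Longrightarrow> \<bar>prob B - prob C\<bar> \<le> sdiff B C"
proof -
  assume a: "B \<in> sets M" "C \<in> sets M"
  have 1: "prob X \<le> prob Y + sdiff X Y" if "X \<in> sets M" "Y \<in> sets M" for X Y
  proof -
    have "prob X \<le> prob (Y \<union> sym_diff X Y)" using that by (intro finite_measure_mono) auto
    also have "\<dots> \<le> prob Y + prob (sym_diff X Y)" using that by (intro measure_Un_le) auto
    finally show ?thesis by (simp add: sdiff_def)
  qed
  show ?thesis using 1[OF a] 1[OF a(2,1)] sdiff_commute[of B C] by linarith
qed

abbreviation pre :: "int \<Rightarrow> 'a set \<Rightarrow> 'a set" where "pre z B \<equiv> {x \<in> space M. TT z x \<in> B}"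

lemma pre_sets [measurable]: "B \<in> sets M \<Longrightarrow> pre z B \<in> sets M"
  using measurable_sets[OF TT_meas, of B z] by (simp add: vimage_def Int_def conj_commute)

lemma sdiff_pre: "B \<in> sets M \<Longrightarrow> C \<in> sets M \<Longrightarrow> sdiff (pre z B) (pre z C) = sdiff B C"
proof -
  assume a: "B \<in> sets M" "C \<in> sets M"
  have "sym_diff (pre z B) (pre z C) = pre z (sym_diff B C)" by auto
  thus ?thesis using prob_TT[of "sym_diff B C" z] a by (simp add: sdiff_def)
qed

lemma pre_pre: "pre z (pre u B) = pre (u + z) B"
  by (auto simp: TT_TT)

lemma sdiff_pre_multiple:
  assumes "B \<in> sets M" shows "sdiff B (pre (int a * n) B) \<le> a * sdiff B (pre n B)"
proof (induction a)
  case 0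
  have "pre 0 B = B" using sets.sets_into_space[OF assms] by (auto simp: TT_0)
  thus ?case by (simp add: sdiff_def)
next
  case (Suc a)
  have e: "pre (int (Suc a) * n) B = pre (int a * n) (pre n B)"
    unfolding pre_pre by (simp add: distrib_right)
  have "sdiff B (pre (int (Suc a) * n) B) \<le> sdiff B (pre (int a * n) B) + sdiff (pre (int a * n) B) (pre (int a * n) (pre n B))"
    unfolding e using assms by (intro sdiff_triangle) auto
  also have "\<dots> = sdiff B (pre (int a * n) B) + sdiff B (pre n B)" using assms by (subst sdiff_pre) auto
  finally show ?case using Suc by (simp add: algebra_simps)
qed

text \<open>The sets approximated by unions of levels form a sigma-algebra containing the
  generators, and by \<open>level_refine\<close> an approximation at one level is one at every
  higher level.\<close>

lemma level_approx:
  assumes "B \<in> sets M" "0 < e"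
  shows "\<exists>l0. \<forall>l\<ge>l0. \<exists>E. sdiff B {x \<in> space M. t l x \<in> E} < e"
proof -
  have ex: "\<exists>l E. sdiff B {x \<in> space M. t l x \<in> E} < e"
    using assms(1)[unfolded gen] assms(2)
  proof (induction arbitrary: e rule: sigma_sets.induct)
    case (Basic a)
    then obtain l v where "a = {x \<in> space M. t l x \<in> {v}}" by auto
    thus ?case using Basic(2) by (intro exI[of _ l] exI[of _ "{v}"]) (simp add: sdiff_def)
  next
    case Empty
    thus ?case by (intro exI[of _ 0] exI[of _ "{}"]) (simp add: sdiff_def)
  next
    case (Compl a)
    then obtain l E where lE: "sdiff a {x \<in> space M. t l x \<in> E} < e" by blast
    have "a \<subseteq> space M" using Compl(1) gen sets.sets_into_space by blast
    hence "sym_diff (space M - a) {x \<in> space M. t l x \<in> - E} = sym_diff a {x \<in> space M. t l x \<in> E}" by auto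
    thus ?case using lE by (intro exI[of _ l] exI[of _ "-E"]) (simp add: sdiff_def)
  next
    case (Union a)
    have am: "\<And>i. a i \<in> sets M" using Union(1) gen by simp
    define U where "U n = (\<Union>i<n. a i)" for n
    have Um: "U n \<in> sets M" for n using am by (auto simp: U_def)
    have "(\<lambda>n. prob (U n)) \<longlonglongrightarrow> prob (\<Union>n. U n)"
      using Um by (intro finite_Lim_measure_incseq) (auto simp: incseq_def U_def, meson lessThan_iff less_le_trans)
    moreover have UU: "(\<Union>n. U n) = (\<Union>i. a i)" by (auto simp: U_def)
    ultimately have "eventually (\<lambda>n. dist (prob (U n)) (prob (\<Union>i. a i)) < e / 2) sequentially"
      using Union(3) by (intro tendstoD) auto
    then obtain n where n: "dist (prob (U n)) (prob (\<Union>i. a i)) < e / 2" unfolding eventually_sequentially by blast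
    have "sym_diff (\<Union>i. a i) (U n) = (\<Union>i. a i) - U n" using UU by auto
    moreover have "prob ((\<Union>i. a i) - U n) = prob (\<Union>i. a i) - prob (U n)" using Um am UU
      by (intro finite_measure_Diff) auto
    ultimately have "sdiff (\<Union>i. a i) (U n) = prob (\<Union>i. a i) - prob (U n)" by (simp only: sdiff_def)
    hence 1: "sdiff (\<Union>i. a i) (U n) < e / 2" using n unfolding dist_real_def by linarith
    have fin: "\<exists>l E. sdiff (U k) {x \<in> space M. t l x \<in> E} < e'" if "0 < e'" for k e'
      using that
    proof (induction k arbitrary: e')
      case 0 thus ?case by (intro exI[of _ 0] exI[of _ "{}"]) (simp add: sdiff_def U_def)
    next
      case (Suc k)
      obtain l1 E1 where 1: "sdiff (U k) {x \<in> space M. t l1 x \<in> E1} < e' / 2" using Suc.IH[of "e'/2"] Suc.prems by auto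
      obtain l2 E2 where 2: "sdiff (a k) {x \<in> space M. t l2 x \<in> E2} < e' / 2" using Union(2)[of "e'/2" k] Suc.prems by auto
      define m where "m = max l1 l2"
      obtain F1 where F1: "{x \<in> space M. t l1 x \<in> E1} = {x \<in> space M. t m x \<in> F1}" using level_refine[of l1 m E1] by (auto simp: m_def)
      obtain F2 where F2: "{x \<in> space M. t l2 x \<in> E2} = {x \<in> space M. t m x \<in> F2}" using level_refine[of l2 m E2] by (auto simp: m_def)
      have "U (Suc k) = U k \<union> a k" by (auto simp: U_def less_Suc_eq)
      hence "sym_diff (U (Suc k)) {x \<in> space M. t m x \<in> F1 \<union> F2} \<subseteq> 
          sym_diff (U k) {x \<in> space M. t m x \<in> F1} \<union> sym_diff (a k) {x \<in> space M. t m x \<in> F2}" by auto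
      hence "sdiff (U (Suc k)) {x \<in> space M. t m x \<in> F1 \<union> F2} \<le> prob (sym_diff (U k) {x \<in> space M. t m x \<in> F1} \<union> sym_diff (a k) {x \<in> space M. t m x \<in> F2})"
        unfolding sdiff_def using Um am by (intro finite_measure_mono) auto
      also have "\<dots> \<le> sdiff (U k) {x \<in> space M. t m x \<in> F1} + sdiff (a k) {x \<in> space M. t m x \<in> F2}"
        unfolding sdiff_def using Um am by (intro measure_Un_le) auto
      also have "\<dots> < e'" using 1 2 unfolding F1 F2 by simp
      finally show ?case by blast
    qed
    obtain l E where 2: "sdiff (U n) {x \<in> space M. t l x \<in> E} < e / 2" using fin[of "e/2" n] Union(3) by auto
    have "sdiff (\<Union>i. a i) {x \<in> space M. t l x \<in> E} \<le> sdiff (\<Union>i. a i) (U n) + sdiff (U n) {x \<in> space M. t l x \<in> E}"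
      using am Um by (intro sdiff_triangle) auto
    thus ?case using 1 2 by (intro exI[of _ l] exI[of _ E]) linarith
  qed
  then obtain l0 E0 where l0: "sdiff B {x \<in> space M. t l0 x \<in> E0} < e" by blast
  show ?thesis
  proof (intro exI[of _ l0] allI impI)
    fix l assume "l0 \<le> l"
    then obtain E' where "{x \<in> space M. t l0 x \<in> E0} = {x \<in> space M. t l x \<in> E'}" using level_refine by blast
    thus "\<exists>E. sdiff B {x \<in> space M. t l x \<in> E} < e" using l0 by auto
  qed
qed

end

context prob_space
begin

lemma card_indicator: "finite I \<Longrightarrow> real (card {i \<in> I. x \<in> B i}) = (\<Sum>i\<in>I. indicator (B i) x)"
  by (simp add: indicator_def sum.If_cases Int_def)

lemma count_meas: 
  assumes "finite I" "\<And>i. i \<in> I \<Longrightarrow> B i \<in> sets M"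
  shows "{x \<in> space M. c \<le> real (card {i \<in> I. x \<in> B i})} \<in> sets M"
  using assms by (simp add: card_indicator)

lemma markov_count:
  assumes I: "finite I" and B: "\<And>i. i \<in> I \<Longrightarrow> B i \<in> sets M" and c: "0 < c"
  shows "prob {x \<in> space M. c \<le> real (card {i \<in> I. x \<in> B i})} \<le> (\<Sum>i\<in>I. prob (B i)) / c"
proof -
  have int1: "integrable M (indicat_real (B i))" if "i \<in> I" for i
    using B[OF that] by (intro integrable_real_indicator) (auto simp: less_top[symmetric] emeasure_finite)
  have int: "integrable M (\<lambda>x. \<Sum>i\<in>I. indicat_real (B i) x)"
    using int1 by (intro Bochner_Integration.integrable_sum) simp
  have "prob {x \<in> space M. c \<le> (\<Sum>i\<in>I. indicat_real (B i) x)} \<le> (\<integral>x. (\<Sum>i\<in>I. indicat_real (B i) x) \<partial>M) / c"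
    using int c by (intro integral_Markov_inequality_measure[where A = "{}"]) (auto intro: sum_nonneg)
  also have "(\<integral>x. (\<Sum>i\<in>I. indicat_real (B i) x) \<partial>M) = (\<Sum>i\<in>I. prob (B i))"
    using B int1 by (subst Bochner_Integration.integral_sum) (auto simp: sets.sets_into_space Int_absorb2)
  finally show ?thesis using I by (simp add: card_indicator)
qed

end

section \<open>Two orbits compared along windows of twice a tower height\<close>

context tower
begin

text \<open>Translating by \<open>h l\<close> reaches the next copy, and going back by the height
  there reaches its bottom. Points too close to the top for \<open>TT_block\<close> are first moved
  down by 3.\<close>

lemma window_start:
  assumes x: "x \<in> space M" and h5: "5 \<le> h l"
  shows "\<exists>u. 0 \<le> u \<and> u \<le> h l \<and> t l (TT u x) = 0"
proof -
  have main: "\<exists>u. u \<le> h l - t l v \<and> h l - t l v - 1 \<le> u \<and> t l (TT u v) = 0" if v: "v \<in> space M" "t l v + 2 < h l" for v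
  proof -
    obtain b where b: "b = 0 \<or> b = 1" "t l (TT (h l) v) = t l v + b" using TT_block[OF v] by blast
    define y where "y = TT (h l) v"
    have y: "y \<in> space M" using v by (simp add: y_def)
    have "t l (TT (- t l y) y) = 0" using TT_shift(1)[OF y, of l "- t l y" l] h5 by simp
    moreover have "TT (- t l y) y = TT (h l - t l v - b) v"
      using b TT_TT[OF v(1)] by (simp add: y_def algebra_simps)
    ultimately show ?thesis using b by (intro exI[of _ "h l - t l v - b"]) auto
  qed
  show ?thesis
  proof (cases "t l x + 2 < h l")
    case True
    then obtain u where "u \<le> h l - t l x" "h l - t l x - 1 \<le> u" "t l (TT u x) = 0" using main[OF x] by blast
    thus ?thesis using tD[OF x, of l] by (intro exI[of _ u]) auto
  next
    case False
    define v where "v = TT (-3) x"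
    have v: "v \<in> space M" "t l v = t l x - 3"
      using x TT_shift(1)[OF x, of l "-3" l] False h5 tD[OF x, of l] by (auto simp: v_def)
    then obtain u where u: "u \<le> h l - t l v" "h l - t l v - 1 \<le> u" "t l (TT u v) = 0" 
      using main[of v] tD[OF x, of l] by auto
    have "TT u v = TT (u - 3) x" using TT_TT[OF x] by (simp add: v_def)
    thus ?thesis using u v False tD[OF x, of l] by (intro exI[of _ "u - 3"]) auto
  qed
qed

text \<open>The bound \<open>h l - 2\<close> keeps \<open>p + 1\<close> below the top height, so
  every copy, short or not, shows each jump.\<close>

definition jumps :: "nat \<Rightarrow> int set \<Rightarrow> int set" where
  "jumps l E = {p \<in> {0..<h l - 2}. (p \<in> E) \<noteq> (p + 1 \<in> E)}"

text \<open>A new copy starts within the first \<open>h l\<close> steps, so a window of length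
  \<open>2 * h l\<close> runs through the whole of one.\<close>

lemma jumps_dense:
  assumes x: "x \<in> space M" and h5: "5 \<le> h l"
  shows "card (jumps l E) \<le> card {u \<in> {0..<2 * h l}. (t l (TT u x) \<in> E) \<noteq> (t l (TT (u + 1) x) \<in> E)}"
proof -
  obtain u0 where u0: "0 \<le> u0" "u0 \<le> h l" "t l (TT u0 x) = 0" using window_start[OF assms] by blast
  have t: "t l (TT (u0 + p) x) = p" if "0 \<le> p" "p + 1 < h l" for p
    using TT_shift(1)[of "TT u0 x" l p l] u0 that x by (simp add: TT_TT add.commute)
  have "(\<lambda>p. u0 + p) ` jumps l E \<subseteq> {u \<in> {0..<2 * h l}. (t l (TT u x) \<in> E) \<noteq> (t l (TT (u + 1) x) \<in> E)}"
  proof safe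
    fix p assume p: "p \<in> jumps l E"
    hence b: "0 \<le> p" "p + 2 < h l" by (auto simp: jumps_def)
    have "t l (TT (u0 + p) x) = p" "t l (TT (u0 + p + 1) x) = p + 1"
      using t[of p] t[of "p + 1"] b by (auto simp: add.assoc)
    note e = this
    show "u0 + p \<in> {0..<2 * h l}" using b u0 by simp
    { assume "t l (TT (u0 + p) x) \<in> E" "t l (TT (u0 + p + 1) x) \<in> E"
      thus False using p e by (simp add: jumps_def) }
    { assume "t l (TT (u0 + p) x) \<notin> E" "t l (TT (u0 + p + 1) x) \<notin> E"
      thus False using p e by (simp add: jumps_def) }
  qed
  hence "card ((\<lambda>p. u0 + p) ` jumps l E) \<le> card {u \<in> {0..<2 * h l}. (t l (TT u x) \<in> E) \<noteq> (t l (TT (u + 1) x) \<in> E)}"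
    by (intro card_mono finite_subset[of "{u \<in> {0..<2 * h l}. (t l (TT u x) \<in> E) \<noteq> (t l (TT (u + 1) x) \<in> E)}" "{0..<2 * h l}"]) auto
  thus ?thesis by (simp add: card_image)
qed

definition mismatch :: "nat \<Rightarrow> int set \<Rightarrow> int \<Rightarrow> 'a \<Rightarrow> nat" where
  "mismatch l E N x = card {u \<in> {0..<2 * h l}. (t l (TT u x) \<in> E) \<noteq> (t l (TT u (TT N x)) \<in> E)}"

definition far :: "nat \<Rightarrow> int set \<Rightarrow> int \<Rightarrow> real \<Rightarrow> 'a set" where
  "far l E N c = {x \<in> space M. c \<le> mismatch l E N x}"

lemma mismatch_alt:
  "x \<in> space M \<Longrightarrow> mismatch l E N x = card {u \<in> {0..<2 * h l}. x \<in> {x \<in> space M. (t l (TT u x) \<in> E) \<noteq> (t l (TT u (TT N x)) \<in> E)}}"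
  by (simp add: mismatch_def)

lemma far_meas [measurable]: "far l E N c \<in> sets M"
proof -
  have "{x \<in> space M. c \<le> real (card {u \<in> {0..<2 * h l}. x \<in> {x \<in> space M. (t l (TT u x) \<in> E) \<noteq> (t l (TT u (TT N x)) \<in> E)}})} \<in> sets M"
    by (intro count_meas) auto
  thus ?thesis by (simp add: far_def mismatch_alt cong: conj_cong)
qed

text \<open>Markov's inequality; by invariance each of the \<open>2 * h l\<close> positions
  contributes the same symmetric difference.\<close>

lemma prob_far:
  assumes "0 < c"
  shows "prob (far l E N c) \<le> 2 * h l * sdiff {x \<in> space M. t l x \<in> E} (pre N {x \<in> space M. t l x \<in> E}) / c"
proof -
  let ?B = "\<lambda>u. {x \<in> space M. (t l (TT u x) \<in> E) \<noteq> (t l (TT u (TT N x)) \<in> E)}"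
  have "far l E N c = {x \<in> space M. c \<le> real (card {u \<in> {0..<2 * h l}. x \<in> ?B u})}"
    by (simp add: far_def mismatch_alt cong: conj_cong)
  hence "prob (far l E N c) \<le> (\<Sum>u\<in>{0..<2 * h l}. prob (?B u)) / c"
    using markov_count[of "{0..<2 * h l}" ?B c] assms by simp
  also have "(\<Sum>u\<in>{0..<2 * h l}. prob (?B u)) = (\<Sum>u\<in>{0..<2 * h l}. sdiff {x \<in> space M. t l x \<in> E} (pre N {x \<in> space M. t l x \<in> E}))"
  proof (rule sum.cong[OF refl])
    fix u
    have "?B u = {x \<in> space M. TT u x \<in> {x \<in> space M. (t l x \<in> E) \<noteq> (t l (TT N x) \<in> E)}}"
      by (auto simp: TT_TT add.commute)
    also have "prob \<dots> = prob {x \<in> space M. (t l x \<in> E) \<noteq> (t l (TT N x) \<in> E)}" by (intro prob_TT) simp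
    also have "{x \<in> space M. (t l x \<in> E) \<noteq> (t l (TT N x) \<in> E)} = sym_diff {x \<in> space M. t l x \<in> E} (pre N {x \<in> space M. t l x \<in> E})" by auto
    finally show "prob (?B u) = sdiff {x \<in> space M. t l x \<in> E} (pre N {x \<in> space M. t l x \<in> E})" by (simp add: sdiff_def)
  qed
  also have "\<dots> = 2 * h l * sdiff {x \<in> space M. t l x \<in> E} (pre N {x \<in> space M. t l x \<in> E})"
    using h_ge1[of l] by simp
  finally show ?thesis .
qed

text \<open>Translating by \<open>h l\<close> displaces exactly one of the two orbits by one step.
  If the orbits matched with fewer than \<open>c\<close> errors both before and after, one of them
  would match itself displaced by one with fewer than \<open>2 * c\<close> errors, whereas
  \<open>jumps_dense\<close> produces at least that many.\<close>

lemma split_far: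
  assumes x: "x \<in> space M" and ll: "l0 \<le> l" and h5: "5 \<le> h l0"
    and mx: "t l x + 2 * h l0 + 2 < h l" and my: "t l (TT N x) + 2 * h l0 + 2 < h l"
    and sp: "split_at l (D l x) (D l (TT N x))" and c: "2 * (c::real) \<le> card (jumps l0 E)"
  shows "x \<in> far l0 E N c \<or> TT (h l) x \<in> far l0 E N c"
proof (rule ccontr)
  assume nf: "\<not> ?thesis"
  define y where "y = TT N x"
  have y: "y \<in> space M" using x by (simp add: y_def)
  obtain bx where bx: "bx = 0 \<or> bx = 1" "t l (TT (h l) x) = t l x + bx"
     "D l x \<in> Sh l \<Longrightarrow> bx = 1" "D l x \<notin> Sh l \<Longrightarrow> D l x \<noteq> A l - 1 \<Longrightarrow> bx = 0"
    using TT_block[OF x, of l] mx h5 by auto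
  obtain b where b: "b = 0 \<or> b = 1" "t l (TT (h l) y) = t l y + b"
     "D l y \<in> Sh l \<Longrightarrow> b = 1" "D l y \<notin> Sh l \<Longrightarrow> D l y \<noteq> A l - 1 \<Longrightarrow> b = 0"
    using TT_block[OF y, of l] my h5 by (auto simp: y_def)
  have ne: "(bx = 0 \<and> b = 1) \<or> (bx = 1 \<and> b = 0)"
    using sp bx b unfolding split_at_def y_def[symmetric] by auto
  have shift: "t l0 (TT u (TT (h l) v)) = t l0 (TT (u + e) v)"
    if v: "v \<in> space M" and e: "e = 0 \<or> e = 1" "t l (TT (h l) v) = t l v + e" and u: "0 \<le> u" "u < 2 * h l0"
      and m: "t l v + 2 * h l0 + 2 < h l" for u v e
  proof -
    have "t l (TT u (TT (h l) v)) = t l v + e + u"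
      using TT_shift(1)[of "TT (h l) v" l u l] e u m v tD(1)[OF v, of l] by auto
    moreover have "t l (TT (u + e) v) = t l v + (u + e)"
      using TT_shift(1)[of v l "u + e" l] e u m v tD(1)[OF v, of l] by auto
    ultimately have "t l (TT u (TT (h l) v)) = t l (TT (u + e) v)" by simp
    thus ?thesis using v(1) by (intro t_decode[OF _ _ _ ll]) simp_all
  qed
  let ?g = "\<lambda>x. t l0 x \<in> E"
  let ?I = "{0..<2 * h l0}"
  let ?U1 = "{u \<in> ?I. ?g (TT u x) \<noteq> ?g (TT u y)}"
  let ?U2 = "{u \<in> ?I. ?g (TT u (TT (h l) x)) \<noteq> ?g (TT u (TT N (TT (h l) x)))}"
  have "TT N (TT (h l) x) = TT (h l) y" using x by (simp add: y_def TT_TT add.commute)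
  hence U2: "?U2 = {u \<in> ?I. ?g (TT (u + bx) x) \<noteq> ?g (TT (u + b) y)}"
    using shift[OF x bx(1,2) _ _ mx] shift[OF y b(1,2)] my y_def by auto
  have c1: "real (card ?U1) < c" using nf x by (auto simp: far_def mismatch_def y_def)
  have c2: "real (card ?U2) < c" using nf x by (auto simp: far_def mismatch_def)
  have "card (jumps l0 E) \<le> card (?U1 \<union> ?U2)"
  proof (cases "bx = 0")
    case True
    have fin: "finite (?U1 \<union> {u \<in> ?I. ?g (TT (u + bx) x) \<noteq> ?g (TT (u + b) y)})"
      by (rule finite_subset[of _ ?I]) auto
    have "card (jumps l0 E) \<le> card {u \<in> ?I. ?g (TT u y) \<noteq> ?g (TT (u + 1) y)}" by (rule jumps_dense[OF y h5])
    also have "\<dots> \<le> card (?U1 \<union> ?U2)" unfolding U2 using True ne by (intro card_mono fin) auto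
    finally show ?thesis .
  next
    case False
    have fin: "finite (?U1 \<union> {u \<in> ?I. ?g (TT (u + bx) x) \<noteq> ?g (TT (u + b) y)})"
      by (rule finite_subset[of _ ?I]) auto
    have "card (jumps l0 E) \<le> card {u \<in> ?I. ?g (TT u x) \<noteq> ?g (TT (u + 1) x)}" by (rule jumps_dense[OF x h5])
    also have "\<dots> \<le> card (?U1 \<union> ?U2)" unfolding U2 using False ne by (intro card_mono fin) auto
    finally show ?thesis .
  qed
  also have "\<dots> \<le> card ?U1 + card ?U2" by (rule card_Un_le)
  finally have "real (card (jumps l0 E)) \<le> real (card ?U1) + real (card ?U2)" by linarith
  thus False using c1 c2 c by linarith
qed

lemma TT_blocks_forward:
  assumes x: "x \<in> space M" and "t l x + int n + 2 < h l"
  shows "\<exists>s. 0 \<le> s \<and> s \<le> int n \<and> t l (TT (int n * h l) x) = t l x + s \<and> D l (TT (int n * h l) x) = (D l x + int n) mod A l"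
  using assms(2)
proof (induction n)
  case 0
  thus ?case using x tD[OF x, of l] by (simp add: TT_0 mod_pos_pos_trivial)
next
  case (Suc n)
  then obtain s where s: "0 \<le> s" "s \<le> int n" "t l (TT (int n * h l) x) = t l x + s" "D l (TT (int n * h l) x) = (D l x + int n) mod A l"
    by auto
  define v where "v = TT (int n * h l) x"
  have v: "v \<in> space M" using x by (simp add: v_def)
  obtain b where b: "b = 0 \<or> b = 1" "t l (TT (h l) v) = t l v + b" "D l (TT (h l) v) = (D l v + 1) mod A l"
    using TT_block[OF v, of l] s Suc.prems by (auto simp: v_def)
  have "TT (h l) v = TT (int (Suc n) * h l) x" using TT_TT[OF x] by (simp add: v_def algebra_simps)
  moreover have "(D l v + 1) mod A l = (D l x + int (Suc n)) mod A l"
    using s by (simp add: v_def mod_simps algebra_simps)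
  ultimately show ?case using b s by (intro exI[of _ "s + b"]) (auto simp: v_def)
qed

lemma TT_blocks_backward:
  assumes x: "x \<in> space M" and lo: "int n + 3 \<le> t l x" and "t l x + 3 < h l"
  shows "\<exists>s. 0 \<le> s \<and> s \<le> int n \<and> t l (TT (- int n * h l) x) = t l x - s \<and> D l (TT (- int n * h l) x) = (D l x - int n) mod A l"
  using assms(2)
proof (induction n)
  case 0
  thus ?case using x tD[OF x, of l] by (simp add: TT_0 mod_pos_pos_trivial)
next
  case (Suc n)
  then obtain s where s: "0 \<le> s" "s \<le> int n" "t l (TT (- int n * h l) x) = t l x - s" "D l (TT (- int n * h l) x) = (D l x - int n) mod A l"
    by auto
  define v where "v = TT (- int n * h l) x"
  have v: "v \<in> space M" using x by (simp add: v_def)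
  obtain b where b: "b = 0 \<or> b = 1" "t l (TT (- h l) v) = t l v - b" "D l (TT (- h l) v) = (D l v - 1) mod A l"
    using TT_block_back[OF v, of l] s Suc.prems assms(3) by (auto simp: v_def)
  have "TT (- h l) v = TT (- int (Suc n) * h l) x" using TT_TT[OF x] by (simp add: v_def algebra_simps)
  moreover have "(D l v - 1) mod A l = (D l x - int (Suc n)) mod A l"
    using s by (simp add: v_def mod_simps algebra_simps)
  ultimately show ?case using b s by (intro exI[of _ "s + b"]) (auto simp: v_def)
qed

lemma TT_blocks:
  assumes x: "x \<in> space M" and "\<bar>r\<bar> + 3 \<le> t l x" "t l x + \<bar>r\<bar> + 3 < h l"
  shows "\<exists>s. \<bar>s\<bar> \<le> \<bar>r\<bar> \<and> t l (TT (r * h l) x) = t l x + s \<and> D l (TT (r * h l) x) = (D l x + r) mod A l"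
proof (cases "0 \<le> r")
  case True
  then obtain n where "r = int n" using nonneg_int_cases by blast
  thus ?thesis using TT_blocks_forward[OF x, of l n] assms by auto
next
  case False
  then obtain n where n: "r = - int n" by (metis linear minus_minus nonneg_int_cases neg_0_le_iff_le)
  then obtain s where "0 \<le> s" "s \<le> int n" "t l (TT (r * h l) x) = t l x - s" "D l (TT (r * h l) x) = (D l x + r) mod A l"
    using TT_blocks_backward[OF x, of n l] assms by auto
  thus ?thesis using n by (intro exI[of _ "- s"]) auto
qed

section \<open>The first level at which the digit classes of two points differ\<close>

definition apart :: "nat \<Rightarrow> int \<Rightarrow> 'a set" where
  "apart q N = {x \<in> space M. \<exists>l\<ge>q. st l (D l x) \<noteq> st l (D l (TT N x))}"

definition unlike :: "nat \<Rightarrow> int \<Rightarrow> 'a \<Rightarrow> bool" where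
  "unlike l N x \<longleftrightarrow> (\<exists>j\<in>{-8..8}. st l ((D l x + j) mod A l) \<noteq> st l ((D l (TT N x) + j) mod A l))"

text \<open>The first level of disagreement survives the short translations used in \<open>lowest_far\<close>, because the range
  \<open>-8..8\<close> leaves room for the shifts by at most 7; this makes the bad events of the different levels disjoint.\<close>

definition lowest :: "nat \<Rightarrow> int \<Rightarrow> nat \<Rightarrow> 'a set" where
  "lowest q N l = {x \<in> space M. unlike l N x \<and> (\<forall>i. q \<le> i \<and> i < l \<longrightarrow> \<not> unlike i N x)}"

definition inner :: "nat \<Rightarrow> int \<Rightarrow> 'a set" where
  "inner q R = {x \<in> space M. R \<le> t q x \<and> t q x + R < h q}"

lemma inner_mono: assumes "x \<in> inner q R" "q \<le> l" shows "R \<le> t l x" "t l x + R < h l"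
proof -
  have x: "x \<in> space M" using assms by (simp add: inner_def)
  show "R \<le> t l x" "t l x + R < h l"
    using pt_grow[OF pt_tD[OF x] assms(2)] assms(1) by (auto simp: inner_def)
qed

text \<open>Translating by \<open>r * h l\<close> changes the height at level \<open>l\<close> by at
  most \<open>\<bar>r\<bar>\<close>. The margin at level \<open>q\<close> absorbs this, so the
  levels from \<open>q\<close> up to \<open>l\<close> see only a small translation inside a
  column.\<close>

lemma TT_blocks_lower_digits:
  assumes x: "x \<in> inner q R" and R: "\<bar>r\<bar> + 3 \<le> R" and i: "q \<le> i" "i < l"
  shows "D i (TT (r * h l) x) = D i x"
proof -
  have xs: "x \<in> space M" using x by (simp add: inner_def)
  note ml = inner_mono[OF x, of l]
  obtain s where s: "\<bar>s\<bar> \<le> \<bar>r\<bar>" "t l (TT (r * h l) x) = t l x + s"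
    using TT_blocks[OF xs, of r l] ml R i by auto
  have "0 \<le> t q x + s" "t q x + s + 1 < h q" using x R s by (auto simp: inner_def)
  thus ?thesis using pt_shift(2)[OF pt_tD[OF xs] pt_TT[OF xs] s(2), of q i] i by simp
qed

text \<open>\<open>j\<close> makes the classes differ, \<open>i\<close> turns this into a split, and
  \<open>split_far\<close> may need one more step: \<open>8 + 7 + 1 = 16\<close>. Seen from the new
  point, a witness of \<open>unlike\<close> is \<open>j - r'\<close>, which is \<open>- i\<close> or
  \<open>- i - 1\<close> and so still lies in \<open>-8..8\<close>.\<close>

lemma lowest_far:
  assumes x: "x \<in> inner q R" "TT N x \<in> inner q R" and R: "2 * h l0 + 40 \<le> R" and q: "l0 \<le> q" "q \<le> l"
    and low: "x \<in> lowest q N l" and c: "2 * (c::real) \<le> card (jumps l0 E)" and h5: "5 \<le> h l0"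
  shows "\<exists>r\<in>{-16..16}. TT (r * h l) x \<in> far l0 E N c \<inter> lowest q N l"
proof -
  define y where "y = TT N x"
  have xs: "x \<in> space M" and ys: "y \<in> space M" using x by (auto simp: inner_def y_def)
  have y: "y \<in> inner q R" using x by (simp add: y_def)
  have comm: "TT N (TT z x) = TT z y" for z using xs by (simp add: y_def TT_TT add.commute)
  note ix = inner_mono[OF x(1) q(2)] and iy = inner_mono[OF y q(2)]
  have R40: "40 \<le> R" using R h5 by linarith
  obtain j where j: "j \<in> {-8..8}" "st l ((D l x + j) mod A l) \<noteq> st l ((D l y + j) mod A l)"
    using low by (auto simp: lowest_def unlike_def y_def)
  have A0: "0 < A l" using A_ge2[of l] by simp
  obtain i where i: "i \<in> {-7..7}" "split_at l (((D l x + j) mod A l + i) mod A l) (((D l y + j) mod A l + i) mod A l)"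
    using split_shift[OF _ _ _ _ j(2)] A0 by auto
  define r where "r = j + i"
  have r15: "\<bar>r\<bar> \<le> 15" using i j by (auto simp: r_def)
  define v where "v = TT (r * h l) x"
  have vs: "v \<in> space M" using xs by (simp add: v_def)
  obtain s where s: "\<bar>s\<bar> \<le> \<bar>r\<bar>" "t l v = t l x + s" "D l v = (D l x + r) mod A l"
    using TT_blocks[OF xs, of r l] ix r15 R40 by (auto simp: v_def)
  obtain s' where s': "\<bar>s'\<bar> \<le> \<bar>r\<bar>" "t l (TT N v) = t l y + s'" "D l (TT N v) = (D l y + r) mod A l"
    using TT_blocks[OF ys, of r l] iy r15 R40 unfolding v_def comm by auto
  have sp: "split_at l (D l v) (D l (TT N v))"
    using i(2) unfolding s(3) s'(3) r_def by (simp add: mod_simps add.assoc)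
  have "v \<in> far l0 E N c \<or> TT (h l) v \<in> far l0 E N c"
    using split_far[OF vs _ h5 _ _ sp c] q s s' ix iy r15 R by auto
  moreover have "TT (h l) v = TT ((r + 1) * h l) x" using TT_TT[OF xs] by (simp add: v_def algebra_simps)
  ultimately obtain r' where r': "r' = r \<or> r' = r + 1" "TT (r' * h l) x \<in> far l0 E N c" by (auto simp: v_def)
  have r16: "\<bar>r'\<bar> \<le> 16" using r' r15 by auto
  have Dx: "D l (TT (r' * h l) x) = (D l x + r') mod A l" 
    using TT_blocks[OF xs, of r' l] ix r16 R40 by auto
  have Dy: "D l (TT N (TT (r' * h l) x)) = (D l y + r') mod A l" 
    using TT_blocks[OF ys, of r' l] iy r16 R40 unfolding comm by auto
  have ul: "unlike l N (TT (r' * h l) x)"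
    unfolding unlike_def Dx Dy
    using j(2) r' i(1) by (intro bexI[of _ "j - r'"]) (auto simp: mod_simps r_def algebra_simps)
  have "unlike k N (TT (r' * h l) x) = unlike k N x" if "q \<le> k" "k < l" for k
    unfolding unlike_def comm
    using TT_blocks_lower_digits[OF x(1) _ that, of r'] TT_blocks_lower_digits[OF y _ that, of r'] r16 R40 by (simp add: y_def)
  hence "TT (r' * h l) x \<in> lowest q N l" using ul low xs by (auto simp: lowest_def)
  thus ?thesis using r'(2) r16 by (intro bexI[of _ r']) auto
qed

lemma digit_pred_meas: "{x \<in> space M. Q (D l x) (D l (TT N x))} \<in> sets M"
proof -
  have "{x \<in> space M. Q (D l x) (D l (TT N x))} = (\<Union>(a, b)\<in>{(a, b). Q a b}. {x \<in> space M. D l x = a \<and> D l (TT N x) = b})"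
    by auto
  also have "\<dots> \<in> sets M" by (intro sets.countable_UN' uncountable_def[THEN iffD1]) auto
  finally show ?thesis .
qed

lemma unlike_meas: "{x \<in> space M. unlike l N x} \<in> sets M"
  unfolding unlike_def by (rule digit_pred_meas)

lemma lowest_meas [measurable]: "lowest q N l \<in> sets M"
proof -
  have "lowest q N l = {x \<in> space M. unlike l N x} - (\<Union>i\<in>{q..<l}. {x \<in> space M. unlike i N x})"
    by (auto simp: lowest_def)
  thus ?thesis using unlike_meas by auto
qed

lemma apart_meas [measurable]: "apart q N \<in> sets M"
proof -
  have "apart q N = (\<Union>l\<in>{q..}. {x \<in> space M. st l (D l x) \<noteq> st l (D l (TT N x))})"
    by (auto simp: apart_def)
  thus ?thesis using digit_pred_meas by auto
qed

lemma inner_meas [measurable]: "inner q R \<in> sets M"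
proof -
  have "inner q R = {x \<in> space M. t q x \<in> {v. R \<le> v \<and> v + R < h q}}" by (auto simp: inner_def)
  moreover have "t q -` {v. R \<le> v \<and> v + R < h q} \<inter> space M \<in> sets M" by (rule measurable_sets[OF t_meas]) simp
  moreover have "t q -` {v. R \<le> v \<and> v + R < h q} \<inter> space M = {x \<in> space M. t q x \<in> {v. R \<le> v \<and> v + R < h q}}" by auto
  ultimately show ?thesis by (simp only:)
qed

lemma apart_sub:
  assumes x: "x \<in> apart q N"
  shows "\<exists>l\<ge>q. x \<in> lowest q N l"
proof -
  have xs: "x \<in> space M" using x by (simp add: apart_def)
  obtain l where "l \<ge> q" "st l (D l x) \<noteq> st l (D l (TT N x))" using x by (auto simp: apart_def)
  hence "unlike l N x" unfolding unlike_def
    using tD(3,4)[OF xs, of l] tD(3,4)[of "TT N x" l] xs by (intro bexI[of _ 0]) (auto simp: mod_pos_pos_trivial)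
  define k where "k = (LEAST l. q \<le> l \<and> unlike l N x)"
  have "q \<le> k \<and> unlike k N x" unfolding k_def using \<open>l \<ge> q\<close> \<open>unlike l N x\<close> by (metis (mono_tags, lifting) LeastI)
  moreover have "\<not> (q \<le> i \<and> unlike i N x)" if "i < k" for i using not_less_Least that unfolding k_def by blast
  ultimately show ?thesis using xs by (intro exI[of _ k]) (auto simp: lowest_def)
qed

text \<open>One of 33 translations at the lowest level carries a point of \<open>apart\<close> with
  margins into the part of \<open>far\<close> with that same lowest level. These parts are disjoint,
  so summing over all levels costs only 33 times \<open>far\<close>. The second term accounts for
  \<open>x\<close> or \<open>TT N x\<close> lacking the margin.\<close>

lemma prob_apart:
  assumes R: "2 * h l0 + 40 \<le> R" and q: "l0 \<le> q" and c: "2 * (c::real) \<le> card (jumps l0 E)" and h5: "5 \<le> h l0"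
  shows "prob (apart q N) \<le> 33 * prob (far l0 E N c) + 2 * prob (space M - inner q R)"
proof -
  define F where "F l = far l0 E N c \<inter> lowest q N (q + l)" for l
  define V where "V l = (\<Union>r\<in>{-16..16::int}. pre (r * h (q + l)) (F l))" for l
  have Fm: "F l \<in> sets M" for l by (simp add: F_def)
  have Vm: "V l \<in> sets M" for l using Fm by (auto simp: V_def)
  have "disjoint_family F"
    unfolding disjoint_family_on_def
  proof safe
    fix m n x assume "m \<noteq> n" "x \<in> F m" "x \<in> F n"
    thus "x \<in> {}" by (cases m n rule: linorder_cases) (auto simp: F_def lowest_def)
  qed
  hence sm: "(\<lambda>l. prob (F l)) sums prob (\<Union>l. F l)"
    using Fm by (intro finite_measure_UNION) auto
  have le: "prob (\<Union>l. F l) \<le> prob (far l0 E N c)" by (intro finite_measure_mono) (auto simp: F_def)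
  have V33: "prob (V l) \<le> 33 * prob (F l)" for l
  proof -
    have "prob (V l) \<le> (\<Sum>r\<in>{-16..16::int}. prob (pre (r * h (q + l)) (F l)))"
      unfolding V_def using Fm by (intro finite_measure_subadditive_finite) auto
    thus ?thesis using prob_TT[OF Fm] by simp
  qed
  have sV: "summable (\<lambda>l. prob (V l))"
    by (rule summable_comparison_test[OF _ summable_mult[OF sums_summable[OF sm], of 33]]) (use V33 in auto)
  have "prob (\<Union>l. V l) \<le> (\<Sum>l. prob (V l))"
    using Vm sV by (intro finite_measure_subadditive_countably) auto
  also have "\<dots> \<le> (\<Sum>l. 33 * prob (F l))" using V33 sV sums_summable[OF sm] by (intro suminf_le summable_mult) auto
  also have "\<dots> = 33 * prob (\<Union>l. F l)" using sm sums_summable[OF sm] by (simp add: suminf_mult sums_iff)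
  finally have PV: "prob (\<Union>l. V l) \<le> 33 * prob (far l0 E N c)" using le by linarith
  have "apart q N \<subseteq> (\<Union>l. V l) \<union> ((space M - inner q R) \<union> pre N (space M - inner q R))"
  proof
    fix x assume x: "x \<in> apart q N"
    have xs: "x \<in> space M" using x by (simp add: apart_def)
    obtain l where l: "l \<ge> q" "x \<in> lowest q N l" using apart_sub[OF x] by blast
    show "x \<in> (\<Union>l. V l) \<union> ((space M - inner q R) \<union> pre N (space M - inner q R))"
    proof (cases "x \<in> inner q R \<and> TT N x \<in> inner q R")
      case True
      obtain r where "r \<in> {-16..16}" "TT (r * h l) x \<in> far l0 E N c \<inter> lowest q N l"
        using lowest_far[OF _ _ R q l(1) l(2) c h5] True by blast
      hence "x \<in> V (l - q)" using l xs by (auto simp: V_def F_def)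
      thus ?thesis by blast
    qed (use xs in auto)
  qed
  hence "prob (apart q N) \<le> prob ((\<Union>l. V l) \<union> ((space M - inner q R) \<union> pre N (space M - inner q R)))"
    using Vm by (intro finite_measure_mono) auto
  also have "\<dots> \<le> prob (\<Union>l. V l) + prob ((space M - inner q R) \<union> pre N (space M - inner q R))"
    using Vm by (intro measure_Un_le) auto
  also have "prob ((space M - inner q R) \<union> pre N (space M - inner q R)) \<le> prob (space M - inner q R) + prob (pre N (space M - inner q R))"
    by (intro measure_Un_le) auto
  also have "prob (pre N (space M - inner q R)) = prob (space M - inner q R)" by (intro prob_TT) auto
  finally show ?thesis using PV by simp
qed

lemma prob_not_inner: assumes "0 \<le> R" shows "prob (space M - inner q R) \<le> 2 * R * w q"
proof -
  have "space M - inner q R \<subseteq> {x \<in> space M. t q x \<in> {0..<R} \<union> {h q - R..<h q}}"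
    using tD(1,2) by (auto simp: inner_def)
  hence "prob (space M - inner q R) \<le> prob {x \<in> space M. t q x \<in> {0..<R} \<union> {h q - R..<h q}}"
    by (intro finite_measure_mono) auto
  also have "\<dots> \<le> card ({0..<R} \<union> {h q - R..<h q}) * w q" by (rule prob_in_le) simp
  also have "\<dots> \<le> (2 * R) * w q"
  proof -
    have "card ({0..<R} \<union> {h q - R..<h q}) \<le> card {0..<R} + card {h q - R..<h q}" by (rule card_Un_le)
    hence "real (card ({0..<R} \<union> {h q - R..<h q})) \<le> 2 * R" using assms by (simp add: of_nat_diff)
    thus ?thesis using w_nonneg[of q] by (intro mult_right_mono) auto
  qed
  finally show ?thesis by simp
qed

text \<open>A single step can enter or leave the union of levels only at a jump or at one of the two
  top heights.\<close>

lemma jumps_many: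
  assumes "2 \<le> h l"
  shows "sdiff {x \<in> space M. t l x \<in> E} (pre 1 {x \<in> space M. t l x \<in> E}) \<le> (card (jumps l E) + 2) * w l"
proof -
  have fin: "finite (jumps l E)" by (rule finite_subset[of _ "{0..<h l}"]) (auto simp: jumps_def)
  have "sym_diff {x \<in> space M. t l x \<in> E} (pre 1 {x \<in> space M. t l x \<in> E}) \<subseteq> {x \<in> space M. t l x \<in> jumps l E \<union> {h l - 2, h l - 1}}"
  proof
    fix x assume a: "x \<in> sym_diff {x \<in> space M. t l x \<in> E} (pre 1 {x \<in> space M. t l x \<in> E})"
    hence x: "x \<in> space M" by auto
    show "x \<in> {x \<in> space M. t l x \<in> jumps l E \<union> {h l - 2, h l - 1}}"
    proof (cases "t l x + 2 < h l")
      case True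
      have "t l (TT 1 x) = t l x + 1" using TT_shift(1)[OF x, of l 1 l] True tD(1)[OF x, of l] by simp
      thus ?thesis using a x True tD(1)[OF x, of l] by (auto simp: jumps_def)
    next
      case False
      thus ?thesis using x tD(2)[OF x, of l] by auto
    qed
  qed
  hence "sdiff {x \<in> space M. t l x \<in> E} (pre 1 {x \<in> space M. t l x \<in> E}) \<le> prob {x \<in> space M. t l x \<in> jumps l E \<union> {h l - 2, h l - 1}}"
    unfolding sdiff_def by (intro finite_measure_mono) auto
  also have "\<dots> \<le> card (jumps l E \<union> {h l - 2, h l - 1}) * w l" using fin by (intro prob_in_le) auto
  also have "\<dots> \<le> (card (jumps l E) + 2) * w l"
  proof -
    have "card (jumps l E \<union> {h l - 2, h l - 1}) \<le> card (jumps l E) + card {h l - 2, h l - 1}" by (rule card_Un_le)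
    also have "\<dots> \<le> card (jumps l E) + 2" by simp
    finally have "real (card (jumps l E \<union> {h l - 2, h l - 1})) \<le> real (card (jumps l E) + 2)" by (simp only: of_nat_le_iff)
    thus ?thesis using w_nonneg[of l] by (intro mult_right_mono)
  qed
  finally show ?thesis by simp
qed

text \<open>The level \<open>l0\<close> is fixed by approximating \<open>B\<close>, which yields at
  least \<open>g * h l0 / 4\<close> jumps. Only afterwards is \<open>q\<close> taken so high that
  margins of size \<open>2 * h l0 + 40\<close> are rarely missed; neither choice depends on
  \<open>N\<close>.\<close>

theorem prob_apart_small:
  assumes B: "B \<in> sets M" and pos: "0 < sdiff B (pre 1 B)" and e: "0 < e"
  shows "\<exists>d>0. \<exists>q0. \<forall>q\<ge>q0. \<forall>N. sdiff B (pre N B) \<le> d \<longrightarrow> prob (apart q N) \<le> e"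
proof -
  define g where "g = sdiff B (pre 1 B)"
  \<comment> \<open>Here \<open>3168 = 48 * 66\<close>: \<open>far\<close> gets probability at most
    \<open>16 * (3 * d) / g \<le> e / 66\<close>, so its 33 translates cost \<open>e / 2\<close>,
    and missing margins cost the other half.\<close>
  define d where "d = min (g / 8) (e * g / 3168)"
  have g: "0 < g" and d: "0 < d" "d \<le> g / 8" "d \<le> e * g / 3168" using pos e by (auto simp: g_def d_def)
  obtain l1 where l1: "\<And>l. l \<ge> l1 \<Longrightarrow> \<exists>E. sdiff B {x \<in> space M. t l x \<in> E} < d" using level_approx[OF B d(1)] by blast
  have "eventually (\<lambda>l. w l < g / 8) sequentially" using order_tendstoD(2)[OF w_tendsto, of "g / 8"] g by simp
  then obtain l2 where l2: "\<And>l. l \<ge> l2 \<Longrightarrow> w l < g / 8" unfolding eventually_sequentially by blast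
  define l0 where "l0 = max (max l1 l2) 5"
  have w0: "w l0 < g / 8" using l2 by (simp add: l0_def)
  have h5: "5 \<le> h l0" using h_ge_self[of l0] by (simp add: l0_def)
  obtain E where E: "sdiff B {x \<in> space M. t l0 x \<in> E} < d" using l1[of l0] unfolding l0_def by (metis max.cobounded1 max.coboundedI1)
  define G where "G = {x \<in> space M. t l0 x \<in> E}"
  have Gm: "G \<in> sets M" by (simp add: G_def)
  have BG: "sdiff B G < d" using E by (simp add: G_def)
  have close: "\<bar>sdiff B (pre N B) - sdiff G (pre N G)\<bar> \<le> 2 * d" for N
  proof -
    have p: "sdiff (pre N B) (pre N G) < d" using sdiff_pre[OF B Gm] BG by simp
    have "sdiff B (pre N B) \<le> sdiff B G + sdiff G (pre N B)" "sdiff G (pre N B) \<le> sdiff G (pre N G) + sdiff (pre N G) (pre N B)"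
      "sdiff G (pre N G) \<le> sdiff G B + sdiff B (pre N G)" "sdiff B (pre N G) \<le> sdiff B (pre N B) + sdiff (pre N B) (pre N G)"
      using B Gm by (intro sdiff_triangle; simp)+
    thus ?thesis using p BG sdiff_commute[of B G] sdiff_commute[of "pre N B" "pre N G"] by linarith
  qed
  have "3 * g / 4 \<le> sdiff G (pre 1 G)" using close[of 1] d(2) g unfolding g_def[symmetric] by linarith
  also have "\<dots> \<le> (card (jumps l0 E) + 2) * w l0" unfolding G_def by (rule jumps_many) (use h5 in simp)
  finally have "g / 2 \<le> card (jumps l0 E) * w l0" using w0 by (simp add: algebra_simps)
  also have "\<dots> \<le> card (jumps l0 E) * (2 / h l0)"
  proof (intro mult_left_mono)
    have "w l0 \<le> 1 / (h l0 - 1)" using w_le_inverse[of l0] h5 by simp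
    also have "\<dots> \<le> 2 / h l0" using h5 by (simp add: field_simps)
    finally show "w l0 \<le> 2 / h l0" .
  qed simp
  finally have K: "2 * (g * h l0 / 8) \<le> card (jumps l0 E)" using h5 by (simp add: field_simps)
  define R where "R = 2 * h l0 + 40"
  have R: "0 < R" using h5 by (simp add: R_def)
  have "eventually (\<lambda>l. w l < e / (8 * R)) sequentially" using order_tendstoD(2)[OF w_tendsto, of "e / (8 * R)"] e R by simp
  then obtain q1 where q1: "\<And>q. q \<ge> q1 \<Longrightarrow> w q < e / (8 * R)" unfolding eventually_sequentially by blast
  show ?thesis
  proof (intro exI[of _ d] conjI d exI[of _ "max l0 q1"] allI impI)
    fix q N assume q: "max l0 q1 \<le> q" and N: "sdiff B (pre N B) \<le> d"
    have c: "0 < g * h l0 / 8" using g h5 by simp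
    have "prob (far l0 E N (g * h l0 / 8)) \<le> 2 * h l0 * sdiff G (pre N G) / (g * h l0 / 8)"
      using prob_far[OF c, of l0 E N] unfolding G_def .
    also have "\<dots> = 16 * sdiff G (pre N G) / g" using h5 g by (simp add: field_simps)
    also have "\<dots> \<le> 16 * (3 * (e * g / 3168)) / g"
      using close[of N] N d(3) g by (intro divide_right_mono) auto
    also have "\<dots> = e / 66" using g by (simp add: field_simps)
    finally have 1: "prob (far l0 E N (g * h l0 / 8)) \<le> e / 66" .
    have "prob (space M - inner q R) \<le> 2 * R * w q" using prob_not_inner[of R q] R by simp
    also have "\<dots> \<le> 2 * R * (e / (8 * R))" using q1[of q] q R by (intro mult_left_mono) auto
    also have "\<dots> = e / 4" using R by (simp add: field_simps)
    finally have 2: "prob (space M - inner q R) \<le> e / 4" .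
    show "prob (apart q N) \<le> e"
      using prob_apart[where ?l0.0 = l0 and R = R and q = q and c = "g * h l0 / 8" and E = E and N = N] 1 2 q K h5 by (simp add: R_def)
  qed
qed

end

text \<open>On good points \<open>W\<close> has a constant slope \<open>b\<close> for differences up
  to \<open>H\<close>. A difference of \<open>H\<close> then changes \<open>W\<close> by
  \<open>H * b\<close>, but the values lie in an interval of length \<open>H\<close>, so
  \<open>b = 0\<close>.\<close>

lemma freiman_const:
  fixes W :: "int \<Rightarrow> int" and H :: int
  assumes bad: "int (card ({0..4 * H} - G)) < H"
    and rng: "\<And>a. a \<in> G \<Longrightarrow> 0 \<le> W a \<and> W a < H"
    and G01: "0 \<in> G" "1 \<in> G"
    and hom: "\<And>a b c d. a \<in> G \<Longrightarrow> b \<in> G \<Longrightarrow> c \<in> G \<Longrightarrow> d \<in> G \<Longrightarrow> a - b = c - d \<Longrightarrow> W a - W b = W c - W d"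
  shows "W 1 = W 0"
proof -
  define B where "B = {0..4 * H} - G"
  have finB: "finite B" by (simp add: B_def)
  have H: "0 < H" using rng[OF G01(1)] by linarith
  \<comment> \<open>Fewer than \<open>H\<close> points are bad, so three translates of the bad set
    cannot cover \<open>3 * H\<close> starting points.\<close>
  have ex: "\<exists>a. a \<in> G \<and> a + d \<in> G \<and> a + d' \<in> G" if d: "0 \<le> d" "d \<le> H" "0 \<le> d'" "d' \<le> H" for d d'
  proof (rule ccontr)
    assume no: "\<not> ?thesis"
    have "{0..<3 * H} \<subseteq> B \<union> (\<lambda>x. x - d) ` B \<union> (\<lambda>x. x - d') ` B"
    proof
      fix a assume a: "a \<in> {0..<3 * H}"
      have "a \<in> B \<or> a + d \<in> B \<or> a + d' \<in> B" using no a d by (auto simp: B_def)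
      thus "a \<in> B \<union> (\<lambda>x. x - d) ` B \<union> (\<lambda>x. x - d') ` B"
        by (auto simp: image_iff intro: bexI[of _ "a + d"] bexI[of _ "a + d'"])
    qed
    hence "card {0..<3 * H} \<le> card (B \<union> (\<lambda>x. x - d) ` B \<union> (\<lambda>x. x - d') ` B)"
      using finB by (intro card_mono) auto
    also have "\<dots> \<le> card (B \<union> (\<lambda>x. x - d) ` B) + card ((\<lambda>x. x - d') ` B)" by (rule card_Un_le)
    also have "\<dots> \<le> card B + card ((\<lambda>x. x - d) ` B) + card ((\<lambda>x. x - d') ` B)" using card_Un_le by simp
    also have "\<dots> \<le> card B + card B + card B" using card_image_le[OF finB] by (intro add_mono) auto
    finally have "int (card {0..<3 * H}) \<le> 3 * int (card B)" by linarith
    thus False using bad H unfolding B_def by simp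
  qed
  define b where "b = W 1 - W 0"
  have key: "int n \<le> H \<longrightarrow> (\<forall>a. a \<in> G \<and> a + int n \<in> G \<longrightarrow> W (a + int n) - W a = int n * b)" for n
  proof (induction n)
    case (Suc n)
    show ?case
    proof (intro impI allI)
      fix a' assume le: "int (Suc n) \<le> H" and a': "a' \<in> G \<and> a' + int (Suc n) \<in> G"
      obtain a where a: "a \<in> G" "a + int n \<in> G" "a + int (Suc n) \<in> G"
        using ex[of "int n" "int (Suc n)"] le by auto
      have "W (a + int (Suc n)) - W (a + int n) = b" unfolding b_def using a G01 by (intro hom) auto
      moreover have "W (a + int n) - W a = int n * b" using Suc le a by auto
      moreover have "W (a' + int (Suc n)) - W a' = W (a + int (Suc n)) - W a" using a a' by (intro hom) auto
      ultimately show "W (a' + int (Suc n)) - W a' = int (Suc n) * b" by (simp add: algebra_simps)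
    qed
  qed simp
  obtain a where a: "a \<in> G" "a + H \<in> G" using ex[of H H] H by auto
  have "W (a + H) - W a = H * b" using key[of "nat H"] a H by simp
  hence "\<bar>H * b\<bar> < H" using rng[OF a(1)] rng[OF a(2)] by linarith
  hence "H * \<bar>b\<bar> < H * 1" using H by (simp add: abs_mult)
  hence "b = 0" using H by (simp only: mult_less_cancel_left_pos)
  thus ?thesis by (simp add: b_def)
qed

section \<open>From equal digit classes to equal heights\<close>

context tower
begin

text \<open>At a high level the heights of \<open>TT (a * n) x\<close> are affine in
  \<open>a\<close>. All good translates share the classes of \<open>x\<close>, so
  \<open>pt_freiman\<close> brings equalities of differences down to level \<open>q\<close>, where
  \<open>freiman_const\<close> applies.\<close>

lemma t_eq_of_mostly_alike:
  assumes x: "x \<in> space M" and q: "plain q" and n: "x \<notin> apart q n"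
    and few: "card {a \<in> {0..4 * h q}. x \<in> apart q (a * n)} < h q"
  shows "t q x = t q (TT n x)"
proof -
  define G where "G = {a. x \<notin> apart q (a * n)}"
  define W where "W a = t q (TT (a * n) x)" for a
  have "{0..4 * h q} - G = {a \<in> {0..4 * h q}. x \<in> apart q (a * n)}" by (auto simp: G_def)
  hence bad: "int (card ({0..4 * h q} - G)) < h q" using few by simp
  have rng: "0 \<le> W a \<and> W a < h q" for a using tD(1,2)[of "TT (a * n) x" q] x by (simp add: W_def)
  have G0: "0 \<in> G" using x by (auto simp: G_def apart_def TT_0)
  have G1: "1 \<in> G" using n by (simp add: G_def)
  have stG: "st l (D l (TT (a * n) x)) = st l (D l x)" if "a \<in> G" "q \<le> l" for a l
    using that x by (auto simp: G_def apart_def)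
  have hom: "W a - W b = W c - W d" if g: "a \<in> G" "b \<in> G" "c \<in> G" "d \<in> G" "a - b = c - d" for a b c d
  proof -
    have "eventually (\<lambda>m. m \<ge> q \<and> t m (TT (a * n) x) = t m x + a * n \<and> t m (TT (b * n) x) = t m x + b * n
        \<and> t m (TT (c * n) x) = t m x + c * n \<and> t m (TT (d * n) x) = t m x + d * n) sequentially"
      using x by (intro eventually_conj TT_t eventually_ge_at_top)
    then obtain m where m: "m \<ge> q" "t m (TT (a * n) x) = t m x + a * n" "t m (TT (b * n) x) = t m x + b * n"
        "t m (TT (c * n) x) = t m x + c * n" "t m (TT (d * n) x) = t m x + d * n" 
      using eventually_happens'[OF sequentially_bot] by blast
    have "(a - b) * n = (c - d) * n" using g(5) by simp
    hence e: "t m (TT (a * n) x) - t m (TT (b * n) x) = t m (TT (c * n) x) - t m (TT (d * n) x)"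
      unfolding m(2-5) by (simp add: algebra_simps)
    show ?thesis unfolding W_def
      by (rule pt_freiman[OF pt_TT[OF x] pt_TT[OF x] pt_TT[OF x] pt_TT[OF x] e _ q order_refl m(1)])
        (use stG g in auto)
  qed
  have "W 1 = W 0" using freiman_const[OF bad rng G0 G1 hom] .
  thus ?thesis using x by (simp add: W_def TT_0)
qed

text \<open>If \<open>B\<close> is almost invariant under \<open>TT n\<close>, it is so under the first few multiples of \<open>n\<close>. The heights of
  these translates then form a Freiman homomorphism with values in a bounded interval, hence a constant.\<close>

theorem rigidity_transfer:
  assumes B: "B \<in> sets M" and pos: "0 < sdiff B (pre 1 B)" and e: "0 < e"
  shows "\<exists>d>0. \<forall>n. sdiff B (pre n B) \<le> d \<longrightarrow> prob {x \<in> space M. t l x \<noteq> t l (TT n x)} \<le> e"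
proof -
  \<comment> \<open>Markov's inequality over \<open>4 * H + 1 \<le> 5 * H\<close> multiples bounds
    the points with too many bad multiples by \<open>5 * h'\<close>; one more \<open>h'\<close> pays
    for the multiple 1.\<close>
  define h' where "h' = e / 6"
  have e': "0 < h'" using e by (simp add: h'_def)
  obtain d0 q0 where d0: "0 < d0" and q0: "\<And>q N. q \<ge> q0 \<Longrightarrow> sdiff B (pre N B) \<le> d0 \<Longrightarrow> prob (apart q N) \<le> h'"
    using prob_apart_small[OF B pos e'] by blast
  \<comment> \<open>\<open>pt_freiman\<close> has to end at a plain level; of two consecutive levels
    at least one is plain.\<close>
  obtain q where q: "plain q" "q0 \<le> q" "l \<le> q"
  proof (cases "plain (Suc (max q0 l))")
    case True thus thesis using that by simp
  next
    case False
    thus thesis using isolated[OF False] that[of "max q0 l"] by simp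
  qed
  define H where "H = h q"
  have H: "1 \<le> H" by (simp add: H_def h_ge1)
  have RH: "1 \<le> real_of_int H" using H by linarith
  define d where "d = d0 / (4 * H + 1)"
  have d: "0 < d" using d0 RH by (simp add: d_def)
  have "prob {x \<in> space M. t l x \<noteq> t l (TT n x)} \<le> e" if n: "sdiff B (pre n B) \<le> d" for n
  proof -
    have ap: "prob (apart q (a * n)) \<le> h'" if a: "a \<in> {0..4 * H}" for a
    proof -
      have "sdiff B (pre (int (nat a) * n) B) \<le> nat a * sdiff B (pre n B)" by (rule sdiff_pre_multiple[OF B])
      also have "\<dots> \<le> (4 * H + 1) * d" using a n d RH by (intro mult_mono sdiff_nonneg) (auto simp: le_nat_iff)
      also have "\<dots> = d0" using RH by (simp add: d_def)
      finally show ?thesis using q0[OF q(2)] a by simp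
    qed
    let ?V = "{x \<in> space M. real_of_int H \<le> real (card {a \<in> {0..4 * H}. x \<in> apart q (a * n)})}"
    have Vm: "?V \<in> sets M" by (intro count_meas) auto
    have "prob ?V \<le> (\<Sum>a\<in>{0..4 * H}. prob (apart q (a * n))) / H"
      using RH by (intro markov_count) auto
    also have "\<dots> \<le> (\<Sum>a\<in>{0..4 * H}. h') / H"
      using RH ap by (intro divide_right_mono sum_mono) auto
    also have "(\<Sum>a\<in>{0..4 * H}. h') = (4 * H + 1) * h'" using H by simp
    also have "(4 * H + 1) * h' / H \<le> 5 * h'"
    proof -
      have "(4 * H + 1) * h' \<le> (5 * H) * h'" using RH e' by (intro mult_right_mono) auto
      thus ?thesis using RH by (simp add: field_simps)
    qed
    finally have 1: "prob ?V \<le> 5 * h'" .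
    have "1 \<in> {0..4 * H}" using H by simp
    hence 2: "prob (apart q n) \<le> h'" using ap[of 1] by simp
    have "{x \<in> space M. t l x \<noteq> t l (TT n x)} \<subseteq> apart q n \<union> ?V"
    proof safe
      fix x assume x: "x \<in> space M" "t l x \<noteq> t l (TT n x)" "x \<notin> apart q n"
      show "real_of_int H \<le> real (card {a \<in> {0..4 * H}. x \<in> apart q (a * n)})"
      proof (rule ccontr)
        assume "\<not> ?thesis"
        hence "card {a \<in> {0..4 * h q}. x \<in> apart q (a * n)} < h q" unfolding H_def by linarith
        hence "t q x = t q (TT n x)" by (rule t_eq_of_mostly_alike[OF x(1) q(1) x(3)])
        thus False using t_decode[of x "TT n x" q l] x q by simp
      qed
    qed
    hence "prob {x \<in> space M. t l x \<noteq> t l (TT n x)} \<le> prob (apart q n \<union> ?V)"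
      using Vm by (intro finite_measure_mono) auto
    also have "\<dots> \<le> prob (apart q n) + prob ?V" using Vm by (intro measure_Un_le) auto
    finally show ?thesis using 1 2 by (simp add: h'_def)
  qed
  thus ?thesis using d by blast
qed

section \<open>Ergodicity, and cyclic motion on uncut levels\<close>

lemma prob_Int_levels:
  assumes "finite E" "B \<in> sets M"
  shows "prob (B \<inter> {x \<in> space M. t l x \<in> E}) = (\<Sum>i\<in>E. prob (B \<inter> {x \<in> space M. t l x = i}))"
proof -
  have "B \<inter> {x \<in> space M. t l x \<in> E} = (\<Union>i\<in>E. B \<inter> {x \<in> space M. t l x = i})" by auto
  moreover have "prob \<dots> = (\<Sum>i\<in>E. prob (B \<inter> {x \<in> space M. t l x = i}))"
    using assms by (intro finite_measure_finite_Union) (auto simp: disjoint_family_on_def)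
  ultimately show ?thesis by simp
qed

text \<open>An invariant set meets every level below the top in the same measure \<open>c\<close>.
  Being close to a union of levels, it is nearly everything if \<open>c\<close> is at least half of
  \<open>w l\<close> and nearly null otherwise.\<close>

theorem ergodic:
  assumes B: "B \<in> sets M" and inv: "sdiff B (pre 1 B) = 0"
  shows "prob B = 0 \<or> prob B = 1"
proof -
  have invz: "sdiff B (pre i B) = 0" if "0 \<le> i" for i
  proof -
    have "sdiff B (pre (int (nat i) * 1) B) \<le> nat i * sdiff B (pre 1 B)" by (rule sdiff_pre_multiple[OF B])
    thus ?thesis using that inv sdiff_nonneg[of B "pre i B"] by simp
  qed
  have small: "prob B \<le> 4 * e \<or> 1 - prob B \<le> 4 * e" if e: "0 < e" for e
  proof -
    obtain l1 where l1: "\<And>l. l \<ge> l1 \<Longrightarrow> \<exists>E. sdiff B {x \<in> space M. t l x \<in> E} < e" using level_approx[OF B e] by blast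
    have "eventually (\<lambda>l. w l < e) sequentially" using order_tendstoD(2)[OF w_tendsto, of e] e by simp
    then obtain l2 where l2: "\<And>l. l \<ge> l2 \<Longrightarrow> w l < e" unfolding eventually_sequentially by blast
    define l where "l = max l1 l2"
    obtain E where E: "sdiff B {x \<in> space M. t l x \<in> E} < e" using l1[of l] unfolding l_def by (metis max.cobounded1)
    have we: "w l < e" using l2[of l] by (simp add: l_def)
    define c where "c = prob (B \<inter> {x \<in> space M. t l x = 0})"
    have ci: "prob (B \<inter> {x \<in> space M. t l x = i}) = c" if i: "0 \<le> i" "i + 1 < h l" for i
    proof -
      let ?L = "{x \<in> space M. t l x = i}"
      have "prob (B \<inter> ?L) = prob (pre i (B \<inter> ?L))" using prob_TT[of "B \<inter> ?L" i] B by simp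
      also have "pre i (B \<inter> ?L) = pre i B \<inter> {x \<in> space M. t l x = 0}" unfolding level_pre[OF i] by auto
      finally have 1: "prob (B \<inter> ?L) = prob (pre i B \<inter> {x \<in> space M. t l x = 0})" .
      have "sdiff (pre i B \<inter> {x \<in> space M. t l x = 0}) (B \<inter> {x \<in> space M. t l x = 0}) \<le> sdiff B (pre i B)"
        unfolding sdiff_def using B by (intro finite_measure_mono) auto
      hence "sdiff (pre i B \<inter> {x \<in> space M. t l x = 0}) (B \<inter> {x \<in> space M. t l x = 0}) \<le> 0" using invz[OF i(1)] by simp
      hence "prob (pre i B \<inter> {x \<in> space M. t l x = 0}) = c"
        using sdiff_prob[of "pre i B \<inter> {x \<in> space M. t l x = 0}" "B \<inter> {x \<in> space M. t l x = 0}"] B unfolding c_def by simp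
      thus ?thesis using 1 by simp
    qed
    define E1 where "E1 = E \<inter> {0..<h l - 1}"
    define E2 where "E2 = {0..<h l - 1} - E"
    let ?S = "\<lambda>E. {x \<in> space M. t l x \<in> E}"
    have fin: "finite E1" "finite E2" by (auto simp: E1_def E2_def)
    have sub: "E1 \<subseteq> {0..<h l - 1}" "E2 \<subseteq> {0..<h l - 1}" by (auto simp: E1_def E2_def)
    have BE: "prob (B \<inter> ?S F) = card F * c" "prob (?S F - B) = card F * (w l - c)" if F: "F \<subseteq> {0..<h l - 1}" for F
    proof -
      have finF: "finite F" using F finite_subset by blast
      have "(\<Sum>i\<in>F. prob (B \<inter> {x \<in> space M. t l x = i})) = (\<Sum>i\<in>F. c)" using F by (intro sum.cong refl ci) auto
      thus 1: "prob (B \<inter> ?S F) = card F * c" using prob_Int_levels[OF finF B] by simp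
      have "prob (?S F - B) = prob (?S F) - prob (?S F \<inter> B)" using B by (intro finite_measure_Diff') auto
      thus "prob (?S F - B) = card F * (w l - c)" using prob_in_eq[OF F] 1 by (simp add: Int_commute algebra_simps)
    qed
    have top: "prob (?S {h l - 1}) \<le> e" using prob_level_le[of l "h l - 1"] we by simp
    have a2: "card E2 * c \<le> e"
    proof -
      have "prob (B \<inter> ?S E2) \<le> sdiff B (?S E)" unfolding sdiff_def using B by (intro finite_measure_mono) (auto simp: E2_def)
      thus ?thesis using BE(1)[OF sub(2)] E by simp
    qed
    have a1: "card E1 * (w l - c) \<le> e"
    proof -
      have "prob (?S E1 - B) \<le> sdiff B (?S E)" unfolding sdiff_def using B by (intro finite_measure_mono) (auto simp: E1_def)
      thus ?thesis using BE(2)[OF sub(1)] E by simp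
    qed
    show ?thesis
    proof (cases "w l / 2 \<le> c")
      case True
      have "card E2 * (w l / 2) \<le> card E2 * c" using True by (intro mult_left_mono) auto
      hence "prob (?S E2) \<le> 2 * e" using a2 prob_in_eq[OF sub(2)] by simp
      moreover have "space M - B \<subseteq> sym_diff B (?S E) \<union> (?S E2 \<union> ?S {h l - 1})"
        using tD(1,2)[of _ l] by (force simp: E2_def)
      hence "prob (space M - B) \<le> prob (sym_diff B (?S E) \<union> (?S E2 \<union> ?S {h l - 1}))"
        using B by (intro finite_measure_mono) auto
      moreover have "\<dots> \<le> prob (sym_diff B (?S E)) + prob (?S E2 \<union> ?S {h l - 1})" using B by (intro measure_Un_le) auto
      moreover have "prob (?S E2 \<union> ?S {h l - 1}) \<le> prob (?S E2) + prob (?S {h l - 1})" by (intro measure_Un_le) auto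
      ultimately have "prob (space M - B) \<le> 4 * e" using E top unfolding sdiff_def by linarith
      thus ?thesis using prob_compl[OF B] by simp
    next
      case False
      have "card E1 * (w l / 2) \<le> card E1 * (w l - c)" using False by (intro mult_left_mono) auto
      hence "prob (?S E1) \<le> 2 * e" using a1 prob_in_eq[OF sub(1)] by simp
      moreover have "B \<subseteq> sym_diff B (?S E) \<union> (?S E1 \<union> ?S {h l - 1})"
        using tD(1,2)[of _ l] sets.sets_into_space[OF B] by (force simp: E1_def)
      hence "prob B \<le> prob (sym_diff B (?S E) \<union> (?S E1 \<union> ?S {h l - 1}))"
        using B by (intro finite_measure_mono) auto
      moreover have "\<dots> \<le> prob (sym_diff B (?S E)) + prob (?S E1 \<union> ?S {h l - 1})" using B by (intro measure_Un_le) auto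
      moreover have "prob (?S E1 \<union> ?S {h l - 1}) \<le> prob (?S E1) + prob (?S {h l - 1})" by (intro measure_Un_le) auto
      ultimately show ?thesis using E top unfolding sdiff_def by linarith
    qed
  qed
  show ?thesis
  proof (rule ccontr)
    assume n: "\<not> ?thesis"
    define p where "p = prob B"
    define e where "e = min p (1 - p) / 8"
    have p: "0 < p" "p < 1" using n measure_nonneg[of M B] prob_le_1[of B] by (auto simp: less_le p_def)
    have e: "0 < e" "8 * e \<le> p" "8 * e \<le> 1 - p" using p by (auto simp: e_def)
    show False using small[OF e(1)] e unfolding p_def[symmetric] by linarith
  qed
qed

text \<open>Without short copies \<open>blk l c = h l * c\<close>, so the height is the one at level
  \<open>Suc l\<close> reduced modulo \<open>h l\<close>. Outside the last copy, fewer than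
  \<open>h l\<close> steps do not leave the tower of level \<open>Suc l\<close>.\<close>

lemma uncut_cycle:
  assumes x: "x \<in> space M" and S: "Sh l = {}" and Dx: "D l x \<noteq> A l - 1" and u: "0 \<le> u" "u < h l"
  shows "t l (TT u x) = (t l x + u) mod h l"
proof -
  note d = tD[OF x, of l] and p = ptD(5)[OF pt_tD[OF x], of l] and p' = ptD(5)[OF pt_TT[OF x, of u], of l]
  have hS: "h (Suc l) = h l * A l" using blk_uncut[OF S] A_ge2[of l] by (simp add: h_Suc)
  have b: "blk l (D l x) = h l * D l x" "blk l (D l (TT u x)) = h l * D l (TT u x)"
    using blk_uncut[OF S] d tD(3)[of "TT u x" l] x by auto
  have "h l * D l x \<le> h l * (A l - 2)" using d Dx h_ge1[of l] by (intro mult_left_mono) auto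
  hence "t (Suc l) x + u + 1 < h (Suc l)" using p b d u hS by (simp add: algebra_simps)
  moreover have "0 \<le> t (Suc l) x + u" using tD(1)[OF x, of "Suc l"] u by simp
  ultimately have "t (Suc l) (TT u x) = t (Suc l) x + u" using TT_shift(1)[OF x, of "Suc l" u "Suc l"] by simp
  hence "t l x + u + h l * D l x = t l (TT u x) + h l * D l (TT u x)" using p p' b by simp
  hence "(t l x + u) mod h l = t l (TT u x) mod h l" by (metis mod_mult_self2)
  thus ?thesis using tD(1,2)[of "TT u x" l] x by (simp add: mod_pos_pos_trivial)
qed

definition topd :: "nat \<Rightarrow> 'a set" where "topd l = {x \<in> space M. D l x = A l - 1}"

lemma topd_meas [measurable]: "topd l \<in> sets M"
  unfolding topd_def by measurable

lemma prob_topd: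
  assumes S: "Sh l = {}" 
  shows "prob (topd l) \<le> 2 / A l"
proof -
  have hS: "h (Suc l) = h l * A l" using blk_uncut[OF S] A_ge2[of l] by (simp add: h_Suc)
  have "topd l \<subseteq> {x \<in> space M. t (Suc l) x \<in> {h (Suc l) - h l..<h (Suc l)}}"
  proof
    fix x assume x: "x \<in> topd l"
    hence xs: "x \<in> space M" by (simp add: topd_def)
    have "t (Suc l) x = h (Suc l) - h l + t l x" using ptD(5)[OF pt_tD[OF xs], of l] x blk_top[of l] by (simp add: topd_def)
    thus "x \<in> {x \<in> space M. t (Suc l) x \<in> {h (Suc l) - h l..<h (Suc l)}}" using xs tD(1,2)[OF xs, of l] by simp
  qed
  hence "prob (topd l) \<le> prob {x \<in> space M. t (Suc l) x \<in> {h (Suc l) - h l..<h (Suc l)}}"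
    by (intro finite_measure_mono) auto
  also have "\<dots> \<le> card {h (Suc l) - h l..<h (Suc l)} * w (Suc l)" by (intro prob_in_le) simp
  also have "\<dots> = h l * w (Suc l)" using h_ge1[of l] by simp
  also have "\<dots> \<le> 2 / A l"
  proof -
    define a where "a = real_of_int (A l)"
    define b where "b = real_of_int (h l)"
    have a: "2 \<le> a" using A_ge2[of l] unfolding a_def by linarith
    have b: "1 \<le> b" using h_ge1[of l] unfolding b_def by linarith
    have "1 * 2 \<le> b * a" by (rule mult_mono[OF b a]) (use b in linarith)+
    hence ab: "2 \<le> b * a" by linarith
    have "w (Suc l) * (b * a - 1) \<le> 1" using w_le[of "Suc l"] unfolding hS a_def b_def by simp
    moreover have "b * a \<le> 2 * (b * a - 1)" using ab by argo
    hence "w (Suc l) * (b * a) \<le> w (Suc l) * (2 * (b * a - 1))" using w_nonneg[of "Suc l"] by (rule mult_left_mono)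
    ultimately have "b * w (Suc l) * a \<le> 2" by (simp add: algebra_simps)
    thus ?thesis using a unfolding a_def b_def by (simp add: field_simps)
  qed
  finally show ?thesis .
qed

lemma uncut_large:
  assumes e: "0 < e"
  obtains l where "l \<ge> L" "Sh l = {}" "prob (topd l) < e" "w l < e" "l \<ge> 1"
proof -
  have "eventually (\<lambda>l. w l < e) sequentially" using order_tendstoD(2)[OF w_tendsto, of e] e by simp
  then obtain l2 where l2: "\<And>l. l \<ge> l2 \<Longrightarrow> w l < e" unfolding eventually_sequentially by blast
  define K where "K = max (max L l2) (max 1 (nat \<lceil>2 / e\<rceil> + 1))"
  obtain l where l: "l \<ge> K" "Sh l = {}" "A l \<ge> int K" using uncut[of K] by blast
  have "2 / e \<le> real (nat \<lceil>2 / e\<rceil>)" by (rule real_nat_ceiling_ge)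
  also have "\<dots> < real_of_int (A l)" using l(3) unfolding K_def by linarith
  finally have "2 / A l < e" using e A_ge2[of l] by (simp add: field_simps)
  thus thesis using that[of l] prob_topd[OF l(2)] l l2[of l] by (auto simp: K_def)
qed

text \<open>Take \<open>n = h l\<close> at a high uncut level: outside the last copy and the two top
  heights this translation preserves the height.\<close>

lemma rigid:
  assumes B: "B \<in> sets M" and e: "0 < e"
  obtains n :: nat where "1 \<le> n" "sdiff B (pre (int n) B) < e"
proof -
  define e1 where "e1 = e / 5"
  have e1: "0 < e1" using e by (simp add: e1_def)
  obtain l1 where l1: "\<And>l. l \<ge> l1 \<Longrightarrow> \<exists>E. sdiff B {x \<in> space M. t l x \<in> E} < e1" using level_approx[OF B e1] by blast
  obtain l where l: "l \<ge> l1" "Sh l = {}" "prob (topd l) < e1" "w l < e1" using uncut_large[OF e1] by blast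
  obtain E where E: "sdiff B {x \<in> space M. t l x \<in> E} < e1" using l1[OF l(1)] by blast
  define G where "G = {x \<in> space M. t l x \<in> E}"
  have Gm: "G \<in> sets M" by (simp add: G_def)
  have "sym_diff G (pre (h l) G) \<subseteq> topd l \<union> {x \<in> space M. t l x \<in> {h l - 2, h l - 1}}"
  proof
    fix x assume a: "x \<in> sym_diff G (pre (h l) G)"
    hence x: "x \<in> space M" by (auto simp: G_def)
    show "x \<in> topd l \<union> {x \<in> space M. t l x \<in> {h l - 2, h l - 1}}"
    proof (cases "t l x + 2 < h l \<and> D l x \<noteq> A l - 1")
      case True
      hence "t l (TT (h l) x) = t l x" using TT_block[OF x, of l] l(2) by auto
      thus ?thesis using a x by (auto simp: G_def)
    next
      case False
      thus ?thesis using x tD(2)[OF x, of l] by (auto simp: topd_def)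
    qed
  qed
  hence "sdiff G (pre (h l) G) \<le> prob (topd l \<union> {x \<in> space M. t l x \<in> {h l - 2, h l - 1}})"
    unfolding sdiff_def by (intro finite_measure_mono) auto
  also have "\<dots> \<le> prob (topd l) + prob {x \<in> space M. t l x \<in> {h l - 2, h l - 1}}" by (intro measure_Un_le) auto
  also have "prob {x \<in> space M. t l x \<in> {h l - 2, h l - 1}} \<le> 2 * w l"
    using prob_in_le[of "{h l - 2, h l - 1}" l] by simp
  finally have 1: "sdiff G (pre (h l) G) < 3 * e1" using l by linarith
  have "sdiff B (pre (h l) B) \<le> sdiff B G + sdiff G (pre (h l) B)" "sdiff G (pre (h l) B) \<le> sdiff G (pre (h l) G) + sdiff (pre (h l) G) (pre (h l) B)"
    using B Gm by (intro sdiff_triangle; simp)+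
  moreover have "sdiff (pre (h l) G) (pre (h l) B) = sdiff B G" using sdiff_pre[OF Gm B] by (simp add: sdiff_commute)
  ultimately have "sdiff B (pre (h l) B) < e" using 1 E by (simp add: G_def e1_def)
  thus thesis using that[of "nat (h l)"] h_ge1[of l] by simp
qed

end

section \<open>Self-joinings\<close>

text \<open>\<open>J B C\<close> stands for the measure of \<open>B \<times> C\<close> under a self-joining.\<close>

locale tower_joining = tower A Sh M t D TT
  for A Sh and M :: "'a measure" and t D TT +
  fixes J :: "'a set \<Rightarrow> 'a set \<Rightarrow> real"
  assumes J_nonneg: "B \<in> sets M \<Longrightarrow> C \<in> sets M \<Longrightarrow> 0 \<le> J B C"
    and J_add1: "B \<in> sets M \<Longrightarrow> B' \<in> sets M \<Longrightarrow> C \<in> sets M \<Longrightarrow> B \<inter> B' = {} \<Longrightarrow> J (B \<union> B') C = J B C + J B' C"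
    and J_add2: "B \<in> sets M \<Longrightarrow> C \<in> sets M \<Longrightarrow> C' \<in> sets M \<Longrightarrow> C \<inter> C' = {} \<Longrightarrow> J B (C \<union> C') = J B C + J B C'"
    and J_left: "B \<in> sets M \<Longrightarrow> J B (space M) = prob B"
    and J_right: "C \<in> sets M \<Longrightarrow> J (space M) C = prob C"
    and J_inv: "B \<in> sets M \<Longrightarrow> C \<in> sets M \<Longrightarrow> J (pre 1 B) (pre 1 C) = J B C"
begin

lemma J_empty1: "C \<in> sets M \<Longrightarrow> J {} C = 0" and J_empty2: "C \<in> sets M \<Longrightarrow> J C {} = 0"
  using J_add1[of "{}" "{}" C] J_add2[of C "{}" "{}"] by auto

lemma J_sum1:
  assumes "finite I" "disjoint_family_on B I" "\<And>i. i \<in> I \<Longrightarrow> B i \<in> sets M" "C \<in> sets M"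
  shows "J (\<Union>i\<in>I. B i) C = (\<Sum>i\<in>I. J (B i) C)"
  using assms
proof (induction I rule: finite_induct)
  case (insert i I)
  have "B i \<inter> (\<Union>i\<in>I. B i) = {}" using insert by (auto simp: disjoint_family_on_def)
  moreover have "disjoint_family_on B I" using insert(4) by (rule disjoint_family_on_mono[rotated]) auto
  moreover have "(\<Union>i\<in>I. B i) \<in> sets M" using insert by (intro sets.finite_UN) auto
  ultimately show ?case using insert J_add1[of "B i" "\<Union>i\<in>I. B i" C] by simp
qed (simp add: J_empty1)

lemma J_sum2:
  assumes "finite I" "disjoint_family_on C I" "\<And>i. i \<in> I \<Longrightarrow> C i \<in> sets M" "B \<in> sets M"
  shows "J B (\<Union>i\<in>I. C i) = (\<Sum>i\<in>I. J B (C i))"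
  using assms
proof (induction I rule: finite_induct)
  case (insert i I)
  have "C i \<inter> (\<Union>i\<in>I. C i) = {}" using insert by (auto simp: disjoint_family_on_def)
  moreover have "disjoint_family_on C I" using insert(4) by (rule disjoint_family_on_mono[rotated]) auto
  moreover have "(\<Union>i\<in>I. C i) \<in> sets M" using insert by (intro sets.finite_UN) auto
  ultimately show ?case using insert J_add2[of B "C i" "\<Union>i\<in>I. C i"] by simp
qed (simp add: J_empty2)

lemma J_mono1: assumes "B \<subseteq> B'" "B \<in> sets M" "B' \<in> sets M" "C \<in> sets M" shows "J B C \<le> J B' C"
proof -
  have "B' = B \<union> (B' - B)" using assms by auto
  hence "J B' C = J B C + J (B' - B) C" using J_add1[of B "B' - B" C] assms by auto
  thus ?thesis using J_nonneg[of "B' - B" C] assms by auto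
qed

lemma J_mono2: assumes "C \<subseteq> C'" "C \<in> sets M" "C' \<in> sets M" "B \<in> sets M" shows "J B C \<le> J B C'"
proof -
  have "C' = C \<union> (C' - C)" using assms by auto
  hence "J B C' = J B C + J B (C' - C)" using J_add2[of B C "C' - C"] assms by auto
  thus ?thesis using J_nonneg[of B "C' - C"] assms by auto
qed

lemma J_le_prob1: "B \<in> sets M \<Longrightarrow> C \<in> sets M \<Longrightarrow> J B C \<le> prob B"
  using J_mono2[of C "space M" B] J_left[of B] sets.sets_into_space by auto

lemma J_le_prob2: "B \<in> sets M \<Longrightarrow> C \<in> sets M \<Longrightarrow> J B C \<le> prob C"
  using J_mono1[of B "space M" C] J_right[of C] sets.sets_into_space by auto

lemma J_inv_nat: assumes "B \<in> sets M" "C \<in> sets M" shows "J (pre (int n) B) (pre (int n) C) = J B C"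
proof (induction n)
  case 0
  have "pre 0 X = X" if "X \<in> sets M" for X using sets.sets_into_space[OF that] by (auto simp: TT_0)
  thus ?case using assms by simp
next
  case (Suc n)
  have "pre (int (Suc n)) X = pre 1 (pre (int n) X)" for X unfolding pre_pre by (simp add: add.commute)
  thus ?case using Suc J_inv[of "pre (int n) B" "pre (int n) C"] assms by simp
qed

text \<open>When level \<open>m\<close> is uncut, translations by \<open>0 \<le> u < h m\<close> act
  on these cells as rotations of the height modulo \<open>h m\<close>.\<close>

definition X :: "nat \<Rightarrow> int \<Rightarrow> 'a set" where "X m s = {x \<in> space M. t m x = s} - topd m"

text \<open>The cyclic counterpart of \<open>prob (B - pre n B)\<close> for a union \<open>B\<close>
  of levels; \<open>turn_bounds\<close> compares the two.\<close>

definition turn :: "nat \<Rightarrow> int set \<Rightarrow> int \<Rightarrow> nat" where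
  "turn m K n = card {v \<in> {0..<h m}. v \<in> K \<and> (v + n) mod h m \<notin> K}"

lemma X_meas [measurable]: "X m s \<in> sets M"
  unfolding X_def by measurable

lemma turn_mod: "turn m K (n mod h m) = turn m K n"
  by (simp add: turn_def mod_simps)

lemma turn_le: "turn m K n \<le> h m"
proof -
  have "turn m K n \<le> card {0..<h m}" unfolding turn_def by (intro card_mono) auto
  thus ?thesis using h_ge1[of m] by (simp add: le_nat_iff)
qed

text \<open>Substitute \<open>v = (s + u) mod h m\<close>, a permutation of the residues.\<close>

lemma turn_count:
  "(\<Sum>u\<in>{0..<h m}. if (s + u) mod h m \<in> K \<and> (s' + u) mod h m \<notin> K then c else 0) = c * real (turn m K (s' - s))"
proof -
  let ?U = "{u \<in> {0..<h m}. (s + u) mod h m \<in> K \<and> (s' + u) mod h m \<notin> K}"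
  let ?V = "{v \<in> {0..<h m}. v \<in> K \<and> (v + (s' - s)) mod h m \<notin> K}"
  have hp: "0 < h m" using h_ge1[of m] by simp
  have "card ?U = card ?V"
  proof (rule bij_betw_same_card[of "\<lambda>u. (s + u) mod h m"], rule bij_betwI[where g = "\<lambda>v. (v - s) mod h m"])
    show "(\<lambda>u. (s + u) mod h m) \<in> ?U \<rightarrow> ?V"
    proof
      fix u assume u: "u \<in> ?U"
      have "((s + u) mod h m + (s' - s)) mod h m = (s' + u) mod h m" unfolding mod_add_left_eq by (simp add: algebra_simps)
      thus "(s + u) mod h m \<in> ?V" using u hp by simp
    qed
    show "(\<lambda>v. (v - s) mod h m) \<in> ?V \<rightarrow> ?U"
    proof
      fix v assume v: "v \<in> ?V"
      have "(s' + (v - s) mod h m) mod h m = (v + (s' - s)) mod h m" unfolding mod_add_right_eq by (simp add: algebra_simps)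
      moreover have "(s + (v - s) mod h m) mod h m = v mod h m" by (simp add: mod_simps)
      moreover have "v mod h m = v" using v by (simp add: mod_pos_pos_trivial)
      ultimately show "(v - s) mod h m \<in> ?U" using v hp by simp
    qed
    show "((s + x) mod h m - s) mod h m = x" if "x \<in> ?U" for x
    proof -
      have "((s + x) mod h m - s) mod h m = x mod h m" by (simp add: mod_simps)
      thus ?thesis using that by (simp add: mod_pos_pos_trivial)
    qed
    show "(s + (y - s) mod h m) mod h m = y" if "y \<in> ?V" for y
    proof -
      have "(s + (y - s) mod h m) mod h m = y mod h m" by (simp add: mod_simps)
      thus ?thesis using that by (simp add: mod_pos_pos_trivial)
    qed
  qed
  hence a: "(\<Sum>u\<in>?U. c) = c * real (turn m K (s' - s))" by (simp add: turn_def)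
  have b: "(\<Sum>u\<in>?U. c) = (\<Sum>u\<in>{0..<h m}. if (s + u) mod h m \<in> K \<and> (s' + u) mod h m \<notin> K then c else 0)"
    by (rule sum.inter_filter) simp
  show ?thesis by (rule trans[OF b[symmetric] a])
qed

lemma J_cells:
  assumes B: "B \<in> sets M" and C: "C \<in> sets M"
  shows "(\<Sum>s\<in>{0..<h m}. \<Sum>s'\<in>{0..<h m}. J (B \<inter> X m s) (C \<inter> X m s')) \<le> J B C"
    and "J B C \<le> (\<Sum>s\<in>{0..<h m}. \<Sum>s'\<in>{0..<h m}. J (B \<inter> X m s) (C \<inter> X m s')) + 2 * prob (topd m)"
proof -
  define UB where "UB = (\<Union>s\<in>{0..<h m}. B \<inter> X m s)"
  define UC where "UC = (\<Union>s\<in>{0..<h m}. C \<inter> X m s)"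
  have Um: "UB \<in> sets M" "UC \<in> sets M" using B C by (auto simp: UB_def UC_def)
  have dis: "disjoint_family_on (\<lambda>s. B \<inter> X m s) {0..<h m}" for B
    by (auto simp: disjoint_family_on_def X_def)
  have "J UB UC = (\<Sum>s\<in>{0..<h m}. J (B \<inter> X m s) UC)"
    unfolding UB_def using B Um by (intro J_sum1 dis) auto
  also have "\<dots> = (\<Sum>s\<in>{0..<h m}. \<Sum>s'\<in>{0..<h m}. J (B \<inter> X m s) (C \<inter> X m s'))"
    unfolding UC_def using B C by (intro sum.cong refl J_sum2 dis) auto
  finally have eq: "J UB UC = (\<Sum>s\<in>{0..<h m}. \<Sum>s'\<in>{0..<h m}. J (B \<inter> X m s) (C \<inter> X m s'))" .
  have sub: "UB \<subseteq> B" "UC \<subseteq> C" by (auto simp: UB_def UC_def)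
  show "(\<Sum>s\<in>{0..<h m}. \<Sum>s'\<in>{0..<h m}. J (B \<inter> X m s) (C \<inter> X m s')) \<le> J B C"
    unfolding eq[symmetric] using J_mono1[OF sub(1) Um(1) B Um(2)] J_mono2[OF sub(2) Um(2) C B] by linarith
  have cov: "B \<subseteq> (\<Union>s\<in>{0..<h m}. B \<inter> X m s) \<union> topd m" if "B \<in> sets M" for B
    using sets.sets_into_space[OF that] tD(1,2)[of _ m] by (auto simp: X_def)
  have Beq: "B = UB \<union> (B - UB)" "C = UC \<union> (C - UC)" using sub by auto
  have top: "B - UB \<subseteq> topd m" "C - UC \<subseteq> topd m" using cov[OF B] cov[OF C] by (auto simp: UB_def UC_def)
  have "J B C = J UB C + J (B - UB) C" using J_add1[of UB "B - UB" C] Um B C Beq(1) by auto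
  moreover have "J UB C = J UB UC + J UB (C - UC)" using J_add2[of UB UC "C - UC"] Um B C Beq(2) by auto
  moreover have "J (B - UB) C \<le> prob (B - UB)" using Um B C by (intro J_le_prob1) auto
  moreover have "prob (B - UB) \<le> prob (topd m)" using top by (intro finite_measure_mono) auto
  moreover have "J UB (C - UC) \<le> prob (C - UC)" using Um B C by (intro J_le_prob2) auto
  moreover have "prob (C - UC) \<le> prob (topd m)" using top by (intro finite_measure_mono) auto
  ultimately show "J B C \<le> (\<Sum>s\<in>{0..<h m}. \<Sum>s'\<in>{0..<h m}. J (B \<inter> X m s) (C \<inter> X m s')) + 2 * prob (topd m)"
    unfolding eq[symmetric] by linarith
qed

text \<open>By invariance \<open>J (pre u B) (pre u (space M - B))\<close> does not depend on
  \<open>u\<close>. Averaged over a full turn, the cells at heights \<open>s\<close> and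
  \<open>s'\<close> contribute through \<open>s' - s\<close> only, which lets the joining be
  compared with translations. The error comes from the last copy in either coordinate.\<close>

lemma J_turn:
  fixes K :: "int set"
  assumes S: "Sh m = {}"
  defines "B \<equiv> {x \<in> space M. t m x \<in> K}"
  defines "W \<equiv> (\<Sum>s\<in>{0..<h m}. \<Sum>s'\<in>{0..<h m}. J (X m s) (X m s') * real (turn m K (s' - s)))"
  shows "W \<le> h m * J B (space M - B)" and "h m * J B (space M - B) \<le> W + 2 * h m * prob (topd m)"
proof -
  have Bm: "B \<in> sets M" by (simp add: B_def)
  have hp: "0 < h m" using h_ge1[of m] by simp
  define Q where "Q u = (\<Sum>s\<in>{0..<h m}. \<Sum>s'\<in>{0..<h m}. J (pre u B \<inter> X m s) (pre u (space M - B) \<inter> X m s'))" for u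
  have Ju: "J (pre u B) (pre u (space M - B)) = J B (space M - B)" if "u \<in> {0..<h m}" for u
    using J_inv_nat[OF Bm, of "space M - B" "nat u"] Bm that by simp
  have cell: "J (pre u B \<inter> X m s) (pre u (space M - B) \<inter> X m s') = (if (s + u) mod h m \<in> K \<and> (s' + u) mod h m \<notin> K then J (X m s) (X m s') else 0)"
    if u: "u \<in> {0..<h m}" for u s s'
  proof -
    have cyc: "t m (TT u x) = (s + u) mod h m" if "x \<in> X m s" for x s
      using uncut_cycle[OF _ S, of x u] that u by (auto simp: X_def topd_def)
    have sp: "X m s \<subseteq> space M" for s by (auto simp: X_def)
    have "pre u B \<inter> X m s = (if (s + u) mod h m \<in> K then X m s else {})"
      using cyc[of _ s] sp[of s] by (auto simp: B_def)
    moreover have "pre u (space M - B) \<inter> X m s' = (if (s' + u) mod h m \<in> K then {} else X m s')"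
      using cyc[of _ s'] sp[of s'] by (auto simp: B_def)
    ultimately show ?thesis by (simp add: J_empty1 J_empty2)
  qed
  have "(\<Sum>u\<in>{0..<h m}. Q u) = (\<Sum>u\<in>{0..<h m}. \<Sum>s\<in>{0..<h m}. \<Sum>s'\<in>{0..<h m}. (if (s + u) mod h m \<in> K \<and> (s' + u) mod h m \<notin> K then J (X m s) (X m s') else 0))"
    unfolding Q_def by (intro sum.cong refl cell)
  also have "\<dots> = (\<Sum>s\<in>{0..<h m}. \<Sum>u\<in>{0..<h m}. \<Sum>s'\<in>{0..<h m}. (if (s + u) mod h m \<in> K \<and> (s' + u) mod h m \<notin> K then J (X m s) (X m s') else 0))"
    by (rule sum.swap)
  also have "\<dots> = (\<Sum>s\<in>{0..<h m}. \<Sum>s'\<in>{0..<h m}. \<Sum>u\<in>{0..<h m}. (if (s + u) mod h m \<in> K \<and> (s' + u) mod h m \<notin> K then J (X m s) (X m s') else 0))"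
    by (intro sum.cong refl sum.swap)
  also have "\<dots> = W" unfolding W_def by (intro sum.cong refl turn_count)
  finally have QW: "(\<Sum>u\<in>{0..<h m}. Q u) = W" .
  have lo: "Q u \<le> J B (space M - B)" if "u \<in> {0..<h m}" for u
    unfolding Q_def Ju[OF that, symmetric] using Bm by (intro J_cells(1)) auto
  have hi: "J B (space M - B) \<le> Q u + 2 * prob (topd m)" if "u \<in> {0..<h m}" for u
    unfolding Q_def Ju[OF that, symmetric] using Bm by (intro J_cells(2)) auto
  have cd: "real (card {0..<h m}) = h m" using hp by simp
  have "(\<Sum>u\<in>{0..<h m}. Q u) \<le> (\<Sum>u\<in>{0..<h m}. J B (space M - B))" by (intro sum_mono lo)
  thus "W \<le> h m * J B (space M - B)" unfolding QW sum_constant cd .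
  have "(\<Sum>u\<in>{0..<h m}. J B (space M - B)) \<le> (\<Sum>u\<in>{0..<h m}. Q u + 2 * prob (topd m))" by (intro sum_mono hi)
  thus "h m * J B (space M - B) \<le> W + 2 * h m * prob (topd m)" unfolding sum.distrib QW sum_constant cd by (simp add: algebra_simps)
qed

text \<open>The errors are the last copy, where the motion is not cyclic, and in the first bound
  also the top height, whose measure may be less than \<open>w m\<close>.\<close>

lemma turn_bounds:
  assumes S: "Sh m = {}" and n: "0 \<le> n" "n < h m"
  shows "turn m K n * w m \<le> prob {x \<in> space M. t m x \<in> K \<and> t m (TT n x) \<notin> K} + w m + prob (topd m)"
    and "prob {x \<in> space M. t m x \<in> K \<and> t m (TT n x) \<notin> K} \<le> turn m K n * w m + prob (topd m)"
proof -
  define V where "V = {v \<in> {0..<h m}. v \<in> K \<and> (v + n) mod h m \<notin> K}"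
  have fin: "finite V" by (rule finite_subset[of _ "{0..<h m}"]) (auto simp: V_def)
  have cyc: "t m (TT n x) = (t m x + n) mod h m" if "x \<in> space M" "x \<notin> topd m" for x
    using uncut_cycle[OF that(1) S _ n] that by (auto simp: topd_def)
  have m1: "{x \<in> space M. t m x \<in> K \<and> t m (TT n x) \<notin> K} \<in> sets M" by measurable
  have "{x \<in> space M. t m x \<in> K \<and> t m (TT n x) \<notin> K} \<subseteq> {x \<in> space M. t m x \<in> V} \<union> topd m"
    using cyc tD(1,2)[of _ m] by (auto simp: V_def)
  hence "prob {x \<in> space M. t m x \<in> K \<and> t m (TT n x) \<notin> K} \<le> prob ({x \<in> space M. t m x \<in> V} \<union> topd m)"
    by (intro finite_measure_mono) auto
  also have "\<dots> \<le> prob {x \<in> space M. t m x \<in> V} + prob (topd m)" by (intro measure_Un_le) auto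
  also have "prob {x \<in> space M. t m x \<in> V} \<le> card V * w m" by (rule prob_in_le[OF fin])
  finally show "prob {x \<in> space M. t m x \<in> K \<and> t m (TT n x) \<notin> K} \<le> turn m K n * w m + prob (topd m)"
    by (simp add: turn_def V_def)
  have tV: "turn m K n = card V" by (simp add: turn_def V_def)
  define V' where "V' = V - {h m - 1}"
  have "{x \<in> space M. t m x \<in> V'} \<subseteq> {x \<in> space M. t m x \<in> K \<and> t m (TT n x) \<notin> K} \<union> topd m"
    using cyc by (auto simp: V_def V'_def)
  hence "prob {x \<in> space M. t m x \<in> V'} \<le> prob ({x \<in> space M. t m x \<in> K \<and> t m (TT n x) \<notin> K} \<union> topd m)"
    using m1 by (intro finite_measure_mono) auto
  also have "\<dots> \<le> prob {x \<in> space M. t m x \<in> K \<and> t m (TT n x) \<notin> K} + prob (topd m)" using m1 by (intro measure_Un_le) auto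
  also have "prob {x \<in> space M. t m x \<in> V'} = card V' * w m" by (rule prob_in_eq) (auto simp: V'_def V_def)
  finally have 1: "card V' * w m \<le> prob {x \<in> space M. t m x \<in> K \<and> t m (TT n x) \<notin> K} + prob (topd m)" .
  have "card V \<le> card V' + 1" using fin card_Diff1_le[of V] unfolding V'_def by (metis card_Diff_singleton_if add.commute diff_le_self le_diff_conv le_refl trans_le_add1 card_Diff_singleton)
  hence "real (card V) \<le> real (card V') + 1" by linarith
  hence "card V * w m \<le> (real (card V') + 1) * w m" using w_nonneg[of m] by (rule mult_right_mono)
  thus "turn m K n * w m \<le> prob {x \<in> space M. t m x \<in> K \<and> t m (TT n x) \<notin> K} + w m + prob (topd m)"
    unfolding tV using 1 by (simp add: algebra_simps)
qed

lemma sdiff_half: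
  assumes "B \<in> sets M" shows "sdiff B (pre n B) = 2 * prob (B - pre n B)"
proof -
  have "prob (sym_diff B (pre n B)) = prob (B - pre n B) + prob (pre n B - B)"
    using assms by (intro finite_measure_Union) auto
  moreover have "prob (pre n B - B) = prob (pre n B) - prob (pre n B \<inter> B)" using assms by (intro finite_measure_Diff') auto
  moreover have "prob (B - pre n B) = prob B - prob (B \<inter> pre n B)" using assms by (intro finite_measure_Diff') auto
  ultimately show ?thesis using prob_TT[OF assms, of n] by (simp add: sdiff_def Int_commute)
qed

text \<open>Let \<open>E\<close> approximate \<open>B\<close> at an uncut level. A rotation either
  moves \<open>E\<close> substantially or, by \<open>rigidity_transfer\<close>, nearly fixes the
  sets of level \<open>l\<close>. Both cases fit one linear inequality between
  \<open>turn m K' n\<close> and \<open>turn m E n\<close>, which can be averaged with the weights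
  of the joining; there the side of \<open>E\<close> is small because
  \<open>J B (space M - B) = 0\<close>.\<close>

theorem joining_diagonal:
  assumes B: "B \<in> sets M" and pos: "0 < sdiff B (pre 1 B)" and JB: "J B (space M - B) = 0"
  shows "J {x \<in> space M. t l x \<in> K} (space M - {x \<in> space M. t l x \<in> K}) = 0"
proof -
  define C where "C = {x \<in> space M. t l x \<in> K}"
  have Cm: "C \<in> sets M" by (simp add: C_def)
  have "J C (space M - C) \<le> e" if e: "0 < e" for e
  proof -
    have e8: "0 < e / 8" using e by simp
    obtain d where d: "0 < d" and dd: "\<And>n. sdiff B (pre n B) \<le> d \<Longrightarrow> prob {x \<in> space M. t l x \<noteq> t l (TT n x)} \<le> e / 8"
      using rigidity_transfer[OF B pos e8, of l] by blast
    \<comment> \<open>\<open>J G (space M - G) \<le> 2 * e1\<close> is later multiplied by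
      \<open>8 / d\<close>, which leaves \<open>e / 8\<close>.\<close>
    define e1 where "e1 = min (d / 8) (d * e / 128)"
    have e1: "0 < e1" "e1 \<le> d / 8" "e1 \<le> d * e / 128" using d e by (auto simp: e1_def)
    obtain l1 where l1: "\<And>l. l \<ge> l1 \<Longrightarrow> \<exists>E. sdiff B {x \<in> space M. t l x \<in> E} < e1" using level_approx[OF B e1(1)] by blast
    define e2 where "e2 = min (e / 8) (d / 8)"
    have e2: "0 < e2" "e2 \<le> e / 8" "e2 \<le> d / 8" using d e by (auto simp: e2_def)
    obtain m where m: "m \<ge> max l l1" "Sh m = {}" "prob (topd m) < e2" "w m < e2" using uncut_large[OF e2(1)] by blast
    obtain E where E: "sdiff B {x \<in> space M. t m x \<in> E} < e1" using l1[of m] m(1) by auto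
    define G where "G = {x \<in> space M. t m x \<in> E}"
    have Gm: "G \<in> sets M" by (simp add: G_def)
    have BG: "sdiff B G < e1" using E by (simp add: G_def)
    obtain K' where K': "C = {x \<in> space M. t m x \<in> K'}" using level_refine[of l m K] m(1) by (auto simp: C_def)
    define H where "H = real_of_int (h m)"
    have H: "1 \<le> H" using h_ge1[of m] unfolding H_def by linarith
    have Hw: "1 \<le> w m * H" using w_ge[of m] by (simp add: H_def)
    have w1: "w m \<le> 1" unfolding w_def by (rule prob_le_1)
    have "w m * (H - 1) \<le> 1" using w_le[of m] by (simp add: H_def)
    hence Hw2: "w m * H \<le> 2" using w1 by (simp add: algebra_simps)
    have point0: "turn m K' n \<le> 3 * e / 8 * H + 8 / d * turn m E n" if n: "0 \<le> n" "n < h m" for n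
    proof (cases "turn m E n \<le> d / 8 * H")
      case True
      have "turn m E n * w m \<le> d / 8 * H * w m" using True w_nonneg[of m] by (rule mult_right_mono)
      also have "\<dots> = d / 8 * (w m * H)" by simp
      also have "\<dots> \<le> d / 8 * 2" using Hw2 d by (intro mult_left_mono) auto
      finally have tw: "turn m E n * w m \<le> d / 4" by simp
      have "prob (G - pre n G) \<le> prob {x \<in> space M. t m x \<in> E \<and> t m (TT n x) \<notin> E}"
        by (intro finite_measure_mono) (auto simp: G_def)
      also have "\<dots> \<le> turn m E n * w m + prob (topd m)" by (rule turn_bounds(2)[OF m(2) n])
      finally have "sdiff G (pre n G) \<le> d / 2 + d / 4" using sdiff_half[OF Gm, of n] tw m(3) e2 by linarith
      moreover have "sdiff B (pre n B) \<le> sdiff B G + sdiff G (pre n B)" "sdiff G (pre n B) \<le> sdiff G (pre n G) + sdiff (pre n G) (pre n B)"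
        using B Gm by (intro sdiff_triangle; simp)+
      moreover have "sdiff (pre n G) (pre n B) = sdiff B G" using sdiff_pre[OF Gm B] by (simp add: sdiff_commute)
      ultimately have "sdiff B (pre n B) \<le> d" using BG e1 by linarith
      hence "prob {x \<in> space M. t l x \<noteq> t l (TT n x)} \<le> e / 8" by (rule dd)
      moreover have "prob {x \<in> space M. t m x \<in> K' \<and> t m (TT n x) \<notin> K'} \<le> prob {x \<in> space M. t l x \<noteq> t l (TT n x)}"
      proof (intro finite_measure_mono)
        show "{x \<in> space M. t m x \<in> K' \<and> t m (TT n x) \<notin> K'} \<subseteq> {x \<in> space M. t l x \<noteq> t l (TT n x)}"
        proof safe
          fix x assume x: "x \<in> space M" "t m x \<in> K'" "t m (TT n x) \<notin> K'" "t l x = t l (TT n x)"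
          have "x \<in> C" using x K' by simp
          moreover have "TT n x \<notin> C" using x K' by simp
          ultimately show False using x by (simp add: C_def)
        qed
      qed measurable
      ultimately have tt: "turn m K' n * w m \<le> 3 * e / 8" using turn_bounds(1)[OF m(2) n, of K'] m(3,4) e2 by linarith
      have "real (turn m K' n) * 1 \<le> turn m K' n * (w m * H)" using Hw by (intro mult_left_mono) auto
      also have "\<dots> = turn m K' n * w m * H" by simp
      also have "\<dots> \<le> 3 * e / 8 * H" using tt H by (intro mult_right_mono) auto
      finally show ?thesis using d by (simp add: add_increasing2)
    next
      case False
      have "real (turn m K' n) \<le> H" using turn_le[of m K' n] unfolding H_def by linarith
      also have "\<dots> \<le> 8 / d * turn m E n" using False d by (simp add: field_simps)
      finally show ?thesis using e H by (simp add: add_increasing)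
    qed
    have point: "turn m K' n \<le> 3 * e / 8 * H + 8 / d * turn m E n" for n
      using point0[of "n mod h m"] h_ge1[of m] by (simp add: turn_mod)
    let ?I = "{0..<h m}"
    let ?j = "\<lambda>s s'. J (X m s) (X m s')"
    have j0: "0 \<le> ?j s s'" for s s' by (intro J_nonneg) auto
    have j1: "(\<Sum>s\<in>?I. \<Sum>s'\<in>?I. ?j s s') \<le> 1"
    proof -
      have "X m s \<subseteq> space M" for s by (auto simp: X_def)
      hence "space M \<inter> X m s = X m s" for s by auto
      hence "(\<Sum>s\<in>?I. \<Sum>s'\<in>?I. ?j s s') \<le> J (space M) (space M)" using J_cells(1)[of "space M" "space M" m] by simp
      thus ?thesis using J_left[of "space M"] by (simp add: prob_space)
    qed
    have "H * J C (space M - C) \<le> (\<Sum>s\<in>?I. \<Sum>s'\<in>?I. ?j s s' * real (turn m K' (s' - s))) + 2 * H * prob (topd m)"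
      using J_turn(2)[OF m(2), of K'] unfolding K' H_def by simp
    also have "(\<Sum>s\<in>?I. \<Sum>s'\<in>?I. ?j s s' * real (turn m K' (s' - s))) \<le> (\<Sum>s\<in>?I. \<Sum>s'\<in>?I. ?j s s' * (3 * e / 8 * H + 8 / d * turn m E (s' - s)))"
      by (intro sum_mono mult_left_mono point j0)
    also have "\<dots> = 3 * e / 8 * H * (\<Sum>s\<in>?I. \<Sum>s'\<in>?I. ?j s s') + 8 / d * (\<Sum>s\<in>?I. \<Sum>s'\<in>?I. ?j s s' * real (turn m E (s' - s)))"
      by (simp add: distrib_left sum.distrib sum_distrib_left mult_ac)
    also have "3 * e / 8 * H * (\<Sum>s\<in>?I. \<Sum>s'\<in>?I. ?j s s') \<le> 3 * e / 8 * H * 1"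
      using j1 e H by (intro mult_left_mono) auto
    also have "(\<Sum>s\<in>?I. \<Sum>s'\<in>?I. ?j s s' * real (turn m E (s' - s))) \<le> H * J G (space M - G)"
      using J_turn(1)[OF m(2), of E] unfolding G_def H_def by simp
    also have "J G (space M - G) \<le> 2 * e1"
    proof -
      have "J G (space M - G) \<le> J (B \<union> (G - B)) (space M - G)" using B Gm by (intro J_mono1) auto
      also have "\<dots> = J B (space M - G) + J (G - B) (space M - G)" using B Gm by (intro J_add1) auto
      also have "J (G - B) (space M - G) \<le> prob (G - B)" using B Gm by (intro J_le_prob1) auto
      also have "prob (G - B) \<le> sdiff B G" unfolding sdiff_def using B Gm by (intro finite_measure_mono) auto
      also have "J B (space M - G) \<le> J B ((space M - B) \<union> (B - G))" using B Gm sets.sets_into_space[OF B] by (intro J_mono2) auto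
      also have "\<dots> = J B (space M - B) + J B (B - G)" using B Gm by (intro J_add2) auto
      also have "J B (B - G) \<le> prob (B - G)" using B Gm by (intro J_le_prob2) auto
      also have "prob (B - G) \<le> sdiff B G" unfolding sdiff_def using B Gm by (intro finite_measure_mono) auto
      finally show ?thesis using JB BG by linarith
    qed
    finally have "H * J C (space M - C) \<le> 3 * e / 8 * H * 1 + 8 / d * (H * (2 * e1)) + 2 * H * prob (topd m)"
      using d H by (simp add: mult_left_mono divide_right_mono)
    also have "\<dots> \<le> 3 * e / 8 * H * 1 + 8 / d * (H * (2 * (d * e / 128))) + 2 * H * (e / 8)"
      using d H e1 e2 m(3) by (intro add_mono mult_left_mono order_refl) auto
    also have "\<dots> = H * (3 * e / 8 + e / 8 + e / 4)" using d by (simp add: field_simps)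
    finally have "J C (space M - C) \<le> 3 * e / 8 + e / 8 + e / 4" using H by (simp only: mult_le_cancel_left_pos)
    thus ?thesis using e by simp
  qed
  moreover have "0 \<le> J C (space M - C)" using Cm by (intro J_nonneg) auto
  ultimately have "J C (space M - C) = 0" by (meson field_le_epsilon antisym add_increasing order_refl dense_le not_less dense_ge)
  thus ?thesis by (simp add: C_def)
qed

end

section \<open>The relatively independent self-joining over a factor\<close>

context tower
begin

text \<open>The identity is immediate when tested on sets \<open>pre 1 E'\<close> with
  \<open>E'\<close> in \<open>F\<close>, but for a non-invertible factor these need not exhaust
  \<open>F\<close>. By \<open>rigid\<close>, each \<open>E\<close> in \<open>F\<close> is
  arbitrarily close to \<open>pre (int n) E = pre 1 E'\<close> with
  \<open>E' = pre (int (n - 1)) E\<close>, which is in \<open>F\<close>; as \<open>g\<close> is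
  bounded, the integrals over \<open>E\<close> vanish too.\<close>

lemma real_cond_exp_pre:
  assumes sub: "subalgebra M F" and inv: "\<And>E. E \<in> sets F \<Longrightarrow> pre 1 E \<in> sets F" and B: "B \<in> sets M"
  shows "AE x in M. real_cond_exp M F (indicator (pre 1 B)) x = real_cond_exp M F (indicator B) (TT 1 x)"
proof -
  interpret S: finite_measure_subalgebra M F by unfold_locales (rule sub)
  have spF: "space F = space M" and FM: "\<And>E. E \<in> sets F \<Longrightarrow> E \<in> sets M" using sub by (auto simp: subalgebra_def)
  define f where "f = real_cond_exp M F (indicator B)"
  define g where "g x = indicat_real B x - f x" for x
  have iB: "integrable M (indicat_real E)" if "E \<in> sets M" for E
    using that by (intro integrable_real_indicator) (auto simp: emeasure_finite less_top[symmetric])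
  have f_int: "integrable M f" unfolding f_def using iB[OF B] by (rule S.real_cond_exp_int)
  have fF: "f \<in> borel_measurable F" by (simp add: f_def)
  have fM [measurable]: "f \<in> borel_measurable M" using f_int by auto
  have gM [measurable]: "g \<in> borel_measurable M" unfolding g_def using B by measurable
  have g_int: "integrable M g" unfolding g_def using iB[OF B] f_int by auto
  have "AE x in M. f x \<le> real_cond_exp M F (\<lambda>_. 1) x" unfolding f_def
    using iB[OF B] by (intro S.real_cond_exp_mono) (auto simp: indicator_def)
  moreover have "AE x in M. real_cond_exp M F (\<lambda>_. 1) x = 1" by (intro S.real_cond_exp_F_meas) auto
  moreover have "AE x in M. 0 \<le> f x" unfolding f_def using B by (intro S.real_cond_exp_pos) auto
  ultimately have g1: "AE x in M. \<bar>g x\<bar> \<le> 1" by eventually_elim (auto simp: g_def indicator_def)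
  have distr: "integral\<^sup>L M (\<lambda>x. k (TT 1 x)) = integral\<^sup>L M k" if "k \<in> borel_measurable M" for k :: "'a \<Rightarrow> real"
    using integral_distr[OF TT_meas, of k 1] that by (simp add: TT_distr)
  have distri: "integrable M (\<lambda>x. k (TT 1 x))" if "integrable M k" for k :: "'a \<Rightarrow> real"
    using integrable_distr_eq[OF TT_meas, of k 1] that by (simp add: TT_distr borel_measurable_integrable)
  have g1T: "AE x in M. \<bar>g (TT 1 x)\<bar> \<le> 1"
    using AE_distrD[OF TT_meas[of 1], where P = "\<lambda>x. \<bar>g x\<bar> \<le> 1"] g1 by (simp only: TT_distr)
  have zero: "(\<integral>x. indicator E x * g (TT 1 x) \<partial>M) = 0" if E: "E \<in> sets F" for E
  proof -
    have EM: "E \<in> sets M" using FM E by simp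
    have iE: "integrable M (\<lambda>x. indicator U x * g (TT 1 x))" if "U \<in> sets M" for U
      using integrable_mult_indicator[OF that distri[OF g_int]] by simp
    have small: "\<bar>\<integral>x. indicator E x * g (TT 1 x) \<partial>M\<bar> \<le> e" if e: "0 < e" for e
    proof -
      obtain n where n: "1 \<le> n" "sdiff E (pre (int n) E) < e" using rigid[OF EM e] by blast
      have preF: "pre (int k) E \<in> sets F" for k
      proof (induction k)
        case 0
        have "pre 0 E = E" using sets.sets_into_space[OF EM] by (auto simp: TT_0)
        thus ?case using E by simp
      next
        case (Suc k)
        have "pre (int (Suc k)) E = pre 1 (pre (int k) E)" unfolding pre_pre by (simp add: add.commute)
        thus ?case using inv[OF Suc] by simp
      qed
      define E' where "E' = pre (int (n - 1)) E"
      have E'F: "E' \<in> sets F" unfolding E'_def by (rule preF)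
      have "pre (int n) E = pre 1 E'" unfolding E'_def pre_pre using n(1) by (simp add: of_nat_diff)
      note E' = E'F this
      have E'M: "E' \<in> sets M" using FM E'(1) by simp
      have "(\<integral>x. indicator (pre 1 E') x * g (TT 1 x) \<partial>M) = (\<integral>x. indicator E' (TT 1 x) * g (TT 1 x) \<partial>M)"
        by (intro Bochner_Integration.integral_cong) (auto simp: indicator_def)
      also have "\<dots> = (\<integral>x. indicator E' x * g x \<partial>M)"
        using distr[of "\<lambda>x. indicator E' x * g x"] E'M by simp
      also have "\<dots> = (\<integral>x. indicator E' x * indicator B x \<partial>M) - (\<integral>x. indicator E' x * f x \<partial>M)"
        unfolding g_def right_diff_distrib
        using integrable_mult_indicator[OF E'M iB[OF B]] integrable_mult_indicator[OF E'M f_int]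
        by (intro Bochner_Integration.integral_diff) auto
      also have "(\<integral>x. indicator E' x * f x \<partial>M) = (\<integral>x. indicator E' x * indicator B x \<partial>M)"
        unfolding f_def using E' B integrable_mult_indicator[OF E'M iB[OF B]] by (intro S.real_cond_exp_intg(2)) auto
      finally have z: "(\<integral>x. indicator (pre (int n) E) x * g (TT 1 x) \<partial>M) = 0" using E' by simp
      have "(\<integral>x. indicator E x * g (TT 1 x) \<partial>M) = (\<integral>x. indicator E x * g (TT 1 x) \<partial>M) - (\<integral>x. indicator (pre (int n) E) x * g (TT 1 x) \<partial>M)"
        using z by simp
      also have "\<dots> = (\<integral>x. indicator E x * g (TT 1 x) - indicator (pre (int n) E) x * g (TT 1 x) \<partial>M)"
        using EM by (intro Bochner_Integration.integral_diff[symmetric] iE) auto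
      also have "\<bar>\<dots>\<bar> \<le> (\<integral>x. \<bar>indicator E x * g (TT 1 x) - indicator (pre (int n) E) x * g (TT 1 x)\<bar> \<partial>M)"
        by (rule integral_abs_bound)
      also have "\<dots> \<le> (\<integral>x. indicator (sym_diff E (pre (int n) E)) x \<partial>M)"
      proof (rule integral_mono_AE)
        show "AE x in M. \<bar>indicator E x * g (TT 1 x) - indicator (pre (int n) E) x * g (TT 1 x)\<bar> \<le> indicator (sym_diff E (pre (int n) E)) x"
          using g1T
        proof eventually_elim
          fix x assume a: "\<bar>g (TT 1 x)\<bar> \<le> 1"
          have "\<bar>indicator U x * g (TT 1 x) - indicator V x * g (TT 1 x)\<bar> \<le> indicator (sym_diff U V) x" for U V
            using a by (cases "x \<in> U"; cases "x \<in> V") simp_all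
          thus "\<bar>indicator E x * g (TT 1 x) - indicator (pre (int n) E) x * g (TT 1 x)\<bar> \<le> indicator (sym_diff E (pre (int n) E)) x" .
        qed
        show "integrable M (\<lambda>x. \<bar>indicator E x * g (TT 1 x) - indicator (pre (int n) E) x * g (TT 1 x)\<bar>)"
          by (intro integrable_abs Bochner_Integration.integrable_diff iE EM pre_sets)
        show "integrable M (indicat_real (sym_diff E (pre (int n) E)))"
          by (intro iB sets.Un sets.Diff EM pre_sets)
      qed
      also have "\<dots> = sdiff E (pre (int n) E)" 
      proof -
        have m: "sym_diff E (pre (int n) E) \<in> sets M" using EM by auto
        thus ?thesis using sets.sets_into_space[OF m] by (simp add: sdiff_def Int_absorb2)
      qed
      finally show ?thesis using n by linarith
    qed
    have "\<bar>\<integral>x. indicator E x * g (TT 1 x) \<partial>M\<bar> \<le> 0" by (rule field_le_epsilon) (use small in simp)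
    thus ?thesis by simp
  qed
  show ?thesis
    unfolding f_def[symmetric]
  proof (rule S.real_cond_exp_charact)
    have "TT 1 \<in> measurable F F"
    proof (rule measurableI)
      fix E assume "E \<in> sets F"
      moreover have "TT 1 -` E \<inter> space F = pre 1 E" by (auto simp: spF)
      ultimately show "TT 1 -` E \<inter> space F \<in> sets F" using inv by simp
    qed (simp add: spF)
    thus "(\<lambda>x. f (TT 1 x)) \<in> borel_measurable F" using fF by measurable
    show "integrable M (\<lambda>x. f (TT 1 x))" by (rule distri[OF f_int])
    show "integrable M (indicat_real (pre 1 B))" using B by (intro iB) auto
    fix E assume E: "E \<in> sets F"
    hence EM: "E \<in> sets M" using FM by simp
    have "(\<integral>x. indicator E x * g (TT 1 x) \<partial>M) = (\<integral>x. indicator E x * indicator (pre 1 B) x - indicator E x * f (TT 1 x) \<partial>M)"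
      by (intro Bochner_Integration.integral_cong) (auto simp: g_def indicator_def)
    also have "\<dots> = (\<integral>x. indicator E x * indicator (pre 1 B) x \<partial>M) - (\<integral>x. indicator E x * f (TT 1 x) \<partial>M)"
      using integrable_mult_indicator[OF EM iB[OF pre_sets[OF B, of 1]]] integrable_mult_indicator[OF EM distri[OF f_int]]
      by (intro Bochner_Integration.integral_diff) auto
    finally show "(LINT x:E|M. indicator (pre 1 B) x) = (LINT x:E|M. f (TT 1 x))"
      using zero[OF E] by (simp add: set_lebesgue_integral_def)
  qed
qed

text \<open>Integrating the conditional expectation of \<open>B\<close> over \<open>C\<close> gives
  the relatively independent self-joining. It vanishes on \<open>B0\<close> against its complement
  because \<open>B0\<close> lies in \<open>F\<close>, so \<open>joining_diagonal\<close> applies to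
  every union \<open>C\<close> of levels: the conditional expectation of \<open>C\<close> is 0 off
  \<open>C\<close> and, by total mass, 1 on \<open>C\<close>.\<close>

theorem factor_dichotomy:
  assumes sub: "subalgebra M F" and inv: "\<And>E. E \<in> sets F \<Longrightarrow> pre 1 E \<in> sets F"
  shows "(\<forall>B\<in>sets F. prob B = 0 \<or> prob B = 1) \<or> (\<forall>l K. \<exists>B\<in>sets F. sdiff B {x \<in> space M. t l x \<in> K} = 0)"
proof (rule disj_imp[THEN iffD2], rule impI)
  assume "\<not> (\<forall>B\<in>sets F. prob B = 0 \<or> prob B = 1)"
  then obtain B0 where B0: "B0 \<in> sets F" "prob B0 \<noteq> 0" "prob B0 \<noteq> 1" by blast
  interpret S: finite_measure_subalgebra M F by unfold_locales (rule sub)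
  have spF: "space F = space M" and FM: "\<And>E. E \<in> sets F \<Longrightarrow> E \<in> sets M" using sub by (auto simp: subalgebra_def)
  have B0M: "B0 \<in> sets M" using B0 FM by simp
  have pos: "0 < sdiff B0 (pre 1 B0)" using ergodic[OF B0M] B0 sdiff_nonneg[of B0 "pre 1 B0"] by (auto simp: less_le)
  define f where "f B = real_cond_exp M F (indicator B)" for B
  have iB: "integrable M (indicat_real E)" if "E \<in> sets M" for E
    using that by (intro integrable_real_indicator) (auto simp: emeasure_finite less_top[symmetric])
  have f_int: "integrable M (f B)" "(\<integral>x. f B x \<partial>M) = prob B" if "B \<in> sets M" for B
    using S.real_cond_exp_int[OF iB[OF that]] sets.sets_into_space[OF that] unfolding f_def by (auto simp: Int_absorb2)
  have fi: "integrable M (\<lambda>x. f B x * indicator C x)" if "B \<in> sets M" "C \<in> sets M" for B C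
    using integrable_mult_indicator[OF that(2) f_int(1)[OF that(1)]] by (simp add: mult.commute)
  have f0: "AE x in M. 0 \<le> f B x" if "B \<in> sets M" for B unfolding f_def using that by (intro S.real_cond_exp_pos) auto
  have fF: "AE x in M. f B x = indicator B x" if "B \<in> sets F" for B
    unfolding f_def using that iB FM by (intro S.real_cond_exp_F_meas) auto
  have f1: "AE x in M. f B x \<le> 1" if "B \<in> sets M" for B 
  proof -
    have "AE x in M. f B x \<le> real_cond_exp M F (\<lambda>_. 1) x" unfolding f_def
      using iB[OF that] by (intro S.real_cond_exp_mono) (auto simp: indicator_def)
    moreover have "AE x in M. real_cond_exp M F (\<lambda>_. 1) x = 1" by (intro S.real_cond_exp_F_meas) auto
    ultimately show ?thesis by eventually_elim auto
  qed
  define J where "J B C = (\<integral>x. f B x * indicator C x \<partial>M)" for B C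
  have distr: "integral\<^sup>L M (\<lambda>x. k (TT 1 x)) = integral\<^sup>L M k" if "k \<in> borel_measurable M" for k :: "'a \<Rightarrow> real"
    using integral_distr[OF TT_meas, of k 1] that by (simp add: TT_distr)
  have fM [measurable]: "f B \<in> borel_measurable M" for B by (simp add: f_def)
  have J_left: "J B (space M) = prob B" if "B \<in> sets M" for B
  proof -
    have "J B (space M) = (\<integral>x. f B x \<partial>M)" unfolding J_def by (intro Bochner_Integration.integral_cong) auto
    thus ?thesis using f_int(2)[OF that] by simp
  qed
  interpret tower_joining A Sh M t D TT J
  proof
    fix B C assume BC: "B \<in> sets M" "C \<in> sets M"
    show "0 \<le> J B C" unfolding J_def using f0[OF BC(1)] by (intro integral_nonneg_AE) auto
    have pa: "AE x in M. real_cond_exp M F (indicator (pre 1 B)) x = real_cond_exp M F (indicator B) (TT 1 x)"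
      by (rule real_cond_exp_pre[OF sub _ BC(1)]) (rule inv)
    have "J (pre 1 B) (pre 1 C) = (\<integral>x. f B (TT 1 x) * indicator C (TT 1 x) \<partial>M)"
      unfolding J_def
    proof (rule integral_cong_AE)
      show "AE x in M. f (pre 1 B) x * indicator (pre 1 C) x = f B (TT 1 x) * indicator C (TT 1 x)"
        using pa AE_space unfolding f_def by eventually_elim (auto simp: indicator_def)
      show "(\<lambda>x. f (pre 1 B) x * indicator (pre 1 C) x) \<in> borel_measurable M"
        by (intro borel_measurable_times fM borel_measurable_indicator pre_sets BC)
      have "(\<lambda>x. f B x * indicator C x) \<in> borel_measurable M"
        by (intro borel_measurable_times fM borel_measurable_indicator BC)
      thus "(\<lambda>x. f B (TT 1 x) * indicator C (TT 1 x)) \<in> borel_measurable M"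
        by (rule measurable_compose[OF TT_meas])
    qed
    also have "\<dots> = J B C" unfolding J_def by (rule distr) (intro borel_measurable_times fM borel_measurable_indicator BC)
    finally show "J (pre 1 B) (pre 1 C) = J B C" .
  next
    fix B B' C assume BC: "B \<in> sets M" "B' \<in> sets M" "C \<in> sets M" "B \<inter> B' = {}"
    have "indicat_real (B \<union> B') = (\<lambda>x. indicator B x + indicator B' x)" using BC(4) by (auto simp: indicator_def fun_eq_iff)
    hence "AE x in M. f (B \<union> B') x = f B x + f B' x" 
      unfolding f_def using S.real_cond_exp_add[OF iB[OF BC(1)] iB[OF BC(2)]] by simp
    hence "J (B \<union> B') C = (\<integral>x. f B x * indicator C x + f B' x * indicator C x \<partial>M)"
      unfolding J_def using BC by (intro integral_cong_AE) (auto simp: distrib_right)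
    thus "J (B \<union> B') C = J B C + J B' C" unfolding J_def using fi BC by simp
  next
    fix B C C' assume BC: "B \<in> sets M" "C \<in> sets M" "C' \<in> sets M" "C \<inter> C' = {}"
    have "J B (C \<union> C') = (\<integral>x. f B x * indicator C x + f B x * indicator C' x \<partial>M)"
      unfolding J_def using BC(4) by (intro Bochner_Integration.integral_cong) (auto simp: indicator_def)
    thus "J B (C \<union> C') = J B C + J B C'" unfolding J_def using fi BC by simp
  next
    fix B assume B: "B \<in> sets M"
    show "J B (space M) = prob B" by (rule J_left[OF B])
    have "space M \<in> sets F" using spF sets.top[of F] by simp
    hence "AE x in M. f (space M) x = indicator (space M) x" by (rule fF)
    hence "AE x in M. f (space M) x * indicator B x = indicator B x"
      using AE_space by eventually_elim (simp add: indicator_def)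
    hence "J (space M) B = (\<integral>x. indicator B x \<partial>M)" unfolding J_def using B
      by (intro integral_cong_AE) auto
    thus "J (space M) B = prob B" using sets.sets_into_space[OF B] by (simp add: Int_absorb2)
  qed
  have J0: "J B0 (space M - B0) = 0"
  proof -
    have "AE x in M. f B0 x * indicator (space M - B0) x = 0"
      using fF[OF B0(1)] by eventually_elim (simp add: indicator_def)
    hence "J B0 (space M - B0) = (\<integral>x. 0 \<partial>M)" unfolding J_def
      using B0M by (intro integral_cong_AE) auto
    thus ?thesis by simp
  qed
  show "\<forall>l K. \<exists>B\<in>sets F. sdiff B {x \<in> space M. t l x \<in> K} = 0"
  proof (intro allI)
    fix l K
    define C where "C = {x \<in> space M. t l x \<in> K}"
    have Cm: "C \<in> sets M" by (simp add: C_def)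
    have JC: "J C (space M - C) = 0" unfolding C_def by (rule joining_diagonal[OF B0M pos J0])
    have a0: "AE x in M. f C x * indicator (space M - C) x = 0"
      using JC f0[OF Cm] fi[OF Cm, of "space M - C"] Cm unfolding J_def
      by (subst (asm) integral_nonneg_eq_0_iff_AE) auto
    have "J C (space M) = J C C + J C (space M - C)"
      using J_add2[of C C "space M - C"] Cm sets.sets_into_space[OF Cm] by (simp add: Un_absorb1)
    hence JCC: "J C C = prob C" using JC J_left[OF Cm] by simp
    have "(\<integral>x. indicator C x - f C x * indicator C x \<partial>M) = 0"
      using JCC fi[OF Cm Cm] iB[OF Cm] sets.sets_into_space[OF Cm] unfolding J_def by (simp add: Int_absorb2)
    moreover have "AE x in M. 0 \<le> indicator C x - f C x * indicator C x" using f1[OF Cm] by eventually_elim (auto simp: indicator_def)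
    ultimately have a1: "AE x in M. indicator C x - f C x * indicator C x = 0"
      using fi[OF Cm Cm] iB[OF Cm] by (subst (asm) integral_nonneg_eq_0_iff_AE) auto
    \<comment> \<open>The conditional expectation is almost everywhere the indicator of
      \<open>C\<close>; cutting it at \<open>1 / 2\<close> gives a version of \<open>C\<close> in
      \<open>F\<close>.\<close>
    define B where "B = {x \<in> space F. 1 / 2 < f C x}"
    have BF: "B \<in> sets F"
    proof -
      have [measurable]: "f C \<in> borel_measurable F" by (simp add: f_def)
      show ?thesis unfolding B_def by measurable
    qed
    have "AE x in M. x \<notin> sym_diff B C"
      using a0 a1 AE_space by eventually_elim (auto simp: B_def spF indicator_def split: if_splits)
    hence "prob (sym_diff B C) = 0" using FM[OF BF] Cm by (subst prob_eq_0) auto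
    thus "\<exists>B\<in>sets F. sdiff B {x \<in> space M. t l x \<in> K} = 0" using BF unfolding C_def sdiff_def by blast
  qed
qed

end

section \<open>The odometer\<close>

lemma odo_a_special: "2 \<le> k \<Longrightarrow> odo_a (10 ^ k) = k"
  unfolding odo_a_def by (auto intro!: the_equality)

lemma odo_a_plain: "\<not> (\<exists>k\<ge>2. i = 10 ^ k) \<Longrightarrow> odo_a i = 8"
  unfolding odo_a_def by (rule if_not_P)

lemma odo_a_ge2: "2 \<le> odo_a i"
  using odo_a_special odo_a_plain[of i] by (cases "\<exists>k\<ge>2. i = 10 ^ k") auto

text \<open>Levels are numbered from 0, coordinates from 1.\<close>

definition odo_A :: "nat \<Rightarrow> int" where "odo_A l = int (odo_a (Suc l))"

text \<open>These are the removed coordinate values after adding 1: the value 7 in base 8 becomes 0,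
  and the values below \<open>k\<close> in base \<open>2 * k\<close> become
  \<open>1..k\<close>.\<close>

definition odo_Sh :: "nat \<Rightarrow> int set" where
  "odo_Sh l = (if \<exists>k\<ge>2. Suc l = 10 ^ k
     then {c. \<exists>k\<ge>2. Suc l = 10 ^ (2 * k) \<and> 1 \<le> c \<and> c \<le> int k} else {0})"

text \<open>The sets \<open>odo_W j\<close> start at \<open>j = 2\<close>, that is at coordinate
  \<open>10 ^ 4\<close>; hence \<open>10 ^ 2\<close> is uncut like the odd powers.\<close>

lemma odo_Sh_special: assumes "2 \<le> k" "Suc l = 10 ^ k"
  shows "odo_Sh l = (if even k \<and> 4 \<le> k then {1..int (k div 2)} else {})"
proof -
  have "Suc l = 10 ^ (2 * j) \<longleftrightarrow> k = 2 * j" for j using assms by auto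
  hence "odo_Sh l = {c. \<exists>j\<ge>2. k = 2 * j \<and> 1 \<le> c \<and> c \<le> int j}" unfolding odo_Sh_def using assms by auto
  also have "\<dots> = (if even k \<and> 4 \<le> k then {1..int (k div 2)} else {})" by auto
  finally show ?thesis .
qed

lemma odo_plain: "\<not> (\<exists>k\<ge>2. Suc l = 10 ^ k) \<Longrightarrow> odo_A l = 8 \<and> odo_Sh l = {0}"
  using odo_a_plain[of "Suc l"] by (auto simp: odo_A_def odo_Sh_def)

lemma odo_shape: "(odo_A l = 8 \<and> odo_Sh l = {0}) \<or> (odo_A l \<ge> 2 \<and> odo_Sh l = {}) \<or> (\<exists>k\<ge>2. odo_A l = 2 * k \<and> odo_Sh l = {1..k})"
proof (cases "\<exists>k\<ge>2. Suc l = 10 ^ k")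
  case True
  then obtain k where k: "2 \<le> k" "Suc l = 10 ^ k" by blast
  have A: "odo_A l = int k" using k odo_a_special by (simp add: odo_A_def)
  show ?thesis
  proof (cases "even k \<and> 4 \<le> k")
    case T: True
    then obtain j where j: "k = 2 * j" by blast
    have "2 \<le> int j" "odo_A l = 2 * int j" "odo_Sh l = {1..int j}" 
      using T j A odo_Sh_special[OF k] by auto
    thus ?thesis by blast
  next
    case False
    thus ?thesis using k A odo_Sh_special[OF k] by auto
  qed
qed (use odo_plain in simp)

interpretation odo: tower_shape odo_A odo_Sh
proof
  fix l
  show "(odo_A l = 8 \<and> odo_Sh l = {0}) \<or> (odo_A l \<ge> 2 \<and> odo_Sh l = {}) \<or> (\<exists>k\<ge>2. odo_A l = 2 * k \<and> odo_Sh l = {1..k})"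
    by (rule odo_shape)
next
  fix l assume a: "\<not> (odo_A l = 8 \<and> odo_Sh l = {0})"
  then obtain k where k: "2 \<le> k" "Suc l = 10 ^ k" using odo_plain by blast
  have l1: "1 \<le> l"
  proof -
    have "(10::nat) ^ 2 \<le> 10 ^ k" using k by (intro power_increasing) auto
    thus ?thesis using k by simp
  qed
  have "\<not> (\<exists>j\<ge>2. Suc (l - 1) = 10 ^ j)"
  proof safe
    fix j :: nat assume j: "2 \<le> j" "Suc (l - 1) = 10 ^ j"
    hence "(10::nat) ^ j + 1 = 10 ^ k" using k l1 by simp
    moreover have "even ((10::nat) ^ j)" "even ((10::nat) ^ k)" using j k by auto
    ultimately show False by presburger
  qed
  thus "1 \<le> l \<and> odo_A (l - 1) = 8 \<and> odo_Sh (l - 1) = {0}" using l1 odo_plain by blast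
next
  fix K :: nat
  \<comment> \<open>An odd exponent gives an uncut level, whose base is the exponent itself and so
    as large as desired.\<close>
  define k where "k = 2 * K + 3"
  define l where "l = 10 ^ k - (1::nat)"
  have l: "Suc l = 10 ^ k" by (simp add: l_def)
  have "k < 10 ^ k" by (rule less_exp[THEN less_le_trans]) (intro power_mono, auto)
  hence "K \<le> l" unfolding l_def k_def by simp
  moreover have "odo_Sh l = {}" using odo_Sh_special[OF _ l] by (simp add: k_def)
  moreover have "int K \<le> odo_A l" using odo_a_special[of k] by (simp add: odo_A_def l) (simp add: k_def)
  ultimately show "\<exists>l\<ge>K. odo_Sh l = {} \<and> odo_A l \<ge> int K" by blast
qed

section \<open>Residues of points of the odometer\<close>

lemma odo_X_iff: "x \<in> odo_X \<longleftrightarrow> x \<in> extensional {1..} \<and> (\<forall>i\<ge>1. x i < odo_a i)"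
  by (auto simp: odo_X_def odo_top_def PiE_iff)

lemma mod_div_add_less: fixes r q c :: nat assumes "r < q" shows "(c * q + r) mod q = r" "(c * q + r) div q = c"
  using assms by simp_all

text \<open>Place values, then the residue of a point modulo \<open>odo_q l\<close>, then the number
  whose first \<open>l\<close> digits are all 1.\<close>

definition odo_q :: "nat \<Rightarrow> nat" where "odo_q l = (\<Prod>i<l. odo_a (Suc i))"
definition odo_Q :: "(nat \<Rightarrow> nat) \<Rightarrow> nat \<Rightarrow> nat" where "odo_Q x l = (\<Sum>i<l. x (Suc i) * odo_q i)"
definition odo_e :: "nat \<Rightarrow> nat" where "odo_e l = (\<Sum>i<l. odo_q i)"

text \<open>Adding 1 to every digit moves the removed points to the tops of the towers:
  the condition \<open>x_i = a_i - 2\<close> for all \<open>i \<le> l\<close> becomes \<open>odo_P x l = odo_q l - 1\<close>.\<close>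

definition odo_P :: "(nat \<Rightarrow> nat) \<Rightarrow> nat \<Rightarrow> nat" where "odo_P x l = (odo_Q x l + odo_e l) mod odo_q l"
definition odo_D :: "(nat \<Rightarrow> nat) \<Rightarrow> nat \<Rightarrow> nat" where "odo_D x l = odo_P x (Suc l) div odo_q l"

lemma odo_q_0 [simp]: "odo_q 0 = 1" and odo_q_Suc: "odo_q (Suc l) = odo_a (Suc l) * odo_q l"
  and odo_Q_0 [simp]: "odo_Q x 0 = 0" and odo_Q_Suc: "odo_Q x (Suc l) = odo_Q x l + x (Suc l) * odo_q l"
  and odo_e_0 [simp]: "odo_e 0 = 0" and odo_e_Suc: "odo_e (Suc l) = odo_e l + odo_q l"
  by (simp_all add: odo_q_def odo_Q_def odo_e_def)

lemma odo_q_ge: "2 ^ l \<le> odo_q l"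
proof (induction l)
  case (Suc l) show ?case unfolding odo_q_Suc power_Suc using Suc odo_a_ge2 by (intro mult_mono) auto
qed simp

lemma odo_q_pos: "0 < odo_q l" and odo_q_ge_self: "l < odo_q l"
  using odo_q_ge[of l] less_exp[of l] by (linarith)+

lemma odo_e_less: "odo_e l < odo_q l"
proof (induction l)
  case (Suc l)
  have "2 * odo_q l \<le> odo_q (Suc l)" unfolding odo_q_Suc using odo_a_ge2 by (intro mult_right_mono) auto
  thus ?case using Suc by (simp add: odo_e_Suc)
qed simp

lemma odo_Q_less: "x \<in> odo_X \<Longrightarrow> odo_Q x l < odo_q l"
proof (induction l)
  case (Suc l)
  have "x (Suc l) < odo_a (Suc l)" using Suc(2) by (simp add: odo_X_iff)
  hence "Suc (x (Suc l)) * odo_q l \<le> odo_a (Suc l) * odo_q l" by (intro mult_right_mono) auto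
  thus ?case using Suc by (simp add: odo_Q_Suc odo_q_Suc)
qed simp

lemma odo_Q_Suc_mod_div: 
  assumes "x \<in> odo_X"
  shows "odo_Q x (Suc l) mod odo_q l = odo_Q x l" "odo_Q x (Suc l) div odo_q l = x (Suc l)"
  using odo_Q_less[OF assms, of l] by (simp_all add: odo_Q_Suc)

lemma odo_P_less: "odo_P x l < odo_q l"
  by (simp add: odo_P_def odo_q_pos)

lemma odo_P_Suc_mod: "odo_P x (Suc l) mod odo_q l = odo_P x l"
proof -
  have "odo_P x (Suc l) mod odo_q l = (odo_Q x (Suc l) + odo_e (Suc l)) mod odo_q l"
    unfolding odo_P_def odo_q_Suc by (simp add: mod_mod_cancel)
  also have "odo_Q x (Suc l) + odo_e (Suc l) = odo_Q x l + odo_e l + (x (Suc l) + 1) * odo_q l"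
    by (simp add: odo_Q_Suc odo_e_Suc)
  finally show ?thesis by (simp only: odo_P_def mod_mult_self1)
qed

lemma odo_P_Suc: "odo_P x (Suc l) = odo_D x l * odo_q l + odo_P x l"
  unfolding odo_D_def using odo_P_Suc_mod[of x l] div_mult_mod_eq[of "odo_P x (Suc l)" "odo_q l"] by simp

lemma odo_D_less: "odo_D x l < odo_a (Suc l)"
  unfolding odo_D_def using odo_P_less[of x "Suc l"] unfolding odo_q_Suc by (simp add: less_mult_imp_div_less)

lemma odo_S_X: "odo_S x \<in> odo_X" if "x \<in> odo_X"
proof -
  have "0 < odo_a i" for i using odo_a_ge2[of i] by simp
  thus ?thesis using that by (auto simp: odo_X_iff odo_S_def)
qed

lemma odo_Q_top: "x \<in> odo_X \<Longrightarrow> odo_Q x l = odo_q l - 1 \<longleftrightarrow> (\<forall>j\<in>{1..<Suc l}. x j = odo_a j - 1)"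
proof (induction l)
  case (Suc l)
  have a2: "2 \<le> odo_a (Suc l)" by (rule odo_a_ge2)
  have xl: "x (Suc l) < odo_a (Suc l)" using Suc(2) by (simp add: odo_X_iff)
  have q: "odo_q (Suc l) - 1 = (odo_a (Suc l) - 1) * odo_q l + (odo_q l - 1)"
    using a2 odo_q_pos[of l] by (simp add: odo_q_Suc diff_mult_distrib)
  have "odo_Q x (Suc l) = odo_q (Suc l) - 1 \<longleftrightarrow> x (Suc l) = odo_a (Suc l) - 1 \<and> odo_Q x l = odo_q l - 1"
  proof
    assume e: "odo_Q x (Suc l) = odo_q (Suc l) - 1"
    have "odo_Q x (Suc l) mod odo_q l = odo_q l - 1" "odo_Q x (Suc l) div odo_q l = odo_a (Suc l) - 1"
      unfolding e q using odo_q_pos[of l] by (intro mod_div_add_less; simp)+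
    thus "x (Suc l) = odo_a (Suc l) - 1 \<and> odo_Q x l = odo_q l - 1" using odo_Q_Suc_mod_div[OF Suc(2), of l] by simp
  next
    assume "x (Suc l) = odo_a (Suc l) - 1 \<and> odo_Q x l = odo_q l - 1"
    thus "odo_Q x (Suc l) = odo_q (Suc l) - 1" unfolding q odo_Q_Suc by simp
  qed
  moreover have "{1..<Suc (Suc l)} = insert (Suc l) {1..<Suc l}" by auto
  ultimately show ?case using Suc by auto
qed simp

lemma odo_Q_S: "x \<in> odo_X \<Longrightarrow> odo_Q (odo_S x) l = (odo_Q x l + 1) mod odo_q l"
proof (induction l)
  case (Suc l)
  note x = Suc(2)
  have IH: "odo_Q (odo_S x) l = (odo_Q x l + 1) mod odo_q l" using Suc by simp
  have xl: "x (Suc l) < odo_a (Suc l)" using x by (simp add: odo_X_iff)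
  show ?case
  proof (cases "odo_Q x l = odo_q l - 1")
    case True
    hence "odo_S x (Suc l) = (x (Suc l) + 1) mod odo_a (Suc l)" using odo_Q_top[OF x, of l] by (simp add: odo_S_def)
    moreover have "odo_Q (odo_S x) l = 0" using IH True odo_q_pos[of l] by simp
    moreover have "odo_Q x (Suc l) + 1 = (x (Suc l) + 1) * odo_q l" using True odo_q_pos[of l] by (simp add: odo_Q_Suc)
    ultimately show ?thesis by (simp add: odo_Q_Suc[of "odo_S x"] odo_q_Suc mult_mod_left)
  next
    case False
    hence "odo_S x (Suc l) = x (Suc l)" using odo_Q_top[OF x, of l] by (auto simp: odo_S_def)
    moreover have lt: "odo_Q x l + 1 < odo_q l" using False odo_Q_less[OF x, of l] by simp
    moreover have "odo_Q x (Suc l) + 1 < odo_q (Suc l)"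
    proof -
      have "Suc (x (Suc l)) * odo_q l \<le> odo_a (Suc l) * odo_q l" using xl by (intro mult_right_mono) auto
      thus ?thesis using lt by (simp add: odo_Q_Suc odo_q_Suc)
    qed
    ultimately show ?thesis using IH by (simp add: odo_Q_Suc)
  qed
qed simp

lemma odo_P_S: "x \<in> odo_X \<Longrightarrow> odo_P (odo_S x) l = (odo_P x l + 1) mod odo_q l"
proof -
  assume x: "x \<in> odo_X"
  have "odo_P (odo_S x) l = ((odo_Q x l + 1) mod odo_q l + odo_e l) mod odo_q l" unfolding odo_P_def odo_Q_S[OF x] ..
  also have "\<dots> = (odo_Q x l + odo_e l + 1) mod odo_q l" unfolding mod_add_left_eq by (simp add: ac_simps)
  also have "\<dots> = (odo_P x l + 1) mod odo_q l" unfolding odo_P_def mod_add_left_eq ..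
  finally show ?thesis .
qed

lemma odo_Q_inj: assumes "x \<in> odo_X" "y \<in> odo_X" "\<And>l. odo_Q x l = odo_Q y l" shows "x = y"
proof (rule extensionalityI[of _ "{1..}"])
  fix i :: nat assume "i \<in> {1..}"
  then obtain l where "i = Suc l" by (cases i) auto
  thus "x i = y i" using odo_Q_Suc_mod_div(2)[OF assms(1), of l] odo_Q_Suc_mod_div(2)[OF assms(2), of l] assms(3) by simp
qed (use assms odo_X_iff in auto)

lemma odo_Q_of_P: assumes "x \<in> odo_X" shows "odo_Q x l = (odo_P x l + (odo_q l - odo_e l)) mod odo_q l"
proof -
  have "(odo_P x l + (odo_q l - odo_e l)) mod odo_q l = (odo_Q x l + odo_e l + (odo_q l - odo_e l)) mod odo_q l"
    unfolding odo_P_def mod_add_left_eq ..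
  also have "odo_Q x l + odo_e l + (odo_q l - odo_e l) = odo_Q x l + odo_q l" using odo_e_less[of l] by simp
  finally show ?thesis using odo_Q_less[OF assms, of l] by simp
qed

lemma odo_P_inj: assumes "x \<in> odo_X" "y \<in> odo_X" "\<And>l. odo_P x l = odo_P y l" shows "x = y"
  using odo_Q_inj[OF assms(1,2)] odo_Q_of_P assms by metis

lemma odo_S_surj: assumes y: "y \<in> odo_X" shows "\<exists>x\<in>odo_X. odo_S x = y"
proof -
  \<comment> \<open>\<open>p l\<close> is the residue of \<open>y - 1\<close>; these residues are
    coherent in \<open>l\<close> and therefore come from a point.\<close>
  define p where "p l = (odo_Q y l + (odo_q l - 1)) mod odo_q l" for l
  define x where "x = (\<lambda>i\<in>{1..}. p i div odo_q (i - 1))"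
  have pl: "p l < odo_q l" for l using odo_q_pos by (simp add: p_def)
  have pm: "p (Suc l) mod odo_q l = p l" for l
  proof -
    have "odo_Q y (Suc l) + (odo_q (Suc l) - 1) = odo_Q y l + (odo_q l - 1) + (y (Suc l) + (odo_a (Suc l) - 1)) * odo_q l"
    proof -
      obtain a where a: "odo_a (Suc l) = Suc a" using odo_a_ge2[of "Suc l"] by (cases "odo_a (Suc l)") auto
      obtain b where b: "odo_q l = Suc b" using odo_q_pos[of l] by (cases "odo_q l") auto
      show ?thesis unfolding odo_Q_Suc odo_q_Suc a b by (simp add: algebra_simps)
    qed
    hence "p (Suc l) mod odo_q l = (odo_Q y l + (odo_q l - 1) + (y (Suc l) + (odo_a (Suc l) - 1)) * odo_q l) mod odo_q l"
      unfolding p_def odo_q_Suc by (simp add: mod_mod_cancel)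
    thus ?thesis by (simp only: p_def mod_mult_self1)
  qed
  have xX: "x \<in> odo_X"
    unfolding odo_X_iff
  proof safe
    fix i :: nat assume "1 \<le> i"
    then obtain l where "i = Suc l" by (cases i) auto
    thus "x i < odo_a i" using pl[of "Suc l"] by (simp add: x_def odo_q_Suc less_mult_imp_div_less)
  qed (simp add: x_def)
  have Qx: "odo_Q x l = p l" for l
  proof (induction l)
    case 0
    show ?case using pl[of 0] by simp
  next
    case (Suc l)
    have "odo_Q x (Suc l) = p (Suc l) div odo_q l * odo_q l + p (Suc l) mod odo_q l"
      unfolding pm odo_Q_Suc Suc by (simp add: x_def)
    thus ?case by simp
  qed
  have "odo_S x = y"
  proof (rule odo_Q_inj[OF odo_S_X[OF xX] y])
    fix l
    have "odo_Q (odo_S x) l = (p l + 1) mod odo_q l" by (simp only: odo_Q_S[OF xX] Qx)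
    also have "\<dots> = (odo_Q y l + (odo_q l - 1) + 1) mod odo_q l" unfolding p_def mod_add_left_eq ..
    also have "odo_Q y l + (odo_q l - 1) + 1 = odo_Q y l + odo_q l" using odo_q_pos[of l] by simp
    finally show "odo_Q (odo_S x) l = odo_Q y l" using odo_Q_less[OF y, of l] by simp
  qed
  thus ?thesis using xX by blast
qed

text \<open>\<open>odo_P\<close> is the height in the full tower of \<open>odo_q l\<close> sets; a
  point is removed if it sits at the top of such a tower in a copy listed in
  \<open>odo_Sh\<close>.\<close>

definition odo_rem :: "(nat \<Rightarrow> nat) \<Rightarrow> nat \<Rightarrow> bool" where
  "odo_rem x l \<longleftrightarrow> odo_P x l = odo_q l - 1 \<and> int (odo_D x l) \<in> odo_Sh l"

section \<open>Removed points, and the heights that remain\<close>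

lemma odo_D_top: 
  assumes x: "x \<in> odo_X" and e: "odo_Q x l + odo_e l + 1 = odo_q l"
  shows "odo_D x l = (x (Suc l) + 1) mod odo_a (Suc l)"
proof -
  have "odo_Q x (Suc l) + odo_e (Suc l) = (x (Suc l) + 1) * odo_q l + (odo_q l - 1)"
    using e by (simp add: odo_Q_Suc odo_e_Suc)
  hence "odo_D x l = (((x (Suc l) + 1) * odo_q l + (odo_q l - 1)) mod (odo_q l * odo_a (Suc l))) div odo_q l"
    unfolding odo_D_def odo_P_def odo_q_Suc by (simp only: mult.commute)
  also have "\<dots> = ((x (Suc l) + 1) * odo_q l + (odo_q l - 1)) div odo_q l mod odo_a (Suc l)"
    using odo_q_pos[of l] by (simp add: mod_mult2_eq)
  also have "((x (Suc l) + 1) * odo_q l + (odo_q l - 1)) div odo_q l = x (Suc l) + 1"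
    using odo_q_pos[of l] by (intro mod_div_add_less) simp
  finally show ?thesis .
qed

lemma odo_P_Suc_top:
  "odo_P x (Suc l) = odo_q (Suc l) - 1 \<longleftrightarrow> odo_P x l = odo_q l - 1 \<and> odo_D x l = odo_a (Suc l) - 1"
proof -
  have a2: "2 \<le> odo_a (Suc l)" by (rule odo_a_ge2)
  have q: "odo_q (Suc l) - 1 = (odo_a (Suc l) - 1) * odo_q l + (odo_q l - 1)"
    using a2 odo_q_pos[of l] by (simp add: odo_q_Suc diff_mult_distrib)
  show ?thesis
  proof
    assume e: "odo_P x (Suc l) = odo_q (Suc l) - 1"
    show "odo_P x l = odo_q l - 1 \<and> odo_D x l = odo_a (Suc l) - 1"
      unfolding odo_P_Suc_mod[symmetric, of x l] odo_D_def e q using odo_q_pos[of l]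
      by (intro conjI mod_div_add_less) simp_all
  next
    assume "odo_P x l = odo_q l - 1 \<and> odo_D x l = odo_a (Suc l) - 1"
    thus "odo_P x (Suc l) = odo_q (Suc l) - 1" unfolding q odo_P_Suc by simp
  qed
qed

text \<open>Both claims are needed in one induction: only because no reduction modulo
  \<open>odo_q l\<close> has occurred can \<open>odo_D_top\<close> identify the next digit with
  \<open>x (Suc l) + 1\<close> modulo the base.\<close>

lemma odo_P_top_iff:
  assumes x: "x \<in> odo_X"
  shows "(odo_P x l = odo_q l - 1 \<longleftrightarrow> (\<forall>i\<in>{1..<Suc l}. x i = odo_a i - 2)) \<and>
    (odo_P x l = odo_q l - 1 \<longrightarrow> odo_Q x l + odo_e l + 1 = odo_q l)"
proof (induction l)
  case 0 show ?case by (simp add: odo_P_def)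
next
  case (Suc l)
  have xl: "x (Suc l) < odo_a (Suc l)" using x by (simp add: odo_X_iff)
  have a2: "2 \<le> odo_a (Suc l)" by (rule odo_a_ge2)
  note 1 = odo_P_Suc_top[of x l]
  have 2: "odo_D x l = odo_a (Suc l) - 1 \<longleftrightarrow> x (Suc l) = odo_a (Suc l) - 2" if "odo_P x l = odo_q l - 1"
  proof -
    have "odo_D x l = (x (Suc l) + 1) mod odo_a (Suc l)" using odo_D_top[OF x] Suc that by blast
    also have "\<dots> = (if x (Suc l) + 1 = odo_a (Suc l) then 0 else x (Suc l) + 1)" using xl by auto
    finally show ?thesis using xl a2 by auto
  qed
  have s: "{1..<Suc (Suc l)} = insert (Suc l) {1..<Suc l}" by auto
  have 3: "odo_Q x (Suc l) + odo_e (Suc l) + 1 = odo_q (Suc l)" if "odo_P x (Suc l) = odo_q (Suc l) - 1"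
  proof -
    have "odo_P x l = odo_q l - 1" "x (Suc l) = odo_a (Suc l) - 2" using that 1 2 by auto
    moreover have "odo_Q x l + odo_e l + 1 = odo_q l" using Suc calculation by blast
    moreover have "(odo_a (Suc l) - 2) * odo_q l + odo_q l + odo_q l = odo_a (Suc l) * odo_q l"
      using a2 by (metis add.commute add_mult_distrib le_add_diff_inverse mult_2 add.assoc)
    ultimately show ?thesis by (simp add: odo_Q_Suc odo_e_Suc odo_q_Suc)
  qed
  show ?case using 1 2 3 Suc unfolding s by auto
qed

lemma odo_Y_iff: "x \<in> odo_Y \<longleftrightarrow> x \<in> odo_X \<and> (\<forall>l. \<not> odo_rem x l)"
proof -
  have Z: "x \<in> odo_Z (Suc l) \<longleftrightarrow> odo_rem x l" if x: "x \<in> odo_X" and l: "\<not> (\<exists>k\<ge>2. Suc l = 10 ^ k)" for l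
  proof -
    have a8: "odo_a (Suc l) = 8" and Sh: "odo_Sh l = {0}" using l odo_a_plain odo_plain by auto
    have xl: "x (Suc l) < 8" using x a8 by (metis odo_X_iff le_add1 plus_1_eq_Suc)
    show ?thesis
    proof (cases "odo_P x l = odo_q l - 1")
      case True
      hence "odo_D x l = (x (Suc l) + 1) mod 8" using odo_D_top[OF x] odo_P_top_iff[OF x, of l] a8 by simp
      hence "odo_D x l = 0 \<longleftrightarrow> x (Suc l) = 7" using xl by presburger
      thus ?thesis using True odo_P_top_iff[OF x, of l] x Sh by (auto simp: odo_Z_def odo_rem_def)
    next
      case False
      thus ?thesis using odo_P_top_iff[OF x, of l] by (simp add: odo_Z_def odo_rem_def)
    qed
  qed
  have W: "x \<in> odo_W k \<longleftrightarrow> odo_rem x l" if x: "x \<in> odo_X" and l: "2 \<le> k" "Suc l = 10 ^ (2 * k)" for k l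
  proof -
    have a: "odo_a (Suc l) = 2 * k" using l odo_a_special[of "2 * k"] by simp
    have Sh: "odo_Sh l = {1..int k}" using odo_Sh_special[of "2 * k" l] l by simp
    have xl: "x (Suc l) < 2 * k" using x a by (metis odo_X_iff le_add1 plus_1_eq_Suc)
    show ?thesis
    proof (cases "odo_P x l = odo_q l - 1")
      case True
      have "odo_D x l = (x (Suc l) + 1) mod (2 * k)" using True odo_D_top[OF x] odo_P_top_iff[OF x, of l] a by simp
      also have "\<dots> = (if x (Suc l) + 1 = 2 * k then 0 else x (Suc l) + 1)" using xl by auto
      finally have "int (odo_D x l) \<in> odo_Sh l \<longleftrightarrow> x (Suc l) < k" unfolding Sh using xl l by auto
      moreover have "real (x (Suc l)) < real (odo_a (Suc l)) / 2 \<longleftrightarrow> x (Suc l) < k" unfolding a by simp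
      ultimately show ?thesis using True odo_P_top_iff[OF x, of l] x l(2) by (simp add: odo_W_def odo_rem_def)
    next
      case False
      thus ?thesis using odo_P_top_iff[OF x, of l] l(2) by (auto simp: odo_W_def odo_rem_def)
    qed
  qed
  show ?thesis
  proof
    assume Y: "x \<in> odo_Y"
    hence x: "x \<in> odo_X" by (simp add: odo_Y_def)
    have "\<not> odo_rem x l" for l
    proof (cases "\<exists>k\<ge>2. Suc l = 10 ^ k")
      case False
      hence "x \<notin> odo_Z (Suc l)" using Y by (auto simp: odo_Y_def)
      thus ?thesis using Z[OF x False] by simp
    next
      case True
      then obtain k where k: "2 \<le> k" "Suc l = 10 ^ k" by blast
      show ?thesis
      proof (cases "even k \<and> 4 \<le> k")
        case T: True
        then obtain j where j: "k = 2 * j" by blast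
        hence "2 \<le> j" using T by simp
        hence "x \<notin> odo_W j" using Y by (auto simp: odo_Y_def)
        thus ?thesis using W[OF x \<open>2 \<le> j\<close>] k j by simp
      next
        case False
        thus ?thesis using odo_Sh_special[OF k] by (auto simp: odo_rem_def)
      qed
    qed
    thus "x \<in> odo_X \<and> (\<forall>l. \<not> odo_rem x l)" using x by simp
  next
    assume a: "x \<in> odo_X \<and> (\<forall>l. \<not> odo_rem x l)"
    have "x \<notin> odo_Z i" if "i \<in> {1..} - {10 ^ k |k. k \<ge> 2}" for i
    proof -
      have "0 < i" using that by simp
      then obtain l where "i = Suc l" by (cases i) auto
      thus ?thesis using Z[of l] a that by blast
    qed
    moreover have "x \<notin> odo_W k" if "k \<in> {2..}" for k
    proof -
      obtain l where "Suc l = 10 ^ (2 * k)" by (metis Suc_pred zero_less_power zero_less_numeral)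
      thus ?thesis using W[of k l] a that by auto
    qed
    ultimately show "x \<in> odo_Y" using a by (auto simp: odo_Y_def)
  qed
qed

text \<open>The height in the tower of level \<open>l\<close> after the removals at lower levels, in
  contrast to \<open>odo_P\<close>.\<close>

fun odo_t :: "nat \<Rightarrow> (nat \<Rightarrow> nat) \<Rightarrow> int" where
  "odo_t 0 x = 0"
| "odo_t (Suc l) x = odo.blk l (int (odo_D x l)) + odo_t l x"

lemma odo_D_range: "0 \<le> int (odo_D x l)" "int (odo_D x l) < odo_A l"
  using odo_D_less[of x l] by (simp_all add: odo_A_def)

lemma odo_P_top_below: "odo_P x l = odo_q l - 1 \<Longrightarrow> i \<le> l \<Longrightarrow> odo_P x i = odo_q i - 1"
proof (induction l)
  case (Suc l)
  thus ?case using odo_P_Suc_top[of x l] by (cases "i = Suc l") auto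
qed simp

lemma odo_t_top: "odo_P x l = odo_q l - 1 \<Longrightarrow> odo_t l x = odo.h l - 1 \<and> (\<forall>i<l. \<not> odo_rem x i)"
proof (induction l)
  case (Suc l)
  have p: "odo_P x l = odo_q l - 1" "odo_D x l = odo_a (Suc l) - 1" using Suc(2) odo_P_Suc_top by auto
  hence d: "int (odo_D x l) = odo_A l - 1" using odo_a_ge2[of "Suc l"] by (simp add: odo_A_def)
  have "\<not> odo_rem x l" using odo.top_notin_Sh[of l] d by (simp add: odo_rem_def)
  thus ?case using Suc.IH[OF p(1)] odo.blk_top[of l] d by (auto simp: less_Suc_eq)
qed simp

lemma odo_t_bottom: "odo_P x l = 0 \<Longrightarrow> odo_t l x = 0"
proof (induction l)
  case (Suc l)
  thus ?case using odo_P_Suc[of x l] odo_q_pos[of l] by simp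
qed simp

text \<open>The last clause is what \<open>odo_pt\<close> needs: a point at the top height in a
  short copy would be a removed one.\<close>

lemma odo_t_bounds: assumes x: "x \<in> odo_Y"
  shows "0 \<le> odo_t l x \<and> odo_t l x \<le> odo.h l - 1 \<and> (odo_t l x = odo.h l - 1 \<longrightarrow> odo_P x l = odo_q l - 1)"
proof (induction l)
  case 0 show ?case by (simp add: odo_P_def)
next
  case (Suc l)
  have nr: "\<not> odo_rem x l" using x odo_Y_iff by simp
  note d = odo_D_range[of x l]
  have b: "odo.blk l (int (odo_D x l)) \<le> odo.h (Suc l) - odo.h l" "0 \<le> odo.blk l (int (odo_D x l))"
    using odo.blk_le_top[OF d] odo.blk_nonneg[OF d(1)] by auto
  have "odo_P x (Suc l) = odo_q (Suc l) - 1" if e: "odo_t (Suc l) x = odo.h (Suc l) - 1"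
  proof -
    have 1: "odo_t l x = odo.h l - 1" and 2: "odo.blk l (int (odo_D x l)) = odo.h (Suc l) - odo.h l" using e b Suc by auto
    have p: "odo_P x l = odo_q l - 1" using 1 Suc by simp
    have "int (odo_D x l) = odo_A l - 1"
    proof (rule ccontr)
      assume "int (odo_D x l) \<noteq> odo_A l - 1"
      hence "odo.blk l (int (odo_D x l) + 1) \<le> odo.h (Suc l) - odo.h l" using odo.blk_le_top[of "int (odo_D x l) + 1" l] d by simp
      moreover have "int (odo_D x l) \<notin> odo_Sh l" using p nr by (simp add: odo_rem_def)
      ultimately show False using odo.blk_step[OF d(1)] 2 odo.h_ge1[of l] by simp
    qed
    hence "odo_D x l = odo_a (Suc l) - 1" by (simp add: odo_A_def)
    thus ?thesis using p odo_P_Suc_top by simp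
  qed
  thus ?case using Suc b by auto
qed

lemma odo_pt: assumes x: "x \<in> odo_Y" shows "odo.pt (\<lambda>l. odo_t l x) (\<lambda>l. int (odo_D x l))"
  unfolding odo.pt_def
proof (intro allI conjI odo_D_range)
  fix l
  show "0 \<le> odo_t l x" using odo_t_bounds[OF x, of l] by simp
  have "\<not> odo_rem x l" using x odo_Y_iff by simp
  thus "odo_t l x + of_bool (int (odo_D x l) \<in> odo_Sh l) < odo.h l"
    using odo_t_bounds[OF x, of l] by (auto simp: odo_rem_def)
qed simp

text \<open>Heights count surviving points. When the column of level \<open>m\<close> is left, the
  height there drops from \<open>odo.h m - 1\<close> to 0 while the offset grows by
  \<open>odo.h m\<close>, or by one less if the copy is short; the net change is 1 or 0.\<close>

lemma odo_t_S:
  assumes x: "x \<in> odo_X"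
  shows "odo_P x m + 1 < odo_q m \<Longrightarrow> odo_t m (odo_S x) = odo_t m x + of_bool (\<not> (\<exists>l<m. odo_rem x l))"
proof (induction m)
  case (Suc m)
  have PS: "odo_P (odo_S x) (Suc m) = odo_P x (Suc m) + 1" using odo_P_S[OF x, of "Suc m"] Suc.prems by simp
  have ex: "(\<exists>l<Suc m. odo_rem x l) \<longleftrightarrow> (\<exists>l<m. odo_rem x l) \<or> odo_rem x m" by (auto simp: less_Suc_eq)
  show ?case
  proof (cases "odo_P x m + 1 < odo_q m")
    case True
    have "odo_D (odo_S x) m = (odo_D x m * odo_q m + (odo_P x m + 1)) div odo_q m"
      unfolding odo_D_def[of "odo_S x"] PS by (simp add: odo_P_Suc)
    also have "\<dots> = odo_D x m" by (rule mod_div_add_less(2)[OF True])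
    finally have "odo_D (odo_S x) m = odo_D x m" .
    moreover have "odo_P x m \<noteq> odo_q m - 1" using True by linarith
    hence "\<not> odo_rem x m" by (simp add: odo_rem_def)
    ultimately show ?thesis using Suc.IH[OF True] ex by simp
  next
    case False
    hence p: "odo_P x m = odo_q m - 1" using odo_P_less[of x m] by simp
    have "odo_P (odo_S x) m = 0" using odo_P_S[OF x, of m] p odo_q_pos[of m] by simp
    hence t0: "odo_t m (odo_S x) = 0" by (rule odo_t_bottom)
    have "odo_P x (Suc m) + 1 = (odo_D x m + 1) * odo_q m" using p odo_q_pos[of m] by (simp add: odo_P_Suc)
    hence "odo_D (odo_S x) m = odo_D x m + 1" unfolding odo_D_def[of "odo_S x"] PS using odo_q_pos[of m] by simp
    hence "odo_t (Suc m) (odo_S x) = odo.blk m (int (odo_D x m)) + odo.h m - of_bool (int (odo_D x m) \<in> odo_Sh m)"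
      using t0 odo.blk_step[of "int (odo_D x m)" m] by (simp add: add.commute)
    moreover have "odo_t m x = odo.h m - 1" "\<not> (\<exists>l<m. odo_rem x l)" using odo_t_top[OF p] by auto
    ultimately show ?thesis using ex p by (simp add: odo_rem_def)
  qed
qed (simp add: odo_P_def)

lemma odo_q_1: "odo_q (Suc 0) = 8" and odo_Sh_0: "odo_Sh 0 = {0}"
proof -
  have n: "\<not> (\<exists>k\<ge>2. Suc 0 = 10 ^ k)" by (auto simp: eq_commute[of "Suc 0"])
  show "odo_Sh 0 = {0}" using odo_plain[OF n] by simp
  show "odo_q (Suc 0) = 8" using odo_a_plain[OF n] by (simp add: odo_q_Suc)
qed

text \<open>Removal at level 0 needs the raised first digit to be 0, and removal at any higher level
  needs it to be 7.\<close>

lemma odo_Y_if_P1: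
  assumes y: "y \<in> odo_X" and "0 < odo_P y (Suc 0)" "odo_P y (Suc 0) < 7"
  shows "y \<in> odo_Y"
proof -
  have "\<not> odo_rem y l" for l
  proof (cases l)
    case 0
    thus ?thesis using assms odo_Sh_0 by (simp add: odo_rem_def odo_D_def)
  next
    case (Suc j)
    thus ?thesis using odo_P_top_below[of y l "Suc 0"] assms odo_q_1 by (auto simp: odo_rem_def)
  qed
  thus ?thesis using y odo_Y_iff by simp
qed

section \<open>The first return map\<close>

lemma odo_S_pow_X: "x \<in> odo_X \<Longrightarrow> (odo_S ^^ n) x \<in> odo_X"
  by (induction n) (auto simp: odo_S_X)

lemma odo_P_S_pow: "x \<in> odo_X \<Longrightarrow> odo_P ((odo_S ^^ n) x) l = (odo_P x l + n) mod odo_q l"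
proof (induction n)
  case 0 thus ?case by (simp add: odo_P_less)
next
  case (Suc n)
  thus ?case using odo_P_S[OF odo_S_pow_X[OF Suc(2), of n], of l] by (simp add: mod_simps)
qed

lemma odo_return: assumes "x \<in> odo_X" shows "\<exists>n. 1 \<le> n \<and> n \<le> 3 \<and> (odo_S ^^ n) x \<in> odo_Y"
proof -
  define p where "p = odo_P x (Suc 0)"
  have p8: "p < 8" using odo_P_less[of x "Suc 0"] by (simp add: p_def odo_q_1)
  have "\<exists>n. 1 \<le> n \<and> n \<le> 3 \<and> 0 < (p + n) mod 8 \<and> (p + n) mod 8 < 7"
  proof (cases "p < 6")
    case True thus ?thesis by (intro exI[of _ 1]) simp
  next
    case False
    hence "p = 6 \<or> p = 7" using p8 by auto
    thus ?thesis
    proof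
      \<comment> \<open>The residues 7 and 0 follow; the third step reaches 1.\<close>
      assume "p = 6" thus ?thesis by (intro exI[of _ 3]) simp
    next
      assume "p = 7" thus ?thesis by (intro exI[of _ 2]) simp
    qed
  qed
  then obtain n where "1 \<le> n" "n \<le> 3" "0 < (p + n) mod 8" "(p + n) mod 8 < 7" by blast
  thus ?thesis using odo_Y_if_P1[OF odo_S_pow_X[OF assms, of n]] odo_P_S_pow[OF assms, of n "Suc 0"]
    by (auto simp: p_def odo_q_1)
qed

definition odo_r :: "(nat \<Rightarrow> nat) \<Rightarrow> nat" where "odo_r x = (LEAST n. n \<ge> 1 \<and> (odo_S ^^ n) x \<in> odo_Y)"

lemma odo_T_eq: "odo_T x = (odo_S ^^ odo_r x) x"
  by (simp add: odo_T_def first_return_def odo_r_def)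

lemma odo_r:
  assumes x: "x \<in> odo_X"
  shows "1 \<le> odo_r x" "odo_r x \<le> 3" "odo_T x \<in> odo_Y" "\<And>j. 1 \<le> j \<Longrightarrow> j < odo_r x \<Longrightarrow> (odo_S ^^ j) x \<notin> odo_Y"
proof -
  obtain n where n: "1 \<le> n" "n \<le> 3" "(odo_S ^^ n) x \<in> odo_Y" using odo_return[OF x] by blast
  have "1 \<le> odo_r x \<and> (odo_S ^^ odo_r x) x \<in> odo_Y" unfolding odo_r_def by (rule LeastI[of _ n]) (use n in simp)
  thus "1 \<le> odo_r x" "odo_T x \<in> odo_Y" by (auto simp: odo_T_eq)
  show "odo_r x \<le> 3" using Least_le[of "\<lambda>n. n \<ge> 1 \<and> (odo_S ^^ n) x \<in> odo_Y" n] n by (simp add: odo_r_def)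
  show "(odo_S ^^ j) x \<notin> odo_Y" if "1 \<le> j" "j < odo_r x" for j
    using not_less_Least[of j "\<lambda>n. n \<ge> 1 \<and> (odo_S ^^ n) x \<in> odo_Y"] that by (auto simp: odo_r_def)
qed

lemma odo_r_eqI:
  assumes "1 \<le> n" "(odo_S ^^ n) x \<in> odo_Y" "\<And>j. 1 \<le> j \<Longrightarrow> j < n \<Longrightarrow> (odo_S ^^ j) x \<notin> odo_Y"
  shows "odo_r x = n"
  unfolding odo_r_def by (rule Least_equality) (use assms in \<open>auto simp: not_less[symmetric]\<close>)

lemma odo_Y_X: "x \<in> odo_Y \<Longrightarrow> x \<in> odo_X"
  by (simp add: odo_Y_def)

text \<open>Far from both ends of some tower, any given number of steps stays inside that tower and
  inside all higher ones. The points excluded are those for which this fails, a null set by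
  \<open>Y0_conull\<close>; on the rest the return map is a bijection.\<close>

definition odo_Y0 :: "(nat \<Rightarrow> nat) set" where
  "odo_Y0 = {x \<in> odo_Y. \<forall>K. \<exists>m. K < odo_P x m \<and> odo_P x m + K < odo_q m}"

lemma odo_P_mono: "l \<le> m \<Longrightarrow> odo_P x l \<le> odo_P x m"
  by (induction rule: dec_induct) (auto simp: odo_P_Suc)

lemma odo_P_gap_mono: "l \<le> m \<Longrightarrow> odo_q l - odo_P x l \<le> odo_q m - odo_P x m"
proof (induction rule: dec_induct)
  case (step n)
  have "Suc (odo_D x n) * odo_q n \<le> odo_a (Suc n) * odo_q n" using odo_D_less[of x n] by (intro mult_right_mono) auto
  hence "odo_q n - odo_P x n \<le> odo_q (Suc n) - odo_P x (Suc n)" using odo_P_less[of x n] by (simp add: odo_P_Suc odo_q_Suc)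
  thus ?case using step by simp
qed simp

lemma odo_Y0_eventually:
  assumes "x \<in> odo_Y0"
  shows "eventually (\<lambda>m. K < odo_P x m \<and> odo_P x m + K < odo_q m) sequentially"
proof -
  obtain m0 where m0: "K < odo_P x m0" "odo_P x m0 + K < odo_q m0" using assms by (auto simp: odo_Y0_def)
  show ?thesis unfolding eventually_sequentially
  proof (intro exI[of _ m0] allI impI)
    fix m assume "m0 \<le> m"
    thus "K < odo_P x m \<and> odo_P x m + K < odo_q m" using odo_P_mono[of m0 m x] odo_P_gap_mono[of m0 m x] m0 by linarith
  qed
qed

text \<open>The first step leaves the surviving point \<open>x\<close> and adds 1. The at most two
  further steps leave removed points and add nothing once \<open>m\<close> exceeds the levels of
  their removal.\<close>

lemma odo_T_t:
  assumes x: "x \<in> odo_Y0"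
  shows "eventually (\<lambda>m. odo_t m (odo_T x) = odo_t m x + 1) sequentially"
proof -
  have xY: "x \<in> odo_Y" and xX: "x \<in> odo_X" using x odo_Y_X by (auto simp: odo_Y0_def)
  have "\<exists>l. odo_rem ((odo_S ^^ j) x) l" if "1 \<le> j" "j < odo_r x" for j
    using odo_r(4)[OF xX that] odo_S_pow_X[OF xX] odo_Y_iff by blast
  then obtain L where L: "\<And>j. 1 \<le> j \<Longrightarrow> j < odo_r x \<Longrightarrow> odo_rem ((odo_S ^^ j) x) (L j)" by metis
  have "eventually (\<lambda>m. (3 < odo_P x m \<and> odo_P x m + 3 < odo_q m) \<and> m > L 1 \<and> m > L 2) sequentially"
    by (intro eventually_conj odo_Y0_eventually[OF x] eventually_gt_at_top)
  thus ?thesis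
  proof eventually_elim
    case (elim m)
    have step: "odo_t m (odo_S ((odo_S ^^ j) x)) = odo_t m ((odo_S ^^ j) x) + of_bool (\<not> (\<exists>l<m. odo_rem ((odo_S ^^ j) x) l))" if "j < 3" for j
      using odo_t_S[OF odo_S_pow_X[OF xX, of j], of m] odo_P_S_pow[OF xX, of j m] elim that by simp
    have 0: "odo_t m (odo_S x) = odo_t m x + 1" using step[of 0] xY odo_Y_iff by simp
    have st: "odo_t m (odo_S ((odo_S ^^ j) x)) = odo_t m ((odo_S ^^ j) x)" if "1 \<le> j" "j < odo_r x" "j < 3" for j
    proof -
      have "j = 1 \<or> j = 2" using that by auto
      hence "L j < m" using elim by auto
      hence "\<exists>l<m. odo_rem ((odo_S ^^ j) x) l" using L[OF that(1,2)] by blast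
      thus ?thesis using step[OF that(3)] by simp
    qed
    consider "odo_r x = 1" | "odo_r x = 2" | "odo_r x = 3" using odo_r(1,2)[OF xX] by linarith
    thus ?case
    proof cases
      case 1 thus ?thesis using 0 by (simp add: odo_T_eq)
    next
      case 2 thus ?thesis using 0 st[of 1] by (simp add: odo_T_eq numeral_2_eq_2)
    next
      case 3 thus ?thesis using 0 st[of 1] st[of 2] by (simp add: odo_T_eq numeral_2_eq_2 numeral_3_eq_3)
    qed
  qed
qed

lemma odo_T_Y0: assumes x: "x \<in> odo_Y0" shows "odo_T x \<in> odo_Y0"
proof -
  have xX: "x \<in> odo_X" using x odo_Y_X by (auto simp: odo_Y0_def)
  have "\<exists>m. K < odo_P (odo_T x) m \<and> odo_P (odo_T x) m + K < odo_q m" for K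
  proof -
    obtain m where m: "K + 3 < odo_P x m" "odo_P x m + (K + 3) < odo_q m" using x unfolding odo_Y0_def by blast
    have "odo_P (odo_T x) m = odo_P x m + odo_r x"
      using odo_P_S_pow[OF xX, of "odo_r x" m] odo_r(2)[OF xX] m by (simp add: odo_T_eq)
    thus ?thesis using m odo_r(2)[OF xX] by (intro exI[of _ m]) simp
  qed
  thus ?thesis using odo_r(3)[OF xX] by (simp add: odo_Y0_def)
qed

lemma odo_t_decode:
  assumes xy: "x \<in> odo_Y" "y \<in> odo_Y"
  shows "odo_t m x = odo_t m y \<Longrightarrow> odo_P x m = odo_P y m"
proof (induction m)
  case 0 show ?case by (simp add: odo_P_def)
next
  case (Suc m)
  note p = odo.ptD[OF odo_pt[OF xy(1)], of m] and p' = odo.ptD[OF odo_pt[OF xy(2)], of m]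
  have "int (odo_D x m) = int (odo_D y m) \<and> odo_t m x = odo_t m y"
    using odo.blk_decode[OF p(2) p'(2) p(1) p'(1) p(4) p'(4)] Suc(2) by simp
  thus ?case using Suc.IH by (simp add: odo_P_Suc)
qed

lemma odo_t_separates:
  assumes "x \<in> odo_Y" "y \<in> odo_Y" "\<And>l. odo_t l x = odo_t l y" shows "x = y"
  using odo_P_inj[of x y] odo_t_decode[OF assms(1,2)] assms odo_Y_X by blast

text \<open>Go back four steps under \<open>odo_S\<close> and take the last point of
  \<open>odo_Y\<close> before \<open>y\<close>; by \<open>odo_return\<close> there is one.\<close>

lemma odo_T_surj: assumes y: "y \<in> odo_Y0" shows "\<exists>x\<in>odo_Y0. odo_T x = y"
proof -
  have yX: "y \<in> odo_X" and yY: "y \<in> odo_Y" using y odo_Y_X by (auto simp: odo_Y0_def)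
  have "\<exists>x\<in>odo_X. (odo_S ^^ n) x = y" for n
  proof (induction n)
    case (Suc n)
    then obtain x where x: "x \<in> odo_X" "(odo_S ^^ n) x = y" by blast
    obtain x' where "x' \<in> odo_X" "odo_S x' = x" using odo_S_surj[OF x(1)] by blast
    thus ?case using x by (intro bexI[of _ x']) (auto simp: funpow_swap1)
  qed (use yX in auto)
  then obtain z where z: "z \<in> odo_X" "(odo_S ^^ 4) z = y" by blast
  define G where "G = {i. i \<le> 3 \<and> (odo_S ^^ i) z \<in> odo_Y}"
  have "finite G" by (rule finite_subset[of _ "{..3}"]) (auto simp: G_def)
  moreover have "G \<noteq> {}" using odo_return[OF z(1)] by (auto simp: G_def)
  ultimately have mG: "Max G \<in> G" "\<And>i. i \<in> G \<Longrightarrow> i \<le> Max G" by auto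
  define i where "i = Max G"
  have i: "i \<le> 3" "(odo_S ^^ i) z \<in> odo_Y" using mG(1) by (auto simp: i_def G_def)
  define x where "x = (odo_S ^^ i) z"
  have pw: "(odo_S ^^ j) x = (odo_S ^^ (j + i)) z" for j by (simp add: x_def funpow_add)
  have r: "odo_r x = 4 - i"
  proof (rule odo_r_eqI)
    show "(odo_S ^^ (4 - i)) x \<in> odo_Y" using i yY z by (simp add: pw)
    fix j assume j: "1 \<le> j" "j < 4 - i"
    have "j + i \<notin> G" using mG(2)[of "j + i"] j by (auto simp: i_def)
    thus "(odo_S ^^ j) x \<notin> odo_Y" using j unfolding pw by (auto simp: G_def)
  qed (use i in simp)
  have Tx: "odo_T x = y" unfolding odo_T_eq r pw using i z by simp
  have xY: "x \<in> odo_Y" using i by (simp add: x_def)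
  have "\<exists>m. K < odo_P x m \<and> odo_P x m + K < odo_q m" for K
  proof -
    obtain m where m: "K + 4 < odo_P y m" "odo_P y m + (K + 4) < odo_q m" using y unfolding odo_Y0_def by blast
    have e: "odo_P y m = (odo_P x m + (4 - i)) mod odo_q m"
      using odo_P_S_pow[OF odo_Y_X[OF xY], of "4 - i" m] Tx by (simp add: odo_T_eq r)
    have "odo_P x m + (4 - i) < odo_q m"
    proof (rule ccontr)
      assume a: "\<not> ?thesis"
      have "(odo_P x m + (4 - i)) mod odo_q m = (odo_P x m + (4 - i) - odo_q m) mod odo_q m" using a by (simp add: le_mod_geq)
      also have "\<dots> \<le> odo_P x m + (4 - i) - odo_q m" by (rule mod_less_eq_dividend)
      also have "\<dots> \<le> 4" using odo_P_less[of x m] by simp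
      finally show False using e m by simp
    qed
    thus ?thesis using e m by (intro exI[of _ m]) simp
  qed
  hence "x \<in> odo_Y0" using xY by (simp add: odo_Y0_def)
  thus ?thesis using Tx by blast
qed

lemma odo_T_bij: "bij_betw odo_T odo_Y0 odo_Y0"
proof (rule bij_betw_imageI)
  show "inj_on odo_T odo_Y0"
  proof (rule inj_onI)
    fix x y assume xy: "x \<in> odo_Y0" "y \<in> odo_Y0" "odo_T x = odo_T y"
    have Y: "x \<in> odo_Y" "y \<in> odo_Y" using xy by (auto simp: odo_Y0_def)
    have "eventually (\<lambda>m. odo_t m x = odo_t m y) sequentially"
      using odo_T_t[OF xy(1)] odo_T_t[OF xy(2)] by eventually_elim (simp add: xy(3))
    hence "odo_t l x = odo_t l y" for l
    proof -
      assume "eventually (\<lambda>m. odo_t m x = odo_t m y) sequentially"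
      hence "eventually (\<lambda>m. odo_t m x = odo_t m y \<and> l \<le> m) sequentially"
        using eventually_ge_at_top[of l] by eventually_elim simp
      then obtain m where m: "odo_t m x = odo_t m y" "l \<le> m" using eventually_happens'[OF sequentially_bot] by blast
      show ?thesis using odo.pt_decode[OF odo_pt[OF Y(2)] odo_pt[OF Y(1)] m] .
    qed
    thus "x = y" by (rule odo_t_separates[OF Y])
  qed
  show "odo_T ` odo_Y0 = odo_Y0" using odo_T_Y0 odo_T_surj by (auto simp: image_iff)
qed

section \<open>From a single map to an action of the integers\<close>

lemma measurable_factor_count:
  assumes k: "k \<in> measurable M (count_space UNIV)"
    and f: "\<And>x y. x \<in> space M \<Longrightarrow> y \<in> space M \<Longrightarrow> k x = k y \<Longrightarrow> f x = f y"
  shows "f \<in> measurable M (count_space UNIV)"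
proof (rule measurableI)
  fix A
  have "f -` A \<inter> space M = k -` (k ` (f -` A \<inter> space M)) \<inter> space M"
  proof (intro set_eqI iffI)
    fix x assume "x \<in> k -` (k ` (f -` A \<inter> space M)) \<inter> space M"
    then obtain y where "x \<in> space M" "y \<in> space M" "f y \<in> A" "k x = k y" by auto
    thus "x \<in> f -` A \<inter> space M" using f[of x y] by simp
  qed auto
  thus "f -` A \<inter> space M \<in> sets M" using measurable_sets[OF k, of "k ` (f -` A \<inter> space M)"] by simp
qed simp

locale tower_map = tower_shape A Sh + prob_space M
  for A Sh and M :: "'a measure" +
  fixes t D :: "nat \<Rightarrow> 'a \<Rightarrow> int" and T :: "'a \<Rightarrow> 'a"
  assumes pt_tD: "x \<in> space M \<Longrightarrow> pt (\<lambda>l. t l x) (\<lambda>l. D l x)"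
    and t_meas [measurable]: "t l \<in> measurable M (count_space UNIV)"
    and D_meas [measurable]: "D l \<in> measurable M (count_space UNIV)"
    and t_separates: "x \<in> space M \<Longrightarrow> y \<in> space M \<Longrightarrow> (\<And>l. t l x = t l y) \<Longrightarrow> x = y"
    and T_surj: "T ` space M = space M"
    and T_meas [measurable]: "T \<in> measurable M M"
    and T_distr: "distr M M T = M"
    and T_t: "x \<in> space M \<Longrightarrow> eventually (\<lambda>m. t m (T x) = t m x + 1) sequentially"
    and gen: "sets M = sigma_sets (space M) {{x \<in> space M. t l x = v} | l v. True}"
begin

text \<open>Powers of \<open>T\<close> of either sign, described through heights rather than through
  an inverse map, so that measurability is inherited from the heights.\<close>

definition TT :: "int \<Rightarrow> 'a \<Rightarrow> 'a" where
  "TT z x = (THE y. y \<in> space M \<and> eventually (\<lambda>m. t m y = t m x + z) sequentially)"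

lemma translate_unique:
  assumes "y \<in> space M" "y' \<in> space M" "eventually (\<lambda>m. t m y = t m x + z) sequentially" "eventually (\<lambda>m. t m y' = t m x + z) sequentially"
  shows "y = y'"
proof (rule t_separates[OF assms(1,2)])
  fix l
  have "eventually (\<lambda>m. t m y = t m y' \<and> l \<le> m) sequentially"
    using assms(3,4) eventually_ge_at_top[of l] by eventually_elim simp
  then obtain m where m: "t m y = t m y'" "l \<le> m" using eventually_happens'[OF sequentially_bot] by blast
  show "t l y = t l y'" by (rule pt_decode[OF pt_tD[OF assms(2)] pt_tD[OF assms(1)] m])
qed

lemma translate_exists:
  assumes "x \<in> space M" shows "\<exists>y\<in>space M. eventually (\<lambda>m. t m y = t m x + z) sequentially"
proof (induction z rule: int_induct[where k = 0])
  case base show ?case using assms by (intro bexI[of _ x]) auto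
next
  case (step1 i)
  then obtain y where y: "y \<in> space M" "eventually (\<lambda>m. t m y = t m x + i) sequentially" by blast
  have "eventually (\<lambda>m. t m (T y) = t m x + (i + 1)) sequentially"
    using y(2) T_t[OF y(1)] by eventually_elim simp
  thus ?case using measurable_space[OF T_meas y(1)] by blast
next
  case (step2 i)
  then obtain y where y: "y \<in> space M" "eventually (\<lambda>m. t m y = t m x + i) sequentially" by blast
  obtain y' where y': "y' \<in> space M" "T y' = y" using y(1) T_surj by (metis imageE)
  have "eventually (\<lambda>m. t m y' = t m x + (i - 1)) sequentially"
    using y(2) T_t[OF y'(1)] unfolding y'(2) by eventually_elim simp
  thus ?case using y'(1) by blast
qed

lemma TT_spec:
  assumes "x \<in> space M" shows "TT z x \<in> space M \<and> eventually (\<lambda>m. t m (TT z x) = t m x + z) sequentially"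
  unfolding TT_def by (rule theI') (use translate_exists[OF assms, of z] translate_unique in blast)

lemma TT_eqI: "x \<in> space M \<Longrightarrow> y \<in> space M \<Longrightarrow> eventually (\<lambda>m. t m y = t m x + z) sequentially \<Longrightarrow> TT z x = y"
  using translate_unique TT_spec by blast

lemma TT_meas: "TT z \<in> measurable M M"
proof -
  have "TT z \<in> measurable M (sigma (space M) {{x \<in> space M. t l x = v} | l v. True})"
  proof (rule measurable_measure_of)
    fix Y assume "Y \<in> {{x \<in> space M. t l x = v} | l v. True}"
    then obtain l v where Y: "Y = {x \<in> space M. t l x = v}" by blast
    \<comment> \<open>\<open>g m\<close> guesses \<open>t l (TT z x)\<close> from the height at
      level \<open>m\<close> alone. The guess is right for all large \<open>m\<close>, which turns
      the preimage into a countable limit.\<close>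
    define g where "g m x = (if \<exists>y\<in>space M. t m y = t m x + z then t l (SOME y. y \<in> space M \<and> t m y = t m x + z) else 0)" for m x
    have gm [measurable]: "g m \<in> measurable M (count_space UNIV)" for m
      by (rule measurable_factor_count[OF t_meas[of m]]) (simp add: g_def)
    have ge: "eventually (\<lambda>m. g m x = t l (TT z x)) sequentially" if x: "x \<in> space M" for x
    proof -
      have "eventually (\<lambda>m. t m (TT z x) = t m x + z \<and> l \<le> m) sequentially"
        using TT_spec[OF x, of z] eventually_ge_at_top[of l] by (auto intro: eventually_conj)
      thus ?thesis
      proof eventually_elim
        case (elim m)
        have ex: "\<exists>y. y \<in> space M \<and> t m y = t m x + z" using elim TT_spec[OF x] by blast
        define y where "y = (SOME y. y \<in> space M \<and> t m y = t m x + z)"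
        have y: "y \<in> space M" "t m y = t m x + z" using someI_ex[OF ex] by (auto simp: y_def)
        have "t l y = t l (TT z x)" using pt_decode[OF pt_tD[of "TT z x"] pt_tD[OF y(1)], of m l] y elim TT_spec[OF x, of z] by simp
        thus ?case using ex by (auto simp: g_def y_def)
      qed
    qed
    have "TT z -` Y \<inter> space M = {x \<in> space M. eventually (\<lambda>m. g m x = v) sequentially}"
    proof (intro set_eqI iffI)
      fix x assume "x \<in> TT z -` Y \<inter> space M"
      hence "x \<in> space M" "t l (TT z x) = v" by (auto simp: Y)
      thus "x \<in> {x \<in> space M. eventually (\<lambda>m. g m x = v) sequentially}" using ge[of x] by simp
    next
      fix x assume a: "x \<in> {x \<in> space M. eventually (\<lambda>m. g m x = v) sequentially}"
      hence x: "x \<in> space M" by simp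
      have "eventually (\<lambda>m. g m x = v) sequentially" using a by simp
      with ge[OF x] have "eventually (\<lambda>m. t l (TT z x) = v) sequentially" by eventually_elim simp
      thus "x \<in> TT z -` Y \<inter> space M" using x TT_spec[OF x, of z] by (simp add: Y)
    qed
    also have "\<dots> \<in> sets M" unfolding eventually_sequentially by measurable
    finally show "TT z -` Y \<inter> space M \<in> sets M" .
  qed (use TT_spec in auto)
  moreover have "sets (sigma (space M) {{x \<in> space M. t l x = v} | l v. True}) = sets M"
    unfolding gen by (rule sets_measure_of) auto
  ultimately show ?thesis using measurable_cong_sets by blast
qed

lemma prob_T: "B \<in> sets M \<Longrightarrow> prob {x \<in> space M. T x \<in> B} = prob B"
proof -
  assume B: "B \<in> sets M"
  have "prob B = measure (distr M M T) B" by (simp add: T_distr)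
  also have "\<dots> = prob (T -` B \<inter> space M)" using B by (simp add: measure_distr)
  also have "T -` B \<inter> space M = {x \<in> space M. T x \<in> B}" by auto
  finally show ?thesis by simp
qed

lemma TT_0': "x \<in> space M \<Longrightarrow> TT 0 x = x"
  by (rule TT_eqI) auto

lemma TT_TT': 
  assumes x: "x \<in> space M" shows "TT z (TT w x) = TT (z + w) x"
proof (rule TT_eqI[OF _ _])
  show "eventually (\<lambda>m. t m (TT (z + w) x) = t m (TT w x) + z) sequentially"
    using conjunct2[OF TT_spec[OF x, of "z + w"]] conjunct2[OF TT_spec[OF x, of w]] by eventually_elim simp
qed (use TT_spec x in auto)

lemma TT_1: "x \<in> space M \<Longrightarrow> TT 1 x = T x"
  using T_t measurable_space[OF T_meas] by (intro TT_eqI) auto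

lemma prob_TT_nat: "B \<in> sets M \<Longrightarrow> prob {x \<in> space M. TT (int n) x \<in> B} = prob B"
proof (induction n arbitrary: B)
  case 0
  have "{x \<in> space M. TT (int 0) x \<in> B} = B" using sets.sets_into_space[OF 0] by (auto simp: TT_0')
  thus ?case by simp
next
  case (Suc n)
  have "{x \<in> space M. TT (int (Suc n)) x \<in> B} = {x \<in> space M. TT (int n) x \<in> {x \<in> space M. T x \<in> B}}"
    using TT_TT'[of _ 1 "int n"] TT_1 TT_spec by auto
  moreover have "{x \<in> space M. T x \<in> B} \<in> sets M" using Suc(2) by measurable
  ultimately show ?case using Suc.IH[of "{x \<in> space M. T x \<in> B}"] prob_T[OF Suc(2)] by simp
qed

lemma TT_distr: "distr M M (TT z) = M"
proof (rule measure_eqI)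
  fix B assume "B \<in> sets (distr M M (TT z))"
  hence B: "B \<in> sets M" by simp
  have m: "{x \<in> space M. TT z x \<in> B} \<in> sets M" using measurable_sets[OF TT_meas B, of z] by (simp add: vimage_def Int_def conj_commute)
  have "prob {x \<in> space M. TT z x \<in> B} = prob B"
  proof (cases "0 \<le> z")
    case True
    thus ?thesis using prob_TT_nat[OF B, of "nat z"] by simp
  next
    case False
    have "prob {x \<in> space M. TT z x \<in> B} = prob {x \<in> space M. TT (int (nat (- z))) x \<in> {x \<in> space M. TT z x \<in> B}}"
      by (rule prob_TT_nat[OF m, symmetric])
    also have "{x \<in> space M. TT (int (nat (- z))) x \<in> {x \<in> space M. TT z x \<in> B}} = B"
      using sets.sets_into_space[OF B] False TT_spec by (auto simp: TT_TT' TT_0')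
    finally show ?thesis .
  qed
  moreover have "TT z -` B \<inter> space M = {x \<in> space M. TT z x \<in> B}" by auto
  ultimately show "emeasure (distr M M (TT z)) B = emeasure M B"
    using B TT_meas by (simp add: emeasure_distr emeasure_eq_measure)
qed simp

sublocale tower A Sh M t D TT
  using pt_tD t_meas D_meas TT_meas TT_distr TT_TT' TT_0' TT_spec gen by unfold_locales auto

end

lemma measurable_count_pair:
  assumes f: "f \<in> measurable M (count_space (UNIV :: 'b::countable set))" and g: "g \<in> measurable M (count_space (UNIV :: 'c::countable set))"
  shows "(\<lambda>x. F (f x) (g x)) \<in> measurable M (count_space UNIV)"
proof -
  have "(\<lambda>x. F i (g x)) \<in> measurable M (count_space UNIV)" for i
    by (rule measurable_compose[OF g]) simp
  thus ?thesis using f by (rule measurable_compose_countable)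
qed

section \<open>The invariant measure of the odometer\<close>

lemma odo_cylinder_open: "openin odo_top {x \<in> odo_X. x i = c}"
proof (cases "1 \<le> i")
  case True
  have "continuous_map odo_top (discrete_topology {..<odo_a i}) (\<lambda>x. x i)"
    unfolding odo_top_def using True by (intro continuous_map_product_projection) auto
  moreover have "openin (discrete_topology {..<odo_a i}) ({c} \<inter> {..<odo_a i})" by simp
  ultimately have "openin odo_top {x \<in> topspace odo_top. x i \<in> {c} \<inter> {..<odo_a i}}"
    by (rule openin_continuous_map_preimage)
  moreover have "{x \<in> topspace odo_top. x i \<in> {c} \<inter> {..<odo_a i}} = {x \<in> odo_X. x i = c}"
    using True by (auto simp: odo_X_iff[unfolded odo_X_def] odo_X_def)
  ultimately show ?thesis by simp
next
  case False
  hence "x i = undefined" if "x \<in> odo_X" for x using that by (simp add: odo_X_iff extensional_def)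
  hence "{x \<in> odo_X. x i = c} = (if c = undefined then odo_X else {})" by auto
  thus ?thesis by (simp add: odo_X_def)
qed

lemma odo_open_cylinder:
  assumes U: "openin odo_top U" and x: "x \<in> U"
  shows "\<exists>l. {y \<in> odo_X. odo_Q y l = odo_Q x l} \<subseteq> U"
proof -
  have xX: "x \<in> odo_X" using openin_subset[OF U] x by (auto simp: odo_X_def)
  obtain V where V: "finite {i \<in> {1..}. V i \<noteq> {..<odo_a i}}" "x \<in> PiE {1..} V" "PiE {1..} V \<subseteq> U"
    using U x unfolding odo_top_def openin_product_topology_alt by fastforce
  define l where "l = Max (insert 0 {i \<in> {1..}. V i \<noteq> {..<odo_a i}})"
  have l: "i \<le> l" if "1 \<le> i" "V i \<noteq> {..<odo_a i}" for i using V(1) that by (auto simp: l_def)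
  have Qdig: "y i = x i" if y: "y \<in> odo_X" "odo_Q y l = odo_Q x l" and i: "1 \<le> i" "i \<le> l" for y i
  proof -
    have "odo_Q y k = odo_Q x k" if "k \<le> l" for k using that
    proof (induction rule: inc_induct)
      case base show ?case by (rule y)
    next
      case (step n)
      thus ?case using odo_Q_Suc_mod_div(1)[OF xX, of n] odo_Q_Suc_mod_div(1)[OF y(1), of n] by simp
    qed
    moreover obtain k where "i = Suc k" using i by (cases i) auto
    ultimately show ?thesis using odo_Q_Suc_mod_div(2)[OF xX, of k] odo_Q_Suc_mod_div(2)[OF y(1), of k] i by simp
  qed
  have "y \<in> PiE {1..} V" if y: "y \<in> odo_X" "odo_Q y l = odo_Q x l" for y
  proof (rule PiE_I)
    fix i :: nat assume i: "i \<in> {1..}"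
    show "y i \<in> V i"
    proof (cases "V i = {..<odo_a i}")
      case True thus ?thesis using y(1) i by (simp add: odo_X_iff)
    next
      case False
      hence "y i = x i" using Qdig[OF y] l[of i] i by simp
      thus ?thesis using V(2) i by (auto simp: PiE_iff)
    qed
  next
    fix i :: nat assume "i \<notin> {1..}"
    thus "y i = undefined" using y(1) by (simp add: odo_X_iff extensional_def)
  qed
  thus ?thesis using V(3) by blast
qed

locale odometer =
  fixes \<mu> :: "(nat \<Rightarrow> nat) measure"
  assumes inv: "invariant_odometer_measure \<mu>"
begin

lemma sets_mu: "sets \<mu> = sigma_sets odo_X {U. openin odo_top U}"
proof -
  have "{U. openin odo_top U} \<subseteq> Pow odo_X" using openin_subset by (auto simp: odo_X_def)
  thus ?thesis using inv by (simp add: invariant_odometer_measure_def borel_of_top_def odo_X_def sets_measure_of)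
qed

lemma space_mu [simp]: "space \<mu> = odo_X"
proof -
  have "sets \<mu> = sets (borel_of_top odo_top)" using inv by (simp add: invariant_odometer_measure_def)
  hence "space \<mu> = space (borel_of_top odo_top)" by (rule sets_eq_imp_space_eq)
  thus ?thesis by (simp add: borel_of_top_def odo_X_def space_measure_of_conv)
qed

sublocale prob_space \<mu>
  using inv by (simp add: invariant_odometer_measure_def)

lemma S_meas [measurable]: "odo_S \<in> measurable \<mu> \<mu>" and S_distr: "distr \<mu> \<mu> odo_S = \<mu>"
  using inv by (auto simp: invariant_odometer_measure_def measure_preserving_on_def)

lemma coord_meas [measurable]: "(\<lambda>x. x i) \<in> measurable \<mu> (count_space UNIV)"
proof (subst measurable_count_space_eq_countable)
  show "(\<lambda>x. x i) \<in> space \<mu> \<rightarrow> UNIV \<and> (\<forall>a\<in>UNIV. (\<lambda>x. x i) -` {a} \<inter> space \<mu> \<in> sets \<mu>)"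
  proof safe
    fix a
    have "(\<lambda>x. x i) -` {a} \<inter> space \<mu> = {x \<in> odo_X. x i = a}" by auto
    also have "\<dots> \<in> sets \<mu>" unfolding sets_mu using odo_cylinder_open by (intro sigma_sets.Basic) simp
    finally show "(\<lambda>x. x i) -` {a} \<inter> space \<mu> \<in> sets \<mu>" .
  qed simp
qed simp

lemma Q_meas [measurable]: "(\<lambda>x. odo_Q x l) \<in> measurable \<mu> (count_space UNIV)"
proof (induction l)
  case (Suc l)
  show ?case unfolding odo_Q_Suc using measurable_count_pair[OF Suc coord_meas[of "Suc l"], of "\<lambda>a b. a + b * odo_q l"] .
qed simp

lemma P_meas [measurable]: "(\<lambda>x. odo_P x l) \<in> measurable \<mu> (count_space UNIV)"
  unfolding odo_P_def by (rule measurable_compose[OF Q_meas]) simp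

lemma D_meas [measurable]: "(\<lambda>x. odo_D x l) \<in> measurable \<mu> (count_space UNIV)"
  unfolding odo_D_def by (rule measurable_compose[OF P_meas]) simp

lemma t_meas [measurable]: "(\<lambda>x. odo_t l x) \<in> measurable \<mu> (count_space UNIV)"
proof (induction l)
  case (Suc l)
  show ?case using measurable_count_pair[OF D_meas[of l] Suc, of "\<lambda>a b. odo.blk l (int a) + b"] by simp
qed simp

lemma gen_mu: "sets \<mu> = sigma_sets odo_X {{x \<in> odo_X. odo_Q x l = v} | l v. True}"
proof
  show "sets \<mu> \<subseteq> sigma_sets odo_X {{x \<in> odo_X. odo_Q x l = v} | l v. True}"
    unfolding sets_mu
  proof (rule sigma_sets_mono, rule subsetI)
    fix U assume "U \<in> {U. openin odo_top U}"
    hence U: "openin odo_top U" by simp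
    define C where "C = {(l, v). {x \<in> odo_X. odo_Q x l = v} \<subseteq> U}"
    have "U = (\<Union>(l, v)\<in>C. {x \<in> odo_X. odo_Q x l = v})"
    proof
      show "U \<subseteq> (\<Union>(l, v)\<in>C. {x \<in> odo_X. odo_Q x l = v})"
      proof
        fix x assume x: "x \<in> U"
        then obtain l where "{y \<in> odo_X. odo_Q y l = odo_Q x l} \<subseteq> U" using odo_open_cylinder[OF U] by blast
        moreover have "x \<in> odo_X" using openin_subset[OF U] x by (auto simp: odo_X_def)
        ultimately show "x \<in> (\<Union>(l, v)\<in>C. {x \<in> odo_X. odo_Q x l = v})" by (auto simp: C_def)
      qed
    qed (auto simp: C_def)
    also have "\<dots> \<in> sigma_sets odo_X {{x \<in> odo_X. odo_Q x l = v} | l v. True}"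
      by (intro sigma_sets_UNION countable_image) auto
    finally show "U \<in> sigma_sets odo_X {{x \<in> odo_X. odo_Q x l = v} | l v. True}" .
  qed
  have "{x \<in> odo_X. odo_Q x l = v} \<in> sets \<mu>" for l v
    using measurable_sets[OF Q_meas[of l], of "{v}"] by (simp add: vimage_def Int_def conj_commute)
  thus "sigma_sets odo_X {{x \<in> odo_X. odo_Q x l = v} | l v. True} \<subseteq> sets \<mu>"
    using sets.sigma_sets_subset[of "{{x \<in> odo_X. odo_Q x l = v} | l v. True}" \<mu>] by auto
qed

lemma X_sets [measurable]: "odo_X \<in> sets \<mu>"
  using sets.top[of \<mu>] by simp

lemma pred_P [measurable]: "{x \<in> odo_X. Pr (odo_P x l)} \<in> sets \<mu>"
  using measurable_sets[OF P_meas[of l], of "{v. Pr v}"] by (simp add: vimage_def Int_def conj_commute)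

lemma Y_sets [measurable]: "odo_Y \<in> sets \<mu>"
proof -
  have e: "odo_Y = odo_X - (\<Union>l. {x \<in> odo_X. odo_rem x l})" using odo_Y_iff by auto
  have "{x \<in> odo_X. odo_rem x l} \<in> sets \<mu>" for l
    unfolding odo_rem_def odo_P_Suc_mod[symmetric, of _ l] odo_D_def by (rule pred_P)
  hence "(\<Union>l. {x \<in> odo_X. odo_rem x l}) \<in> sets \<mu>" by (intro sets.countable_UN) auto
  hence "odo_X - (\<Union>l. {x \<in> odo_X. odo_rem x l}) \<in> sets \<mu>" by (rule sets.Diff[OF X_sets])
  thus ?thesis by (subst e)
qed

lemma Y0_sets [measurable]: "odo_Y0 \<in> sets \<mu>"
proof -
  have e: "odo_Y0 = odo_Y \<inter> (\<Inter>K. \<Union>m. {x \<in> odo_X. K < odo_P x m \<and> odo_P x m + K < odo_q m})"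
    using odo_Y_X by (auto simp: odo_Y0_def)
  have "(\<Inter>K. \<Union>m. {x \<in> odo_X. K < odo_P x m \<and> odo_P x m + K < odo_q m}) \<in> sets \<mu>"
    using pred_P by (intro sets.countable_INT sets.countable_UN image_subsetI) auto
  thus ?thesis by (subst e) (rule sets.Int[OF Y_sets])
qed

definition s1 :: "(nat \<Rightarrow> nat) set \<Rightarrow> (nat \<Rightarrow> nat) set" where "s1 B = {x \<in> odo_X. odo_S x \<in> B}"

lemma s1_sets [measurable]: "B \<in> sets \<mu> \<Longrightarrow> s1 B \<in> sets \<mu>"
  using measurable_sets[OF S_meas, of B] by (simp add: s1_def vimage_def Int_def conj_commute)

lemma prob_s1: "B \<in> sets \<mu> \<Longrightarrow> prob (s1 B) = prob B"
proof -
  assume B: "B \<in> sets \<mu>"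
  have "prob B = measure (distr \<mu> \<mu> odo_S) B" by (simp add: S_distr)
  also have "\<dots> = prob (odo_S -` B \<inter> space \<mu>)" using B by (simp add: measure_distr)
  also have "odo_S -` B \<inter> space \<mu> = s1 B" by (auto simp: s1_def)
  finally show ?thesis by simp
qed

text \<open>\<open>odo_S\<close> permutes the residues cyclically, so by invariance all are equally
  likely.\<close>

lemma prob_P: assumes "p < odo_q m" shows "prob {x \<in> odo_X. odo_P x m = p} = 1 / odo_q m"
proof -
  have c: "prob {x \<in> odo_X. odo_P x m = p} = prob {x \<in> odo_X. odo_P x m = 0}" if "p < odo_q m" for p
    using that
  proof (induction p)
    case (Suc p)
    have "s1 {x \<in> odo_X. odo_P x m = Suc p} = {x \<in> odo_X. odo_P x m = p}"
    proof (intro set_eqI iffI)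
      fix x assume "x \<in> s1 {x \<in> odo_X. odo_P x m = Suc p}"
      hence x: "x \<in> odo_X" "(odo_P x m + 1) mod odo_q m = Suc p" by (auto simp: s1_def odo_P_S)
      have "odo_P x m + 1 \<noteq> odo_q m" using x(2) by auto
      hence "odo_P x m + 1 < odo_q m" using odo_P_less[of x m] by simp
      thus "x \<in> {x \<in> odo_X. odo_P x m = p}" using x by simp
    qed (use Suc.prems in \<open>auto simp: s1_def odo_P_S odo_S_X\<close>)
    thus ?case using prob_s1[OF pred_P[of "\<lambda>v. v = Suc p" m]] Suc by simp
  qed simp
  have "(\<Union>p<odo_q m. {x \<in> odo_X. odo_P x m = p}) = space \<mu>" using odo_P_less by auto
  moreover have "prob (\<Union>p<odo_q m. {x \<in> odo_X. odo_P x m = p}) = (\<Sum>p<odo_q m. prob {x \<in> odo_X. odo_P x m = p})"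
    using pred_P by (intro finite_measure_finite_Union) (auto simp: disjoint_family_on_def)
  ultimately have "(\<Sum>p<odo_q m. prob {x \<in> odo_X. odo_P x m = p}) = 1" using prob_space by simp
  moreover have "(\<Sum>p<odo_q m. prob {x \<in> odo_X. odo_P x m = p}) = (\<Sum>p<odo_q m. prob {x \<in> odo_X. odo_P x m = 0})"
    by (intro sum.cong refl c) simp
  ultimately have "odo_q m * prob {x \<in> odo_X. odo_P x m = 0} = 1" by simp
  thus ?thesis using c[OF assms] odo_q_pos[of m] by (simp add: field_simps)
qed

lemma prob_P_set_le: assumes "finite V" shows "prob {x \<in> odo_X. odo_P x m \<in> V} \<le> card V / odo_q m"
proof -
  have "{x \<in> odo_X. odo_P x m \<in> V} = (\<Union>p\<in>V. {x \<in> odo_X. odo_P x m = p})" by auto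
  hence "prob {x \<in> odo_X. odo_P x m \<in> V} \<le> (\<Sum>p\<in>V. prob {x \<in> odo_X. odo_P x m = p})"
    using assms pred_P by (simp only:) (intro finite_measure_subadditive_finite, auto)
  also have "\<dots> \<le> (\<Sum>p\<in>V. 1 / odo_q m)"
  proof (rule sum_mono)
    fix p
    show "prob {x \<in> odo_X. odo_P x m = p} \<le> 1 / odo_q m"
    proof (cases "p < odo_q m")
      case False
      hence "{x \<in> odo_X. odo_P x m = p} = {}" using odo_P_less by auto
      thus ?thesis by (simp only: measure_empty) simp
    qed (simp add: prob_P)
  qed
  finally show ?thesis by simp
qed

lemma Y0_conull: "prob (odo_Y - odo_Y0) = 0"
proof -
  define N where "N K = {x \<in> odo_X. \<forall>m. \<not> (K < odo_P x m \<and> odo_P x m + K < odo_q m)}" for K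
  have NI: "N K = (\<Inter>m. {x \<in> odo_X. \<not> (K < odo_P x m \<and> odo_P x m + K < odo_q m)})" for K by (auto simp: N_def)
  have Nm: "N K \<in> sets \<mu>" for K unfolding NI using pred_P by (intro sets.countable_INT) auto
  have N0: "prob (N K) = 0" for K
  proof -
    have le: "prob (N K) \<le> (2 * real K + 2) / odo_q m" for m
    proof -
      have "N K \<subseteq> {x \<in> odo_X. odo_P x m \<in> {..K} \<union> {odo_q m - K..<odo_q m}}"
      proof
        fix x assume "x \<in> N K"
        hence "x \<in> odo_X" "\<not> (K < odo_P x m \<and> odo_P x m + K < odo_q m)" by (auto simp: N_def)
        thus "x \<in> {x \<in> odo_X. odo_P x m \<in> {..K} \<union> {odo_q m - K..<odo_q m}}" using odo_P_less[of x m] by auto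
      qed
      hence "prob (N K) \<le> prob {x \<in> odo_X. odo_P x m \<in> {..K} \<union> {odo_q m - K..<odo_q m}}"
        using pred_P by (intro finite_measure_mono) auto
      also have "\<dots> \<le> card ({..K} \<union> {odo_q m - K..<odo_q m}) / odo_q m" by (rule prob_P_set_le) simp
      also have "\<dots> \<le> (2 * real K + 2) / odo_q m"
      proof (rule divide_right_mono)
        have "card ({..K} \<union> {odo_q m - K..<odo_q m}) \<le> card {..K} + card {odo_q m - K..<odo_q m}" by (rule card_Un_le)
        also have "\<dots> \<le> 2 * K + 2" by simp
        finally show "real (card ({..K} \<union> {odo_q m - K..<odo_q m})) \<le> 2 * real K + 2" by linarith
      qed simp
      finally show ?thesis .
    qed
    have "(\<lambda>m. (2 * real K + 2) / real m) \<longlonglongrightarrow> 0" by (rule lim_const_over_n)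
    moreover have "\<forall>m\<ge>1. prob (N K) \<le> (2 * real K + 2) / real m"
    proof (intro allI impI)
      fix m :: nat assume "1 \<le> m"
      hence "(2 * real K + 2) / odo_q m \<le> (2 * real K + 2) / real m"
        using odo_q_ge_self[of m] by (intro divide_left_mono) auto
      thus "prob (N K) \<le> (2 * real K + 2) / real m" using le[of m] by linarith
    qed
    ultimately have "prob (N K) \<le> 0" by (rule LIMSEQ_le_const[OF _ exI])
    thus ?thesis using measure_nonneg[of \<mu> "N K"] by linarith
  qed
  have "prob (\<Union>K. N K) = 0"
    using Nm N0 by (intro measure_eq_0_null_sets null_sets_UN null_setsI) (auto simp: emeasure_eq_measure)
  moreover have "prob (odo_Y - odo_Y0) \<le> prob (\<Union>K. N K)"
    using Nm odo_Y_X by (intro finite_measure_mono) (auto simp: odo_Y0_def N_def)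
  ultimately show ?thesis using measure_nonneg[of \<mu> "odo_Y - odo_Y0"] by linarith
qed

lemma prob_Y_pos: "0 < prob odo_Y"
proof -
  have "{x \<in> odo_X. odo_P x (Suc 0) = 1} \<subseteq> odo_Y" using odo_Y_if_P1 by auto
  hence "prob {x \<in> odo_X. odo_P x (Suc 0) = 1} \<le> prob odo_Y" by (intro finite_measure_mono) auto
  thus ?thesis using prob_P[of 1 "Suc 0"] by (simp add: odo_q_1)
qed

text \<open>Points outside \<open>odo_Y\<close> have residue 7 or 0 modulo 8, and three consecutive
  residues cannot all be of this kind.\<close>

lemma no_three: assumes "x \<in> odo_X" "x \<notin> odo_Y" "odo_S x \<notin> odo_Y" shows "odo_S (odo_S x) \<in> odo_Y"
proof (rule ccontr)
  assume n: "odo_S (odo_S x) \<notin> odo_Y"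
  define p where "p = odo_P x (Suc 0)"
  have p8: "p < 8" using odo_P_less[of x "Suc 0"] by (simp add: p_def odo_q_1)
  have P: "odo_P x (Suc 0) = p" "odo_P (odo_S x) (Suc 0) = (p + 1) mod 8" "odo_P (odo_S (odo_S x)) (Suc 0) = ((p + 1) mod 8 + 1) mod 8"
    using odo_P_S[OF assms(1), of "Suc 0"] odo_P_S[OF odo_S_X[OF assms(1)], of "Suc 0"] by (simp_all add: p_def odo_q_1)
  have "p = 0 \<or> 7 \<le> p" "(p + 1) mod 8 = 0 \<or> 7 \<le> (p + 1) mod 8" "((p + 1) mod 8 + 1) mod 8 = 0 \<or> 7 \<le> ((p + 1) mod 8 + 1) mod 8"
    using odo_Y_if_P1[OF assms(1)] odo_Y_if_P1[OF odo_S_X[OF assms(1)]] odo_Y_if_P1[OF odo_S_X[OF odo_S_X[OF assms(1)]]] assms n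
    unfolding P by linarith+
  thus False using p8 by presburger
qed

lemma T_cases:
  assumes x: "x \<in> odo_X"
  shows "odo_T x = (if odo_S x \<in> odo_Y then odo_S x else if odo_S (odo_S x) \<in> odo_Y then odo_S (odo_S x) else odo_S (odo_S (odo_S x)))"
proof -
  have r: "odo_r x = 1 \<or> odo_r x = 2 \<or> odo_r x = 3" using odo_r(1,2)[OF x] by linarith
  have T: "(odo_S ^^ odo_r x) x \<in> odo_Y" using odo_r(3)[OF x] by (simp add: odo_T_eq)
  note nr = odo_r(4)[OF x, of 1] odo_r(4)[OF x, of 2]
  from r show ?thesis
  proof (elim disjE)
    assume "odo_r x = 1" thus ?thesis using T by (simp add: odo_T_eq)
  next
    assume "odo_r x = 2" thus ?thesis using T nr by (simp add: odo_T_eq numeral_2_eq_2)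
  next
    assume "odo_r x = 3" thus ?thesis using T nr by (simp add: odo_T_eq numeral_2_eq_2 numeral_3_eq_3)
  qed
qed

text \<open>The mass of \<open>B\<close> is followed backwards under \<open>odo_S\<close>: at each
  stage the part inside \<open>odo_Y\<close> is kept and the part outside is pulled back again. By
  \<open>no_three\<close> nothing is left outside after the third stage, and the kept parts are
  disjoint.\<close>

lemma T_preimage:
  assumes B: "B \<in> sets \<mu>" "B \<subseteq> odo_Y"
  shows "{x \<in> odo_Y. odo_T x \<in> B} \<in> sets \<mu>" "prob {x \<in> odo_Y. odo_T x \<in> B} = prob B"
proof -
  define C where "C = odo_X - odo_Y"
  define B1 where "B1 = s1 B"
  define B2 where "B2 = s1 (C \<inter> B1)"
  define B3 where "B3 = s1 (C \<inter> B2)"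
  have Cm: "C \<in> sets \<mu>" by (auto simp: C_def)
  have m: "B1 \<in> sets \<mu>" "B2 \<in> sets \<mu>" "B3 \<in> sets \<mu>" using B Cm unfolding B1_def B2_def B3_def by (auto intro!: s1_sets sets.Int)
  have eq: "{x \<in> odo_Y. odo_T x \<in> B} = (odo_Y \<inter> B1) \<union> ((odo_Y \<inter> B2) \<union> (odo_Y \<inter> B3))"
  proof (intro set_eqI iffI)
    fix x assume "x \<in> {x \<in> odo_Y. odo_T x \<in> B}"
    hence x: "x \<in> odo_Y" "x \<in> odo_X" "odo_T x \<in> B" using odo_Y_X by auto
    thus "x \<in> (odo_Y \<inter> B1) \<union> ((odo_Y \<inter> B2) \<union> (odo_Y \<inter> B3))"
      using T_cases[OF x(2)] odo_S_X by (auto simp: B1_def B2_def B3_def s1_def C_def split: if_splits)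
  next
    fix x assume "x \<in> (odo_Y \<inter> B1) \<union> ((odo_Y \<inter> B2) \<union> (odo_Y \<inter> B3))"
    hence x: "x \<in> odo_Y" "x \<in> odo_X" "x \<in> B1 \<or> x \<in> B2 \<or> x \<in> B3" using odo_Y_X by auto
    thus "x \<in> {x \<in> odo_Y. odo_T x \<in> B}"
      using T_cases[OF x(2)] B(2) by (auto simp: B1_def B2_def B3_def s1_def C_def)
  qed
  show "{x \<in> odo_Y. odo_T x \<in> B} \<in> sets \<mu>" unfolding eq using m by auto
  have split: "prob A = prob (odo_Y \<inter> A) + prob (C \<inter> A)" if A: "A \<in> sets \<mu>" for A
  proof -
    have "A = (odo_Y \<inter> A) \<union> (C \<inter> A)" using sets.sets_into_space[OF A] by (auto simp: C_def)
    moreover have "prob ((odo_Y \<inter> A) \<union> (C \<inter> A)) = prob (odo_Y \<inter> A) + prob (C \<inter> A)"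
      using A Cm by (intro finite_measure_Union) (auto simp: C_def)
    ultimately show ?thesis by simp
  qed
  have "C \<inter> B3 = {}" using no_three B(2) by (auto simp: C_def B1_def B2_def B3_def s1_def)
  hence "prob (C \<inter> B3) = 0" by simp
  moreover have "prob B = prob B1" using prob_s1[OF B(1)] by (simp add: B1_def)
  moreover have "prob (C \<inter> B1) = prob B2" unfolding B2_def using Cm m by (intro prob_s1[symmetric]) auto
  moreover have "prob (C \<inter> B2) = prob B3" unfolding B3_def using Cm m by (intro prob_s1[symmetric]) auto
  ultimately have pB: "prob B = prob (odo_Y \<inter> B1) + (prob (odo_Y \<inter> B2) + prob (odo_Y \<inter> B3))"
    using split[OF m(1)] split[OF m(2)] split[OF m(3)] by linarith
  have d23: "(odo_Y \<inter> B2) \<inter> (odo_Y \<inter> B3) = {}" and d1: "(odo_Y \<inter> B1) \<inter> ((odo_Y \<inter> B2) \<union> (odo_Y \<inter> B3)) = {}"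
    using B(2) by (auto simp: B1_def B2_def B3_def s1_def C_def)
  have "prob ((odo_Y \<inter> B1) \<union> ((odo_Y \<inter> B2) \<union> (odo_Y \<inter> B3))) = prob (odo_Y \<inter> B1) + prob ((odo_Y \<inter> B2) \<union> (odo_Y \<inter> B3))"
    using m d1 by (intro finite_measure_Union) auto
  also have "prob ((odo_Y \<inter> B2) \<union> (odo_Y \<inter> B3)) = prob (odo_Y \<inter> B2) + prob (odo_Y \<inter> B3)"
    using m d23 by (intro finite_measure_Union) auto
  finally show "prob {x \<in> odo_Y. odo_T x \<in> B} = prob B" unfolding eq pB .
qed

section \<open>The induced system and its restriction to a conull set\<close>

abbreviation \<nu> :: "(nat \<Rightarrow> nat) measure" where "\<nu> \<equiv> normalized_restriction \<mu> odo_Y"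

lemma space_nu [simp]: "space \<nu> = odo_Y"
  using odo_Y_X by (auto simp: normalized_restriction_def space_scale_measure space_restrict_space)

lemma sets_nu: "A \<in> sets \<nu> \<longleftrightarrow> A \<in> sets \<mu> \<and> A \<subseteq> odo_Y"
  unfolding normalized_restriction_def sets_scale_measure
  by (subst sets_restrict_space_iff) (auto intro: sets.Int)

lemma emeasure_nu: assumes "A \<in> sets \<nu>" shows "emeasure \<nu> A = ennreal (prob A / prob odo_Y)"
proof -
  have "emeasure \<nu> A = inverse (emeasure \<mu> odo_Y) * emeasure \<mu> A"
    using assms sets_nu unfolding normalized_restriction_def emeasure_scale_measure
    by (subst emeasure_restrict_space) (auto intro: sets.Int)
  also have "\<dots> = ennreal (inverse (prob odo_Y)) * ennreal (prob A)"
    using prob_Y_pos by (simp add: emeasure_eq_measure inverse_ennreal)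
  also have "\<dots> = ennreal (prob A / prob odo_Y)"
    using prob_Y_pos by (simp add: ennreal_mult[symmetric] divide_inverse mult.commute)
  finally show ?thesis .
qed

lemma prob_space_nu: "prob_space \<nu>"
proof (rule prob_spaceI)
  have "odo_Y \<in> sets \<nu>" by (simp add: sets_nu)
  thus "emeasure \<nu> (space \<nu>) = 1" using emeasure_nu[of odo_Y] prob_Y_pos by simp
qed

text \<open>\<open>tower_map\<close> asks for surjectivity and for the growth of heights at every
  point, hence the restriction to \<open>odo_Y0\<close>.\<close>

definition M0 :: "(nat \<Rightarrow> nat) measure" where "M0 = restrict_space \<nu> odo_Y0"

lemma Y0_Y: "odo_Y0 \<subseteq> odo_Y" by (auto simp: odo_Y0_def)

lemma Y0_nu: "odo_Y0 \<in> sets \<nu>" using Y0_Y by (simp add: sets_nu)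

lemma space_M0 [simp]: "space M0 = odo_Y0"
  using Y0_Y by (auto simp: M0_def space_restrict_space)

lemma sets_M0: "A \<in> sets M0 \<longleftrightarrow> A \<in> sets \<mu> \<and> A \<subseteq> odo_Y0"
proof -
  have e: "odo_Y0 \<inter> space \<nu> = odo_Y0" using Y0_Y by auto
  show ?thesis unfolding M0_def using Y0_Y Y0_nu by (subst sets_restrict_space_iff) (auto simp: e sets_nu)
qed

lemma emeasure_M0: "A \<in> sets M0 \<Longrightarrow> emeasure M0 A = emeasure \<nu> A"
  unfolding M0_def using Y0_nu by (intro emeasure_restrict_space) (auto simp: sets_M0[unfolded M0_def] Int_absorb2[OF Y0_Y])

lemma emeasure_nu_Y0: "emeasure \<nu> (odo_Y - odo_Y0) = 0"
  using emeasure_nu[of "odo_Y - odo_Y0"] Y0_conull by (simp add: sets_nu sets.Diff)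

lemma emeasure_nu_Int: assumes "A \<in> sets \<nu>" shows "emeasure \<nu> (A \<inter> odo_Y0) = emeasure \<nu> A"
proof -
  have "AE x in \<nu>. x \<in> odo_Y0" using emeasure_nu_Y0 Y0_nu by (intro AE_I[of _ _ "odo_Y - odo_Y0"]) (auto simp: sets_nu)
  thus ?thesis using assms Y0_nu by (intro emeasure_eq_AE) (auto elim!: eventually_mono)
qed

lemma AE_M0_iff: "(AE x in M0. Pr x) \<longleftrightarrow> (AE x in \<nu>. Pr x)"
proof -
  have a: "AE x in \<nu>. x \<in> odo_Y0" using emeasure_nu_Y0 Y0_nu by (intro AE_I[of _ _ "odo_Y - odo_Y0"]) (auto simp: sets_nu)
  have "(AE x in M0. Pr x) \<longleftrightarrow> (AE x in \<nu>. x \<in> odo_Y0 \<longrightarrow> Pr x)"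
    unfolding M0_def using Y0_nu Y0_Y by (intro AE_restrict_space_iff) (simp add: Int_absorb2)
  also have "\<dots> \<longleftrightarrow> (AE x in \<nu>. Pr x)" using a by (auto elim: AE_mp)
  finally show ?thesis .
qed

lemma prob_space_M0: "prob_space M0"
proof (rule prob_spaceI)
  have "emeasure \<nu> (odo_Y \<inter> odo_Y0) = emeasure \<nu> odo_Y" by (rule emeasure_nu_Int) (simp add: sets_nu)
  hence "emeasure \<nu> odo_Y0 = 1" using prob_space.emeasure_space_1[OF prob_space_nu] Y0_Y by (simp add: Int_absorb1)
  thus "emeasure M0 (space M0) = 1" using emeasure_M0[of odo_Y0] by (simp add: sets_M0)
qed

lemma emeasure_T: assumes "B \<in> sets \<nu>" shows "{x \<in> odo_Y. odo_T x \<in> B} \<in> sets \<nu>" "emeasure \<nu> {x \<in> odo_Y. odo_T x \<in> B} = emeasure \<nu> B"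
proof -
  have B: "B \<in> sets \<mu>" "B \<subseteq> odo_Y" using assms by (auto simp: sets_nu)
  show 1: "{x \<in> odo_Y. odo_T x \<in> B} \<in> sets \<nu>" using T_preimage(1)[OF B] by (auto simp: sets_nu)
  show "emeasure \<nu> {x \<in> odo_Y. odo_T x \<in> B} = emeasure \<nu> B" using emeasure_nu[OF 1] emeasure_nu[OF assms] T_preimage(2)[OF B] by simp
qed

lemma T_meas_nu: "odo_T \<in> measurable \<nu> \<nu>"
proof (rule measurableI)
  fix x assume "x \<in> space \<nu>"
  thus "odo_T x \<in> space \<nu>" using odo_r(3) odo_Y_X by simp
next
  fix A assume "A \<in> sets \<nu>"
  moreover have "odo_T -` A \<inter> space \<nu> = {x \<in> odo_Y. odo_T x \<in> A}" by auto
  ultimately show "odo_T -` A \<inter> space \<nu> \<in> sets \<nu>" using emeasure_T(1) by simp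
qed

lemma T_vimage_M0: "odo_T -` B \<inter> odo_Y0 = {x \<in> odo_Y. odo_T x \<in> B} \<inter> odo_Y0"
  using Y0_Y by auto

lemma T_meas_M0: "odo_T \<in> measurable M0 M0"
proof (rule measurableI)
  fix x assume "x \<in> space M0"
  thus "odo_T x \<in> space M0" using odo_T_Y0 by simp
next
  fix A assume A: "A \<in> sets M0"
  hence "A \<in> sets \<nu>" using Y0_Y by (auto simp: sets_M0 sets_nu)
  hence "{x \<in> odo_Y. odo_T x \<in> A} \<inter> odo_Y0 \<in> sets \<mu>" using emeasure_T(1)[of A] by (auto simp: sets_nu)
  thus "odo_T -` A \<inter> space M0 \<in> sets M0" using T_vimage_M0[of A] by (simp add: sets_M0)
qed

lemma T_distr_M0: "distr M0 M0 odo_T = M0"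
proof (rule measure_eqI)
  fix B assume "B \<in> sets (distr M0 M0 odo_T)"
  hence B: "B \<in> sets M0" by simp
  hence Bn: "B \<in> sets \<nu>" using Y0_Y by (auto simp: sets_M0 sets_nu)
  have "emeasure (distr M0 M0 odo_T) B = emeasure M0 (odo_T -` B \<inter> space M0)" using B T_meas_M0 by (simp add: emeasure_distr)
  also have "\<dots> = emeasure \<nu> (odo_T -` B \<inter> space M0)" using measurable_sets[OF T_meas_M0 B] by (rule emeasure_M0)
  also have "\<dots> = emeasure \<nu> ({x \<in> odo_Y. odo_T x \<in> B} \<inter> odo_Y0)" using T_vimage_M0[of B] by simp
  also have "\<dots> = emeasure \<nu> B" using emeasure_nu_Int[OF emeasure_T(1)[OF Bn]] emeasure_T(2)[OF Bn] by simp
  finally show "emeasure (distr M0 M0 odo_T) B = emeasure M0 B" using emeasure_M0[OF B] by simp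
qed simp

lemma restrict_count_meas: "f \<in> measurable \<mu> (count_space UNIV) \<Longrightarrow> f \<in> measurable M0 (count_space UNIV)"
proof (rule measurableI)
  fix A assume "f \<in> measurable \<mu> (count_space UNIV)"
  hence "f -` A \<inter> odo_X \<in> sets \<mu>" using measurable_sets[of f \<mu> "count_space UNIV" A] by simp
  hence "(f -` A \<inter> odo_X) \<inter> odo_Y0 \<in> sets \<mu>" by auto
  moreover have "(f -` A \<inter> odo_X) \<inter> odo_Y0 = f -` A \<inter> odo_Y0" using Y0_Y odo_Y_X by auto
  ultimately show "f -` A \<inter> space M0 \<in> sets M0" by (simp add: sets_M0)
qed simp

lemma t_meas_M0: "odo_t l \<in> measurable M0 (count_space UNIV)"
  using restrict_count_meas[OF t_meas[of l]] by simp

lemma gen_M0: "sets M0 = sigma_sets (space M0) {{x \<in> space M0. odo_t l x = v} | l v. True}" (is "_ = sigma_sets _ ?G")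
proof
  have "{x \<in> space M0. odo_t l x = v} \<in> sets M0" for l v
    using measurable_sets[OF t_meas_M0[of l], of "{v}"] by (simp add: vimage_def Int_def conj_commute)
  thus "sigma_sets (space M0) ?G \<subseteq> sets M0" by (intro sets.sigma_sets_subset) auto
  have main: "A \<inter> odo_Y0 \<in> sigma_sets odo_Y0 ?G" if "A \<in> sigma_sets odo_X {{x \<in> odo_X. odo_Q x l = v} | l v. True}" for A
    using that
  proof (induction rule: sigma_sets.induct)
    case (Basic a)
    then obtain l v where a: "a = {x \<in> odo_X. odo_Q x l = v}" by blast
    have dec: "odo_Q x l = odo_Q y l" if "x \<in> odo_Y0" "y \<in> odo_Y0" "odo_t l x = odo_t l y" for x y
      using odo_t_decode[of x y l] that Y0_Y odo_Y_X odo_Q_of_P by (metis subsetD)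
    define V where "V = odo_t l ` (a \<inter> odo_Y0)"
    have "a \<inter> odo_Y0 = (\<Union>v\<in>V. {x \<in> space M0. odo_t l x = v})"
    proof (intro set_eqI iffI)
      fix x assume "x \<in> (\<Union>v\<in>V. {x \<in> space M0. odo_t l x = v})"
      then obtain y where y: "x \<in> odo_Y0" "y \<in> a" "y \<in> odo_Y0" "odo_t l x = odo_t l y" by (auto simp: V_def)
      hence "odo_Q x l = odo_Q y l" using dec by blast
      thus "x \<in> a \<inter> odo_Y0" using y Y0_Y odo_Y_X unfolding a by auto
    qed (auto simp: V_def)
    also have "\<dots> \<in> sigma_sets odo_Y0 ?G" by (intro sigma_sets_UNION countable_image) auto
    finally show ?case .
  next
    case Empty show ?case by (simp add: sigma_sets.Empty)
  next
    case (Compl a)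
    have "(odo_X - a) \<inter> odo_Y0 = odo_Y0 - a \<inter> odo_Y0" using Y0_Y odo_Y_X by auto
    thus ?case using sigma_sets.Compl[OF Compl(2)] by simp
  next
    case (Union a)
    have "(\<Union>i. a i) \<inter> odo_Y0 = (\<Union>i. a i \<inter> odo_Y0)" by auto
    thus ?case using sigma_sets.Union[of "\<lambda>i. a i \<inter> odo_Y0"] Union(2) by simp
  qed
  show "sets M0 \<subseteq> sigma_sets (space M0) ?G"
  proof
    fix A assume "A \<in> sets M0"
    hence "A \<in> sigma_sets odo_X {{x \<in> odo_X. odo_Q x l = v} | l v. True}" "A \<subseteq> odo_Y0" using gen_mu by (auto simp: sets_M0)
    thus "A \<in> sigma_sets (space M0) ?G" using main[of A] by (simp add: Int_absorb2)
  qed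
qed

lemma tower_map_M0: "tower_map odo_A odo_Sh M0 odo_t (\<lambda>l x. int (odo_D x l)) odo_T"
proof -
  interpret M0: prob_space M0 by (rule prob_space_M0)
  show ?thesis
  proof
    show "(\<lambda>x. int (odo_D x l)) \<in> measurable M0 (count_space UNIV)" for l
      using measurable_compose[OF restrict_count_meas[OF D_meas[of l]], of int] by simp
    show "odo_T ` space M0 = space M0" using odo_T_bij by (simp add: bij_betw_def)
    show "x = y" if "x \<in> space M0" "y \<in> space M0" "\<And>l. odo_t l x = odo_t l y" for x y
      using odo_t_separates[of x y] that Y0_Y by auto
  qed (use odo_pt Y0_Y t_meas_M0 T_meas_M0 T_distr_M0 odo_T_t gen_M0 in auto)
qed

end

section \<open>Factors\<close>

lemma standard_borel_separating:
  assumes "standard_borel_space M"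
  shows "\<exists>U :: nat \<Rightarrow> 'a set. (\<forall>n. U n \<in> sets M) \<and> (\<forall>x\<in>space M. \<forall>y\<in>space M. (\<forall>n. x \<in> U n \<longleftrightarrow> y \<in> U n) \<longrightarrow> x = y)"
proof -
  obtain \<tau> where \<tau>: "completely_metrizable_space \<tau>" "second_countable \<tau>" "sets M = sets (borel_of_top \<tau>)"
    using assms by (auto simp: standard_borel_space_def)
  have sp: "space M = topspace \<tau>" using sets_eq_imp_space_eq[OF \<tau>(3)] by (simp add: borel_of_top_def space_measure_of_conv)
  have om: "V \<in> sets M" if "openin \<tau> V" for V
  proof -
    have "{U. openin \<tau> U} \<subseteq> Pow (topspace \<tau>)" using openin_subset by auto
    thus ?thesis using that \<tau>(3) by (auto simp: borel_of_top_def)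
  qed
  obtain \<B> where BB: "countable \<B> \<and> (\<forall>V\<in>\<B>. openin \<tau> V) \<and>
      (\<forall>U x. openin \<tau> U \<and> x \<in> U \<longrightarrow> (\<exists>V\<in>\<B>. x \<in> V \<and> V \<subseteq> U))"
    using \<tau>(2) unfolding second_countable_def by (rule exE)
  have B: "countable \<B>" "\<And>V. V \<in> \<B> \<Longrightarrow> openin \<tau> V" using BB by simp_all
  have base: "\<exists>V\<in>\<B>. x \<in> V \<and> V \<subseteq> U" if "openin \<tau> U" "x \<in> U" for U x using BB that by simp
  have H: "Hausdorff_space \<tau>" using \<tau>(1) by (intro metrizable_imp_Hausdorff_space completely_metrizable_imp_metrizable_space)
  define U where "U = from_nat_into (insert {} \<B>)"
  have rng: "range U = insert {} \<B>" unfolding U_def by (rule range_from_nat_into) (use B(1) in auto)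
  have "U n \<in> sets M" for n
  proof -
    have "U n \<in> insert {} \<B>" unfolding rng[symmetric] by blast
    thus ?thesis using om B(2) by auto
  qed
  moreover have "x = y" if xy: "x \<in> space M" "y \<in> space M" "\<forall>n. x \<in> U n \<longleftrightarrow> y \<in> U n" for x y
  proof (rule ccontr)
    assume "x \<noteq> y"
    then obtain V W where VW: "openin \<tau> V" "openin \<tau> W" "x \<in> V" "y \<in> W" "disjnt V W"
      using H xy unfolding Hausdorff_space_def sp by meson
    obtain V' where V': "V' \<in> \<B>" "x \<in> V'" "V' \<subseteq> V" using base[OF VW(1,3)] by blast
    obtain n where "U n = V'" using rng V'(1) by (metis imageE insertI2)
    hence "y \<in> V" using xy(3) V' by auto
    thus False using VW by (auto simp: disjnt_def)
  qed
  ultimately show ?thesis by blast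
qed

lemma equalizer_measurable:
  assumes M: "standard_borel_space M" and f: "f \<in> measurable N M" and g: "g \<in> measurable N M"
  shows "{x \<in> space N. f x = g x} \<in> sets N"
proof -
  obtain U :: "nat \<Rightarrow> _" where U: "\<And>n. U n \<in> sets M" "\<And>x y. x \<in> space M \<Longrightarrow> y \<in> space M \<Longrightarrow> (\<And>n. x \<in> U n \<longleftrightarrow> y \<in> U n) \<Longrightarrow> x = y"
    using standard_borel_separating[OF M] by blast
  have "{x \<in> space N. f x = g x} = (\<Inter>n. {x \<in> space N. f x \<in> U n \<longleftrightarrow> g x \<in> U n})"
  proof (intro set_eqI iffI)
    fix x assume "x \<in> (\<Inter>n. {x \<in> space N. f x \<in> U n \<longleftrightarrow> g x \<in> U n})"
    hence x: "x \<in> space N" "\<And>n. f x \<in> U n \<longleftrightarrow> g x \<in> U n" by auto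
    have "f x = g x" using x measurable_space[OF f x(1)] measurable_space[OF g x(1)] by (intro U(2))
    thus "x \<in> {x \<in> space N. f x = g x}" using x by simp
  qed auto
  moreover have "{x \<in> space N. f x \<in> U n \<longleftrightarrow> g x \<in> U n} \<in> sets N" for n
  proof -
    have m: "f -` U n \<inter> space N \<in> sets N" "g -` U n \<inter> space N \<in> sets N" using measurable_sets f g U(1) by auto
    have "{x \<in> space N. f x \<in> U n \<longleftrightarrow> g x \<in> U n} = space N - sym_diff (f -` U n \<inter> space N) (g -` U n \<inter> space N)" by auto
    also have "\<dots> \<in> sets N" using m by auto
    finally show ?thesis .
  qed
  ultimately show ?thesis by auto
qed

text \<open>Almost every point lies in exactly those sets of a countable separating family that have
  measure 1; by separation there is only one such point.\<close>

lemma zero_one_point_mass: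
  assumes M: "standard_borel_space M" and P: "prob_space M" and zo: "\<And>B. B \<in> sets M \<Longrightarrow> measure M B = 0 \<or> measure M B = 1"
  shows "\<exists>z\<in>space M. AE x in M. x = z"
proof -
  interpret prob_space M by (rule P)
  obtain U :: "nat \<Rightarrow> _" where U: "\<And>n. U n \<in> sets M" "\<And>x y. x \<in> space M \<Longrightarrow> y \<in> space M \<Longrightarrow> (\<And>n. x \<in> U n \<longleftrightarrow> y \<in> U n) \<Longrightarrow> x = y"
    using standard_borel_separating[OF M] by blast
  have "AE x in M. x \<in> U n \<longleftrightarrow> prob (U n) = 1" for n
  proof (cases "prob (U n) = 1")
    case True
    hence "AE x in M. x \<in> U n" by (rule prob_eq_1[OF U(1), THEN iffD1])
    thus ?thesis by (simp add: True)
  next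
    case False
    hence "prob (U n) = 0" using zo[OF U(1)] by blast
    hence "AE x in M. x \<notin> U n" by (rule prob_eq_0[OF U(1), THEN iffD1])
    thus ?thesis by (simp add: False)
  qed
  hence ae: "AE x in M. \<forall>n. x \<in> U n \<longleftrightarrow> prob (U n) = 1" by (simp add: AE_all_countable)
  have "\<exists>z\<in>space M. \<forall>n. z \<in> U n \<longleftrightarrow> prob (U n) = 1"
  proof (rule ccontr)
    assume n: "\<not> ?thesis"
    have "AE x in M. False" using ae AE_space by eventually_elim (use n in blast)
    thus False by simp
  qed
  then obtain z where z: "z \<in> space M" "\<And>n. z \<in> U n \<longleftrightarrow> prob (U n) = 1" by blast
  have "AE x in M. x = z" using ae AE_space
  proof eventually_elim
    case (elim x)
    thus ?case using U(2)[OF elim(2) z(1)] z(2) by blast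
  qed
  thus ?thesis using z(1) by blast
qed

context odometer
begin

lemma AE_T: assumes "AE x in \<nu>. Pr x" shows "AE x in \<nu>. Pr (odo_T x)"
proof -
  have "distr \<nu> \<nu> odo_T = \<nu>"
  proof (rule measure_eqI)
    fix B assume "B \<in> sets (distr \<nu> \<nu> odo_T)"
    hence B: "B \<in> sets \<nu>" by simp
    have "odo_T -` B \<inter> space \<nu> = {x \<in> odo_Y. odo_T x \<in> B}" by auto
    thus "emeasure (distr \<nu> \<nu> odo_T) B = emeasure \<nu> B" using B T_meas_nu emeasure_T(2)[OF B] by (simp add: emeasure_distr)
  qed simp
  with assms have "AE x in distr \<nu> \<nu> odo_T. Pr x" by (simp only:)
  thus ?thesis by (rule AE_distrD[OF T_meas_nu])
qed

lemma trivial_factor: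
  assumes fm: "factor_map \<nu> odo_T \<rho> R \<pi>" and zo: "\<And>B. B \<in> sets \<rho> \<Longrightarrow> measure \<rho> B = 0 \<or> measure \<rho> B = 1"
  shows "one_point_mod_null \<nu> odo_T \<rho> R \<pi>"
proof -
  interpret N: prob_space \<nu> by (rule prob_space_nu)
  have pi: "\<pi> \<in> measurable \<nu> \<rho>" "distr \<nu> \<rho> \<pi> = \<rho>" "AE y in \<nu>. \<pi> (odo_T y) = R (\<pi> y)" "standard_borel_space \<rho>" "prob_space \<rho>"
    using fm by (auto simp: factor_map_def mp_system_def)
  obtain z where z: "z \<in> space \<rho>" "AE x in \<rho>. x = z" using zero_one_point_mass[OF pi(4,5) zo] by blast
  have "AE x in distr \<nu> \<rho> \<pi>. x = z" unfolding pi(2) by (rule z(2))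
  hence a: "AE y in \<nu>. \<pi> y = z" by (rule AE_distrD[OF pi(1)])
  \<comment> \<open>\<open>R\<close> fixes \<open>z\<close> exactly: the equation does not involve
    \<open>y\<close>, and some \<open>y\<close> satisfies all three relations at once.\<close>
  have "AE y in \<nu>. R z = z" using a AE_T[OF a] pi(3) by eventually_elim simp
  hence "R z = z" by simp
  thus ?thesis using fm z(1) a by (auto simp: one_point_mod_null_def)
qed

text \<open>\<open>\<psi>\<close> reads the coordinates of \<open>x\<close> off
  \<open>\<pi> x\<close> and inverts \<open>\<pi>\<close> on the conull set \<open>G\<close>. To get
  invariant domains, \<open>A\<close> collects the points whose whole forward orbit stays in
  \<open>G\<close>. Its image is measurable because it equals \<open>B\<close>, the set of points
  with \<open>\<psi> z\<close> in \<open>A\<close> and \<open>\<pi> (\<psi> z) = z\<close>.\<close>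

lemma generating_factor:
  assumes fm: "factor_map \<nu> odo_T \<rho> R \<pi>"
    and gen: "\<And>i c. \<exists>B\<in>sets \<rho>. AE x in \<nu>. x i = c \<longleftrightarrow> \<pi> x \<in> B"
  shows "iso_mod_null \<nu> odo_T \<rho> R \<pi>"
proof -
  have pi: "\<pi> \<in> measurable \<nu> \<rho>" "distr \<nu> \<rho> \<pi> = \<rho>" "AE y in \<nu>. \<pi> (odo_T y) = R (\<pi> y)" "standard_borel_space \<rho>"
    and R: "R \<in> measurable \<rho> \<rho>"
    using fm by (auto simp: factor_map_def mp_system_def measure_preserving_on_def)
  define C where "C i c = (SOME B. B \<in> sets \<rho> \<and> (AE x in \<nu>. x i = c \<longleftrightarrow> \<pi> x \<in> B))" for i c
  have CC: "C i c \<in> sets \<rho> \<and> (AE x in \<nu>. x i = c \<longleftrightarrow> \<pi> x \<in> C i c)" for i c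
    unfolding C_def by (rule someI_ex) (use gen[of i c] in blast)
  have C: "C i c \<in> sets \<rho>" "AE x in \<nu>. x i = c \<longleftrightarrow> \<pi> x \<in> C i c" for i c
    using CC[of i c] by simp_all
  define \<psi> where "\<psi> z = (\<lambda>i\<in>{1..}. LEAST c. z \<in> C i c)" for z
  define G where "G = {x \<in> odo_Y. (\<forall>i c. x i = c \<longleftrightarrow> \<pi> x \<in> C i c) \<and> \<pi> (odo_T x) = R (\<pi> x)}"
  have G_sets: "G \<in> sets \<nu>"
  proof -
    have c: "{x \<in> odo_Y. x i = c \<longleftrightarrow> \<pi> x \<in> C i c} \<in> sets \<nu>" for i c
    proof -
      have "(\<lambda>x. x i) -` {c} \<inter> odo_X \<in> sets \<mu>" using measurable_sets[OF coord_meas[of i], of "{c}"] by simp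
      hence "((\<lambda>x. x i) -` {c} \<inter> odo_X) \<inter> odo_Y \<in> sets \<nu>" by (auto simp: sets_nu)
      moreover have "\<pi> -` C i c \<inter> odo_Y \<in> sets \<nu>" using measurable_sets[OF pi(1) C(1)[of i c]] by simp
      moreover have "odo_Y \<in> sets \<nu>" using sets.top[of \<nu>] by simp
      moreover have "{x \<in> odo_Y. x i = c \<longleftrightarrow> \<pi> x \<in> C i c} = odo_Y - sym_diff (((\<lambda>x. x i) -` {c} \<inter> odo_X) \<inter> odo_Y) (\<pi> -` C i c \<inter> odo_Y)"
        using odo_Y_X by auto
      ultimately show ?thesis by auto
    qed
    have e: "{x \<in> odo_Y. \<pi> (odo_T x) = R (\<pi> x)} \<in> sets \<nu>"
      using equalizer_measurable[OF pi(4) measurable_compose[OF T_meas_nu pi(1)] measurable_compose[OF pi(1) R]] by simp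
    have Geq: "G = (\<Inter>i. \<Inter>c. {x \<in> odo_Y. x i = c \<longleftrightarrow> \<pi> x \<in> C i c}) \<inter> {x \<in> odo_Y. \<pi> (odo_T x) = R (\<pi> x)}"
      by (auto simp: G_def)
    have "(\<Inter>i. \<Inter>c. {x \<in> odo_Y. x i = c \<longleftrightarrow> \<pi> x \<in> C i c}) \<in> sets \<nu>"
      using c by (intro sets.countable_INT image_subsetI) auto
    thus ?thesis unfolding Geq using e by (rule sets.Int)
  qed
  have G_AE: "AE x in \<nu>. x \<in> G"
  proof -
    have "AE x in \<nu>. \<forall>i c. x i = c \<longleftrightarrow> \<pi> x \<in> C i c" using C(2) by (simp add: AE_all_countable)
    thus ?thesis using pi(3) AE_space by eventually_elim (simp add: G_def)
  qed
  have \<psi>_inv: "\<psi> (\<pi> x) = x" if "x \<in> G" for x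
  proof (rule extensionalityI[of _ "{1..}"])
    show "x \<in> extensional {1..}" using that odo_Y_X odo_X_iff by (auto simp: G_def)
    fix i :: nat assume i: "i \<in> {1..}"
    have "(LEAST c. \<pi> x \<in> C i c) = (LEAST c. x i = c)" using that by (auto simp: G_def)
    also have "\<dots> = x i" by (rule Least_equality) auto
    finally show "\<psi> (\<pi> x) i = x i" using i by (simp add: \<psi>_def)
  qed (simp add: \<psi>_def)
  define A where "A = {x \<in> odo_Y. \<forall>n. (odo_T ^^ n) x \<in> G}"
  have Tn: "(odo_T ^^ n) \<in> measurable \<nu> \<nu>" for n
  proof (induction n)
    case (Suc n) show ?case using measurable_compose[OF Suc T_meas_nu] by (simp add: comp_def)
  qed simp
  have A_sets: "A \<in> sets \<nu>"
  proof -
    have "A = (\<Inter>n. (odo_T ^^ n) -` G \<inter> space \<nu>)" by (auto simp: A_def)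
    also have "\<dots> \<in> sets \<nu>" using measurable_sets[OF Tn G_sets] by (intro sets.countable_INT image_subsetI) auto
    finally show ?thesis .
  qed
  have "AE x in \<nu>. (odo_T ^^ n) x \<in> G" for n
  proof (induction n)
    case (Suc n)
    show ?case using AE_T[OF Suc] by (simp add: funpow_swap1)
  qed (simp add: G_AE)
  hence A_AE: "AE x in \<nu>. x \<in> A"
    using AE_space by (auto simp: A_def AE_all_countable AE_conj_iff)
  have A_null: "emeasure \<nu> (space \<nu> - A) = 0"
  proof -
    have "space \<nu> - A \<in> sets \<nu>" using A_sets by (rule sets.compl_sets)
    moreover have "{x \<in> space \<nu>. \<not> x \<in> A} = space \<nu> - A" by blast
    ultimately show ?thesis using A_AE by (rule AE_iff_measurable[THEN iffD1])
  qed
  have AG: "A \<subseteq> G" and AY: "A \<subseteq> odo_Y" using funpow_0 by (auto simp: A_def) (metis funpow_0)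
  have TA: "odo_T ` A \<subseteq> A"
  proof safe
    fix x assume x: "x \<in> A"
    have "(odo_T ^^ n) (odo_T x) \<in> G" for n
    proof -
      have "(odo_T ^^ Suc n) x \<in> G" using x unfolding A_def by blast
      thus ?thesis by (simp add: funpow_swap1)
    qed
    thus "odo_T x \<in> A" using odo_r(3)[of x] x AY odo_Y_X unfolding A_def by auto
  qed
  \<comment> \<open>Away from the image of \<open>G\<close>, \<open>LEAST\<close> may return a value
    outside the alphabet; \<open>Z\<close> discards such points.\<close>
  define Z where "Z = {z \<in> space \<rho>. \<forall>i\<ge>1. \<psi> z i < odo_a i}"
  have \<psi>_coord: "(\<lambda>z. \<psi> z i) \<in> measurable \<rho> (count_space UNIV)" for i
  proof (cases "i \<in> {1..}")
    case True
    have "(\<lambda>z. LEAST c. z \<in> C i c) \<in> measurable \<rho> (count_space UNIV)"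
      using C(1) by (intro measurable_Least) simp
    thus ?thesis using True by (simp add: \<psi>_def)
  qed (simp add: \<psi>_def)
  have Z_sets: "Z \<in> sets \<rho>"
  proof -
    have "Z = (\<Inter>i. (\<lambda>z. \<psi> z i) -` {c. 1 \<le> i \<longrightarrow> c < odo_a i} \<inter> space \<rho>)" unfolding Z_def by blast
    also have "\<dots> \<in> sets \<rho>"
    proof (rule sets.countable_INT, rule image_subsetI)
      fix i show "(\<lambda>z. \<psi> z i) -` {c. 1 \<le> i \<longrightarrow> c < odo_a i} \<inter> space \<rho> \<in> sets \<rho>"
        by (rule measurable_sets[OF \<psi>_coord]) simp
    qed simp
    finally show ?thesis .
  qed
  have \<psi>X: "\<psi> z \<in> odo_X" if "z \<in> Z" for z using that by (auto simp: Z_def odo_X_iff \<psi>_def)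
  have \<psi>_meas: "\<psi> \<in> measurable (restrict_space \<rho> Z) \<mu>"
  proof -
    have Q: "(\<lambda>z. odo_Q (\<psi> z) l) \<in> measurable \<rho> (count_space UNIV)" for l
    proof (induction l)
      case (Suc l)
      show ?case unfolding odo_Q_Suc using measurable_count_pair[OF Suc \<psi>_coord[of "Suc l"], of "\<lambda>a b. a + b * odo_q l"] .
    qed simp
    have "\<psi> \<in> measurable (restrict_space \<rho> Z) (sigma odo_X {{x \<in> odo_X. odo_Q x l = v} | l v. True})"
    proof (rule measurable_measure_of)
      fix E assume "E \<in> {{x \<in> odo_X. odo_Q x l = v} | l v. True}"
      then obtain l v where E: "E = {x \<in> odo_X. odo_Q x l = v}" by blast
      have "\<psi> -` E \<inter> space (restrict_space \<rho> Z) = (\<lambda>z. odo_Q (\<psi> z) l) -` {v} \<inter> space (restrict_space \<rho> Z)"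
        using \<psi>X by (auto simp: E space_restrict_space)
      also have "\<dots> \<in> sets (restrict_space \<rho> Z)" by (rule measurable_sets[OF measurable_restrict_space1[OF Q]]) simp
      finally show "\<psi> -` E \<inter> space (restrict_space \<rho> Z) \<in> sets (restrict_space \<rho> Z)" .
    qed (use \<psi>X in \<open>auto simp: space_restrict_space\<close>)
    moreover have "sets (sigma odo_X {{x \<in> odo_X. odo_Q x l = v} | l v. True}) = sets \<mu>"
      unfolding gen_mu by (rule sets_measure_of) auto
    ultimately show ?thesis using measurable_cong_sets by blast
  qed
  have ZE: "{z \<in> Z. \<psi> z \<in> E} \<in> sets \<rho>" if "E \<in> sets \<mu>" for E
  proof -
    have "\<psi> -` E \<inter> space (restrict_space \<rho> Z) \<in> sets (restrict_space \<rho> Z)" using measurable_sets[OF \<psi>_meas that] .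
    moreover have "\<psi> -` E \<inter> space (restrict_space \<rho> Z) = {z \<in> Z. \<psi> z \<in> E}"
      using sets.sets_into_space[OF Z_sets] by (auto simp: space_restrict_space)
    ultimately show ?thesis using Z_sets sets_restrict_space_iff[of Z \<rho>] by (simp add: sets.Int)
  qed
  define Z1 where "Z1 = {z \<in> Z. \<psi> z \<in> A}"
  have Z1_sets: "Z1 \<in> sets \<rho>" unfolding Z1_def using ZE A_sets sets_nu by blast
  have Z1sp: "Z1 \<subseteq> space \<rho>" using Z1_sets by (rule sets.sets_into_space)
  have \<psi>_nu: "\<psi> \<in> measurable (restrict_space \<rho> Z1) \<nu>"
  proof (rule measurableI)
    fix z assume "z \<in> space (restrict_space \<rho> Z1)"
    thus "\<psi> z \<in> space \<nu>" using AY by (auto simp: space_restrict_space Z1_def)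
  next
    fix E assume "E \<in> sets \<nu>"
    hence "{z \<in> Z. \<psi> z \<in> E} \<inter> Z1 \<in> sets \<rho>" using ZE Z1_sets sets_nu by blast
    moreover have "\<psi> -` E \<inter> space (restrict_space \<rho> Z1) = {z \<in> Z. \<psi> z \<in> E} \<inter> Z1"
      using Z1sp by (auto simp: space_restrict_space Z1_def)
    ultimately show "\<psi> -` E \<inter> space (restrict_space \<rho> Z1) \<in> sets (restrict_space \<rho> Z1)"
      using Z1_sets sets_restrict_space_iff[of Z1 \<rho>] by (simp add: sets.Int)
  qed
  define B where "B = {z \<in> Z1. \<pi> (\<psi> z) = z}"
  have B_sets: "B \<in> sets \<rho>"
  proof -
    have "{z \<in> space (restrict_space \<rho> Z1). \<pi> (\<psi> z) = z} \<in> sets (restrict_space \<rho> Z1)"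
      by (rule equalizer_measurable[OF pi(4) measurable_compose[OF \<psi>_nu pi(1)] measurable_restrict_space1]) simp
    moreover have "{z \<in> space (restrict_space \<rho> Z1). \<pi> (\<psi> z) = z} = B" using Z1sp by (auto simp: B_def space_restrict_space)
    ultimately show ?thesis using Z1_sets sets_restrict_space_iff[of Z1 \<rho>] by (simp add: sets.Int)
  qed
  have piA: "\<pi> x \<in> B" if x: "x \<in> A" for x
  proof -
    have inv: "\<psi> (\<pi> x) = x" using \<psi>_inv AG x by blast
    have "\<pi> x \<in> space \<rho>" using measurable_space[OF pi(1)] AY x by auto
    moreover have "x \<in> odo_X" using x AY odo_Y_X by blast
    ultimately show ?thesis using x inv by (simp add: B_def Z1_def Z_def odo_X_iff)
  qed
  have AB: "\<pi> ` A = B"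
  proof
    show "B \<subseteq> \<pi> ` A"
    proof
      fix z assume "z \<in> B"
      hence "\<psi> z \<in> A" "\<pi> (\<psi> z) = z" by (auto simp: B_def Z1_def)
      thus "z \<in> \<pi> ` A" by (metis imageI)
    qed
  qed (use piA in auto)
  have inj: "inj_on \<pi> A" using \<psi>_inv AG by (metis inj_on_inverseI subsetD)
  have RB: "R ` B \<subseteq> B"
  proof safe
    fix z assume "z \<in> B"
    then obtain x where x: "x \<in> A" "z = \<pi> x" using AB by blast
    hence "R z = \<pi> (odo_T x)" using AG by (auto simp: G_def)
    thus "R z \<in> B" using piA[of "odo_T x"] TA x(1) by auto
  qed
  have B_null: "emeasure \<rho> (space \<rho> - B) = 0"
  proof -
    have "emeasure \<rho> (space \<rho> - B) = emeasure (distr \<nu> \<rho> \<pi>) (space \<rho> - B)" by (simp only: pi(2))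
    also have "\<dots> = emeasure \<nu> (\<pi> -` (space \<rho> - B) \<inter> space \<nu>)" using B_sets pi(1) by (intro emeasure_distr) auto
    also have "\<dots> \<le> emeasure \<nu> (space \<nu> - A)" using piA sets.compl_sets[OF A_sets] by (intro emeasure_mono) auto
    finally show ?thesis using A_null by simp
  qed
  have BZ1: "B \<subseteq> Z1" by (auto simp: B_def)
  have "\<psi> \<in> measurable (restrict_space (restrict_space \<rho> Z1) B) \<nu>" by (rule measurable_restrict_space1[OF \<psi>_nu])
  moreover have "sets (restrict_space (restrict_space \<rho> Z1) B) = sets (restrict_space \<rho> B)"
    using BZ1 by (simp add: sets_restrict_restrict_space Int_absorb1)
  ultimately have "\<psi> \<in> measurable (restrict_space \<rho> B) \<nu>" using measurable_cong_sets by blast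
  hence \<psi>B: "\<psi> \<in> measurable (restrict_space \<rho> B) (restrict_space \<nu> A)"
    by (rule measurable_restrict_space2[rotated]) (auto simp: space_restrict_space B_def Z1_def)
  have "the_inv_into A \<pi> z = \<psi> z" if zB: "z \<in> B" for z
  proof -
    obtain x where x: "x \<in> A" "z = \<pi> x" using AB zB by blast
    thus ?thesis using the_inv_into_f_f[OF inj x(1)] \<psi>_inv AG by auto
  qed
  hence inv_meas: "the_inv_into A \<pi> \<in> measurable (restrict_space \<rho> B) (restrict_space \<nu> A)"
    using \<psi>B by (subst measurable_cong[of _ _ \<psi>]) (auto simp: space_restrict_space)
  have pi_meas: "\<pi> \<in> measurable (restrict_space \<nu> A) (restrict_space \<rho> B)"
    using piA by (intro measurable_restrict_space3 pi(1)) auto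
  have eqv: "\<forall>y\<in>A. \<pi> (odo_T y) = R (\<pi> y)" using AG by (auto simp: G_def)
  have "bij_betw \<pi> A B" using inj AB by (simp add: bij_betw_def)
  thus ?thesis unfolding iso_mod_null_def
    using fm A_sets A_null TA B_sets B_null RB pi_meas inv_meas eqv by blast
qed

theorem prime:
  assumes fm: "factor_map \<nu> odo_T \<rho> R \<pi>"
  shows "iso_mod_null \<nu> odo_T \<rho> R \<pi> \<or> one_point_mod_null \<nu> odo_T \<rho> R \<pi>"
proof -
  have pi: "\<pi> \<in> measurable \<nu> \<rho>" "distr \<nu> \<rho> \<pi> = \<rho>" "AE y in \<nu>. \<pi> (odo_T y) = R (\<pi> y)"
    and R: "R \<in> measurable \<rho> \<rho>"
    using fm by (auto simp: factor_map_def mp_system_def measure_preserving_on_def)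
  interpret T: tower_map odo_A odo_Sh M0 odo_t "\<lambda>l x. int (odo_D x l)" odo_T by (rule tower_map_M0)
  \<comment> \<open>Preimages are taken up to null sets because \<open>\<pi>\<close> is equivariant
    only almost everywhere; exact preimages need not be stable under \<open>T.TT 1\<close>.\<close>
  define Fs where "Fs = {E \<in> sets M0. \<exists>B\<in>sets \<rho>. AE x in M0. x \<in> E \<longleftrightarrow> \<pi> x \<in> B}"
  have pisp: "AE x in M0. x \<in> odo_Y0 \<and> \<pi> x \<in> space \<rho>"
  proof -
    have "\<pi> x \<in> space \<rho>" if "x \<in> odo_Y0" for x using measurable_space[OF pi(1), of x] that Y0_Y by auto
    thus ?thesis using AE_space[of M0] by (auto elim: eventually_mono)
  qed
  have alg: "sigma_algebra (space M0) Fs"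
    unfolding sigma_algebra_iff2
  proof (intro conjI ballI allI impI)
    show "Fs \<subseteq> Pow (space M0)" using sets.sets_into_space unfolding Fs_def by blast
    show "{} \<in> Fs" unfolding Fs_def by (auto intro: bexI[of _ "{}"])
  next
    fix E assume "E \<in> Fs"
    then obtain B where B: "E \<in> sets M0" "B \<in> sets \<rho>" "AE x in M0. x \<in> E \<longleftrightarrow> \<pi> x \<in> B" by (auto simp: Fs_def)
    have "AE x in M0. x \<in> space M0 - E \<longleftrightarrow> \<pi> x \<in> space \<rho> - B" using B(3) pisp by eventually_elim auto
    thus "space M0 - E \<in> Fs" using B unfolding Fs_def by blast
  next
    fix E :: "nat \<Rightarrow> _" assume "range E \<subseteq> Fs"
    hence ex: "\<exists>B. B \<in> sets \<rho> \<and> (AE x in M0. x \<in> E i \<longleftrightarrow> \<pi> x \<in> B)" and Em: "E i \<in> sets M0" for i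
      unfolding Fs_def by auto
    define B where "B i = (SOME B. B \<in> sets \<rho> \<and> (AE x in M0. x \<in> E i \<longleftrightarrow> \<pi> x \<in> B))" for i
    have B: "B i \<in> sets \<rho>" "AE x in M0. x \<in> E i \<longleftrightarrow> \<pi> x \<in> B i" for i
      using someI_ex[OF ex[of i]] unfolding B_def by simp_all
    have "AE x in M0. \<forall>i. x \<in> E i \<longleftrightarrow> \<pi> x \<in> B i" using B(2) by (simp add: AE_all_countable)
    hence "AE x in M0. x \<in> (\<Union>i. E i) \<longleftrightarrow> \<pi> x \<in> (\<Union>i. B i)" by eventually_elim auto
    moreover have "(\<Union>i. B i) \<in> sets \<rho>" using B(1) by auto
    moreover have "(\<Union>i. E i) \<in> sets M0" using Em by auto
    ultimately show "(\<Union>i. E i) \<in> Fs" unfolding Fs_def by blast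
  qed
  define F where "F = sigma (space M0) Fs"
  have Fpow: "Fs \<subseteq> Pow (space M0)" using sets.sets_into_space unfolding Fs_def by blast
  have sF: "sets F = Fs" unfolding F_def sets_measure_of[OF Fpow] by (rule sigma_algebra.sigma_sets_eq[OF alg])
  have sub: "subalgebra M0 F" unfolding subalgebra_def sF by (simp add: F_def Fs_def space_measure_of_conv)
  have inv: "{x \<in> space M0. T.TT 1 x \<in> E} \<in> sets F" if EF: "E \<in> sets F" for E
  proof -
    obtain B where B: "E \<in> sets M0" "B \<in> sets \<rho>" "AE x in M0. x \<in> E \<longleftrightarrow> \<pi> x \<in> B" using EF unfolding sF Fs_def by blast
    have "AE x in \<nu>. x \<in> E \<longleftrightarrow> \<pi> x \<in> B" using B(3) by (simp only: AE_M0_iff)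
    hence "AE x in \<nu>. odo_T x \<in> E \<longleftrightarrow> \<pi> (odo_T x) \<in> B" by (rule AE_T)
    hence a: "AE x in M0. odo_T x \<in> E \<longleftrightarrow> \<pi> (odo_T x) \<in> B" by (simp only: AE_M0_iff)
    have b: "AE x in M0. \<pi> (odo_T x) = R (\<pi> x)" using pi(3) by (simp only: AE_M0_iff)
    have "AE x in M0. x \<in> {x \<in> space M0. T.TT 1 x \<in> E} \<longleftrightarrow> \<pi> x \<in> R -` B \<inter> space \<rho>"
      using a b pisp by eventually_elim (use T.TT_1 in auto)
    moreover have "R -` B \<inter> space \<rho> \<in> sets \<rho>" using measurable_sets[OF R B(2)] .
    moreover have "{x \<in> space M0. T.TT 1 x \<in> E} \<in> sets M0" by (rule T.pre_sets[OF B(1)])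
    ultimately show ?thesis unfolding sF Fs_def by blast
  qed
  have "(\<forall>B\<in>sets F. measure M0 B = 0 \<or> measure M0 B = 1) \<or>
      (\<forall>l K. \<exists>B\<in>sets F. T.sdiff B {x \<in> space M0. odo_t l x \<in> K} = 0)"
    by (rule T.factor_dichotomy[OF sub]) (rule inv)
  thus ?thesis
  proof
    assume zo: "\<forall>B\<in>sets F. measure M0 B = 0 \<or> measure M0 B = 1"
    have "measure \<rho> B = 0 \<or> measure \<rho> B = 1" if B: "B \<in> sets \<rho>" for B
    proof -
      define E where "E = (\<pi> -` B \<inter> space \<nu>) \<inter> odo_Y0"
      have Em: "\<pi> -` B \<inter> space \<nu> \<in> sets \<nu>" by (rule measurable_sets[OF pi(1) B])
      have EM: "E \<in> sets M0" using Em unfolding E_def by (auto simp: sets_M0 sets_nu)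
      have "AE x in M0. x \<in> E \<longleftrightarrow> \<pi> x \<in> B" using pisp by eventually_elim (use Y0_Y in \<open>auto simp: E_def\<close>)
      hence "E \<in> sets F" using EM B unfolding sF Fs_def by blast
      moreover have "measure M0 E = measure \<rho> B"
      proof -
        have "emeasure M0 E = emeasure \<nu> (\<pi> -` B \<inter> space \<nu>)" using emeasure_M0[OF EM] emeasure_nu_Int[OF Em] by (simp add: E_def)
        also have "\<dots> = emeasure (distr \<nu> \<rho> \<pi>) B" using B pi(1) by (simp add: emeasure_distr)
        finally show ?thesis by (simp only: pi(2) measure_def)
      qed
      ultimately show ?thesis using zo by auto
    qed
    thus ?thesis using trivial_factor[OF fm] by blast
  next
    assume all: "\<forall>l K. \<exists>B\<in>sets F. T.sdiff B {x \<in> space M0. odo_t l x \<in> K} = 0"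
    have "\<exists>B\<in>sets \<rho>. AE x in \<nu>. x i = c \<longleftrightarrow> \<pi> x \<in> B" for i c
    proof -
      have dec: "x i = y i" if xy: "x \<in> odo_Y0" "y \<in> odo_Y0" "odo_t i x = odo_t i y" for x y
      proof (cases i)
        case 0
        have X: "x \<in> odo_X" "y \<in> odo_X" using xy Y0_Y odo_Y_X by auto
        show ?thesis using X 0 by (simp add: odo_X_iff extensional_def)
      next
        case (Suc k)
        have X: "x \<in> odo_X" "y \<in> odo_X" using xy Y0_Y odo_Y_X by auto
        have "odo_P x i = odo_P y i" using odo_t_decode[of x y i] xy Y0_Y by auto
        hence "odo_Q x i = odo_Q y i" using odo_Q_of_P X by simp
        thus ?thesis using odo_Q_Suc_mod_div(2)[OF X(1), of k] odo_Q_Suc_mod_div(2)[OF X(2), of k] Suc by simp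
      qed
      \<comment> \<open>By \<open>dec\<close>, the height at level \<open>i\<close> determines
        coordinate \<open>i\<close>, so on \<open>odo_Y0\<close> the event \<open>x i = c\<close> is
        a union of levels.\<close>
      define K where "K = odo_t i ` {x \<in> odo_Y0. x i = c}"
      have K: "odo_t i x \<in> K \<longleftrightarrow> x i = c" if "x \<in> odo_Y0" for x
      proof
        assume "odo_t i x \<in> K"
        then obtain y where "y \<in> odo_Y0" "y i = c" "odo_t i x = odo_t i y" by (auto simp: K_def)
        thus "x i = c" using dec[OF that] by simp
      qed (use that in \<open>auto simp: K_def\<close>)
      obtain E where E: "E \<in> sets F" "T.sdiff E {x \<in> space M0. odo_t i x \<in> K} = 0" using all by blast
      then obtain B where B: "E \<in> sets M0" "B \<in> sets \<rho>" "AE x in M0. x \<in> E \<longleftrightarrow> \<pi> x \<in> B" unfolding sF Fs_def by blast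
      have m: "{x \<in> space M0. odo_t i x \<in> K} \<in> sets M0"
        using measurable_sets[OF t_meas_M0[of i], of K] by (simp add: vimage_def Int_def conj_commute)
      have "AE x in M0. x \<notin> sym_diff E {x \<in> space M0. odo_t i x \<in> K}"
        using E(2) B(1) m T.prob_eq_0[of "sym_diff E {x \<in> space M0. odo_t i x \<in> K}"] unfolding T.sdiff_def by auto
      hence "AE x in M0. x i = c \<longleftrightarrow> \<pi> x \<in> B" using B(3) pisp
      proof eventually_elim
        case (elim x)
        thus ?case using K[of x] by auto
      qed
      thus ?thesis using B(2) by (auto simp: AE_M0_iff)
    qed
    thus ?thesis using generating_factor[OF fm] by blast
  qed
qed

end

theorem theorem6p1:
  fixes \<mu> :: "(nat \<Rightarrow> nat) measure"
    and \<rho> :: "'z measure" and R :: "'z \<Rightarrow> 'z" and \<pi> :: "(nat \<Rightarrow> nat) \<Rightarrow> 'z"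
  assumes "invariant_odometer_measure \<mu>"
    and "factor_map (normalized_restriction \<mu> odo_Y) odo_T \<rho> R \<pi>"
  shows "iso_mod_null (normalized_restriction \<mu> odo_Y) odo_T \<rho> R \<pi> \<or>
         one_point_mod_null (normalized_restriction \<mu> odo_Y) odo_T \<rho> R \<pi>"
proof -
  interpret odometer \<mu> by unfold_locales (rule assms(1))
  show ?thesis by (rule prime[OF assms(2)])
qed

end
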